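(* Let $r\geq 1$, let $\boldsymbol{n}=(n_1,\dots,n_r)$ and $\boldsymbol{d}=(d_1,\dots,d_r)$ be two $r$-tuples of positive integers with $n_1\leq\dots\leq n_r$ and $d=d_1+\dots+d_r\geq 3$. Let $SV^{\boldsymbol{n}}_{\boldsymbol{d}}\subset\mathbb{P}^N$ be the product $\mathbb{P}^{n_1}\times\dots\times\mathbb{P}^{n_r}$ embedded by the complete linear system $\big|\mathcal{O}_{\mathbb{P}^{n_1}\times\dots\times\mathbb{P}^{n_r}}(d_1,\dots,d_r)\big|$. Write $$d-1=2^{\lambda_1}+\dots+2^{\lambda_s}+\epsilon,$$ with $\lambda_1>\lambda_2>\dots>\lambda_s\geq 1$ and $\epsilon\in\{0,1\}$. Then $SV^{\boldsymbol{n}}_{\boldsymbol{d}}$ is not $h$-defective for every positive integer $$h\leq n_1\big((n_1+1)^{\lambda_1-1}+\dots+(n_1+1)^{\lambda_s-1}\big)+1.$$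
   Context: Everything is over $\mathbb{C}$; varieties are irreducible. Here $N=\prod_{i=1}^r\binom{n_i+d_i}{n_i}-1$. For a non-degenerate variety $X\subset\mathbb{P}^N$ of dimension $n$ and a positive integer $h$, the $h$-secant variety $\mathrm{Sec}_h(X)$ is the Zariski closure in $\mathbb{P}^N$ of the union of all linear spaces spanned by collections of $h$ points of $X$. Its expected dimension is $\mathrm{expdim}(\mathrm{Sec}_h(X))=\min\{nh+h-1,N\}$. The variety $X$ is $h$-defective if $\dim \mathrm{Sec}_h(X)<\mathrm{expdim}(\mathrm{Sec}_h(X))$. *)

theory Defs
  imports
    "HOL-Analysis.Abstract_Topology"
    "HOL-Library.Extended_Nat"
    "HOL-Library.FuncSet"
    "HOL-Library.Function_Algebras"
    "HOL-Library.Multiset"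
begin

section \<open>Projective space over the complex numbers\<close>

text \<open>
  A finite set \<open>I\<close> of coordinate indices gives the vector space of functions into the complex
  numbers supported in \<open>I\<close>, and the projective space of dimension \<open>card I - 1\<close>, whose points are
  the classes of nonzero vectors modulo nonzero scalars.
\<close>

definition cscale :: "complex \<Rightarrow> ('i \<Rightarrow> complex) \<Rightarrow> 'i \<Rightarrow> complex"
  where "cscale c x = (\<lambda>i. c * x i)"

global_interpretation cfun: vector_space cscale
  by standard (auto simp: cscale_def fun_eq_iff algebra_simps)

definition vecs :: "'i set \<Rightarrow> ('i \<Rightarrow> complex) set"
  where "vecs I = {x. \<forall>i. i \<notin> I \<longrightarrow> x i = 0}"

definition proj_point :: "('i \<Rightarrow> complex) \<Rightarrow> ('i \<Rightarrow> complex) set"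
  where "proj_point x = {cscale c x | c. c \<noteq> 0}"

definition proj_space :: "'i set \<Rightarrow> ('i \<Rightarrow> complex) set set"
  where "proj_space I = proj_point ` (vecs I - {0})"

text \<open>
  A multiset of indices encodes the monomial in which each variable occurs with its multiplicity;
  forms of degree \<open>e\<close> are the linear combinations of the monomials of degree \<open>e\<close>. As the field is
  infinite, they are identified with the functions they define.
\<close>

definition mon :: "'i multiset \<Rightarrow> ('i \<Rightarrow> complex) \<Rightarrow> complex"
  where "mon M x = (\<Prod>i\<in>#M. x i)"

definition forms :: "'i set \<Rightarrow> nat \<Rightarrow> (('i \<Rightarrow> complex) \<Rightarrow> complex) set"
  where "forms I e = cfun.span (mon ` multisets_of_size I e)"

definition zero_locus ::
    "'i set \<Rightarrow> (('i \<Rightarrow> complex) \<Rightarrow> complex) set \<Rightarrow> ('i \<Rightarrow> complex) set set"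
  where "zero_locus I S = {p \<in> proj_space I. \<forall>F\<in>S. \<forall>x\<in>p. F x = 0}"

definition zariski :: "'i set \<Rightarrow> ('i \<Rightarrow> complex) set topology"
  where "zariski I =
    topology (\<lambda>U. \<exists>S \<subseteq> (\<Union>e. forms I e). U = proj_space I - zero_locus I S)"

lemma mon_mult: "mon M x * mon M' x = mon (M + M') x"
  by (simp add: mon_def)

lemma forms_mult:
  assumes "F \<in> forms I e" "G \<in> forms I e'"
  shows "(\<lambda>x. F x * G x) \<in> forms I (e + e')"
proof -
  have 1: "(\<lambda>x. mon M x * G x) \<in> forms I (e + e')" if M: "M \<in> multisets_of_size I e" for M
    using assms(2) unfolding forms_def[of I e']
  proof (induction rule: cfun.span_induct_alt)
    case base
    have "(\<lambda>x. mon M x * 0 x) = 0"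
      by (simp add: fun_eq_iff)
    then show ?case
      by (simp add: forms_def cfun.span_zero)
  next
    case (step c f g)
    then obtain M' where M': "f = mon M'" "M' \<in> multisets_of_size I e'"
      by auto
    have "M + M' \<in> multisets_of_size I (e + e')"
      using M M' by (auto simp: multisets_of_size_def)
    then have "cscale c (mon (M + M')) + (\<lambda>x. mon M x * g x) \<in> forms I (e + e')"
      using step.IH unfolding forms_def
      by (intro cfun.span_add cfun.span_scale) (auto intro: cfun.span_base)
    moreover have "cscale c (mon (M + M')) + (\<lambda>x. mon M x * g x)
        = (\<lambda>x. mon M x * (cscale c f + g) x)"
      by (simp add: fun_eq_iff cscale_def M' mon_mult[symmetric] algebra_simps)
    ultimately show ?case
      by simp
  qed
  show ?thesis
    using assms(1) unfolding forms_def[of I e]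
  proof (induction rule: cfun.span_induct_alt)
    case base
    have "(\<lambda>x. 0 x * G x) = 0"
      by (simp add: fun_eq_iff)
    then show ?case
      by (simp add: forms_def cfun.span_zero)
  next
    case (step c f g)
    have "(\<lambda>x. f x * G x) \<in> forms I (e + e')"
      using 1 step.hyps by auto
    then have "cscale c (\<lambda>x. f x * G x) + (\<lambda>x. g x * G x) \<in> forms I (e + e')"
      using step.IH unfolding forms_def by (intro cfun.span_add cfun.span_scale)
    moreover have "cscale c (\<lambda>x. f x * G x) + (\<lambda>x. g x * G x) = (\<lambda>x. (cscale c f + g) x * G x)"
      by (simp add: fun_eq_iff cscale_def algebra_simps)
    ultimately show ?case
      by simp
  qed
qed

lemma mon_cscale: "mon M (cscale c x) = c ^ size M * mon M x"
  by (induction M) (auto simp: mon_def cscale_def)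

lemma forms_cscale:
  assumes "F \<in> forms I e"
  shows "F (cscale c x) = c ^ e * F x"
  using assms unfolding forms_def
proof (induction rule: cfun.span_induct_alt)
  case base
  show ?case by simp
next
  case (step a f g)
  then show ?case
    by (auto simp: multisets_of_size_def mon_cscale cscale_def[of a] algebra_simps)
qed

lemma zero_locus_Un:
  assumes "S \<subseteq> (\<Union>e. forms I e)" "T \<subseteq> (\<Union>e. forms I e)"
  shows "zero_locus I S \<union> zero_locus I T = zero_locus I {\<lambda>x. F x * G x | F G. F \<in> S \<and> G \<in> T}"
    (is "?L = ?R")
proof
  show "?L \<subseteq> ?R"
    by (auto simp: zero_locus_def)
  show "?R \<subseteq> ?L"
  proof
    fix p assume p: "p \<in> ?R"
    then obtain y where y: "p = proj_point y" and pI: "p \<in> proj_space I"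
      by (auto simp: zero_locus_def proj_space_def)
    have yp: "y \<in> p"
      unfolding y proj_point_def by (rule CollectI, rule exI[of _ 1]) (simp add: cscale_def)
    have *: "p \<in> zero_locus I S'" if "S' \<subseteq> (\<Union>e. forms I e)" "\<forall>F\<in>S'. F y = 0" for S'
    proof -
      have "F x = 0" if F: "F \<in> S'" and x: "x \<in> p" for F x
      proof -
        obtain c where "x = cscale c y"
          using x y by (auto simp: proj_point_def)
        moreover obtain e where "F \<in> forms I e"
          using F \<open>S' \<subseteq> (\<Union>e. forms I e)\<close> by blast
        ultimately show ?thesis
          using F \<open>\<forall>F\<in>S'. F y = 0\<close> by (simp add: forms_cscale)
      qed
      then show ?thesis
        using pI by (auto simp: zero_locus_def)
    qed
    show "p \<in> ?L"
    proof (cases "\<forall>F\<in>S. F y = 0")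
      case True
      then show ?thesis using * assms by blast
    next
      case False
      then obtain F where F: "F \<in> S" "F y \<noteq> 0"
        by blast
      have "G y = 0" if "G \<in> T" for G
      proof -
        have "(\<lambda>x. F x * G x) \<in> {\<lambda>x. F x * G x | F G. F \<in> S \<and> G \<in> T}"
          using F that by blast
        then have "F y * G y = 0"
          using p yp unfolding zero_locus_def by fast
        then show ?thesis using F by simp
      qed
      then show ?thesis using * assms by blast
    qed
  qed
qed

lemma istopology_zariski:
  "istopology (\<lambda>U. \<exists>S \<subseteq> (\<Union>e. forms I e). U = proj_space I - zero_locus I S)"
  unfolding istopology_def
proof (intro conjI allI impI)
  fix U V
  assume "\<exists>S \<subseteq> (\<Union>e. forms I e). U = proj_space I - zero_locus I S"
    and "\<exists>S \<subseteq> (\<Union>e. forms I e). V = proj_space I - zero_locus I S"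
  then obtain S T where S: "S \<subseteq> (\<Union>e. forms I e)" "U = proj_space I - zero_locus I S"
    and T: "T \<subseteq> (\<Union>e. forms I e)" "V = proj_space I - zero_locus I T"
    by blast
  have "{\<lambda>x. F x * G x | F G. F \<in> S \<and> G \<in> T} \<subseteq> (\<Union>e. forms I e)"
  proof
    fix H assume "H \<in> {\<lambda>x. F x * G x | F G. F \<in> S \<and> G \<in> T}"
    then obtain F G where H: "H = (\<lambda>x. F x * G x)" "F \<in> S" "G \<in> T"
      by auto
    obtain e e' where "F \<in> forms I e" "G \<in> forms I e'"
      using S(1) T(1) H(2,3) by blast
    then show "H \<in> (\<Union>e. forms I e)"
      unfolding H(1) using forms_mult by blast
  qed
  moreover have "U \<inter> V
      = proj_space I - zero_locus I {\<lambda>x. F x * G x | F G. F \<in> S \<and> G \<in> T}"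
    using zero_locus_Un[OF S(1) T(1)] S T by auto
  ultimately show "\<exists>S \<subseteq> (\<Union>e. forms I e). U \<inter> V = proj_space I - zero_locus I S"
    by blast
next
  fix K
  assume "\<forall>U\<in>K. \<exists>S \<subseteq> (\<Union>e. forms I e). U = proj_space I - zero_locus I S"
  then obtain f where f: "\<And>U. U \<in> K \<Longrightarrow> f U \<subseteq> (\<Union>e. forms I e)"
      "\<And>U. U \<in> K \<Longrightarrow> U = proj_space I - zero_locus I (f U)"
    by metis
  have "\<Union>K = (\<Union>U\<in>K. proj_space I - zero_locus I (f U))"
    using f(2) by auto
  also have "\<dots> = proj_space I - zero_locus I (\<Union>U\<in>K. f U)"
    by (auto simp: zero_locus_def)
  finally show "\<exists>S \<subseteq> (\<Union>e. forms I e). \<Union>K = proj_space I - zero_locus I S"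
    using f(1) by (intro exI[of _ "\<Union>U\<in>K. f U"]) blast
qed

lemma openin_zariski:
  "openin (zariski I) U \<longleftrightarrow> (\<exists>S \<subseteq> (\<Union>e. forms I e). U = proj_space I - zero_locus I S)"
  unfolding zariski_def by (simp add: topology_inverse'[OF istopology_zariski])

lemma topspace_zariski: "topspace (zariski I) = proj_space I"
proof -
  have "mon {#} \<in> forms I 0"
    unfolding forms_def by (intro cfun.span_base) auto
  moreover have "zero_locus I {mon {#}} = {}"
  proof -
    have "p \<noteq> {}" if "p \<in> proj_space I" for p :: "('a \<Rightarrow> complex) set"
      using that zero_neq_one by (fastforce simp: proj_space_def proj_point_def)
    then show ?thesis
      by (auto simp: zero_locus_def mon_def)
  qed
  ultimately have "openin (zariski I) (proj_space I)"
    unfolding openin_zariski by (intro exI[of _ "{mon {#}}"]) auto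
  then show ?thesis
    by (intro antisym openin_subset) (auto simp: topspace_def openin_zariski)
qed

lemma closedin_zariski:
  "closedin (zariski I) Z \<longleftrightarrow> (\<exists>S \<subseteq> (\<Union>e. forms I e). Z = zero_locus I S)"
proof -
  have "zero_locus I S \<subseteq> proj_space I" for S
    by (auto simp: zero_locus_def)
  then show ?thesis
    unfolding closedin_def topspace_zariski openin_zariski
    by (metis double_diff order_refl Diff_subset)
qed

section \<open>Dimension\<close>

definition irreducible_closedin :: "'a topology \<Rightarrow> 'a set \<Rightarrow> bool"
  where "irreducible_closedin T Z \<longleftrightarrow> closedin T Z \<and> Z \<noteq> {} \<and>
    (\<forall>A B. closedin T A \<and> closedin T B \<and> Z = A \<union> B \<longrightarrow> Z = A \<or> Z = B)"

text \<open>The Krull dimension; the empty space gets dimension 0.\<close>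

definition krull_dim :: "'a topology \<Rightarrow> enat"
  where "krull_dim T = Sup {enat k | k. \<exists>Z :: nat \<Rightarrow> 'a set.
    (\<forall>i\<le>k. irreducible_closedin T (Z i)) \<and> (\<forall>i<k. Z i \<subset> Z (Suc i))}"

definition proj_dim :: "'i set \<Rightarrow> ('i \<Rightarrow> complex) set set \<Rightarrow> enat"
  where "proj_dim I X = krull_dim (subtopology (zariski I) X)"

section \<open>Secant varieties\<close>

text \<open>
  The \<open>h\<close> points are not required to be distinct. For \<open>X\<close> with at least \<open>h\<close> points this gives the same
  union, since a smaller collection can be enlarged.
\<close>

definition linear_span :: "'i set \<Rightarrow> ('i \<Rightarrow> complex) set set \<Rightarrow> ('i \<Rightarrow> complex) set set"
  where "linear_span I Q = {p \<in> proj_space I. p \<subseteq> cfun.span (\<Union>Q)}"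

definition secant_variety ::
    "'i set \<Rightarrow> nat \<Rightarrow> ('i \<Rightarrow> complex) set set \<Rightarrow> ('i \<Rightarrow> complex) set set"
  where "secant_variety I h X =
    zariski I closure_of (\<Union>p \<in> {1..h} \<rightarrow> X. linear_span I (p ` {1..h}))"

definition expected_dim :: "'i set \<Rightarrow> nat \<Rightarrow> ('i \<Rightarrow> complex) set set \<Rightarrow> enat"
  where "expected_dim I h X =
    min (proj_dim I X * enat h + enat h - 1) (enat (card I - 1))"

definition defective :: "'i set \<Rightarrow> nat \<Rightarrow> ('i \<Rightarrow> complex) set set \<Rightarrow> bool"
  where "defective I h X \<longleftrightarrow> proj_dim I (secant_variety I h X) < expected_dim I h X"

section \<open>Segre-Veronese varieties\<close>

text \<open>
  The \<open>i\<close>-th factor is the projective space on the coordinates \<open>{0..n i}\<close>, for \<open>i \<in> {1..r}\<close>. The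
  products over \<open>i\<close> of a monomial of degree \<open>d i\<close> in the coordinates of the \<open>i\<close>-th factor form a
  basis of the global sections of the line bundle of multidegree \<open>d\<close>; the embedding by the complete
  linear system is taken with respect to this basis.
\<close>

definition sv_index :: "nat \<Rightarrow> (nat \<Rightarrow> nat) \<Rightarrow> (nat \<Rightarrow> nat) \<Rightarrow> (nat \<Rightarrow> nat multiset) set"
  where "sv_index r n d = (\<Pi>\<^sub>E i\<in>{1..r}. multisets_of_size {0..n i} (d i))"

definition sv_map :: "nat \<Rightarrow> (nat \<Rightarrow> nat) \<Rightarrow> (nat \<Rightarrow> nat) \<Rightarrow>
    (nat \<Rightarrow> nat \<Rightarrow> complex) \<Rightarrow> (nat \<Rightarrow> nat multiset) \<Rightarrow> complex"
  where "sv_map r n d v =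
    (\<lambda>M. if M \<in> sv_index r n d then \<Prod>i=1..r. mon (M i) (v i) else 0)"

definition segre_veronese :: "nat \<Rightarrow> (nat \<Rightarrow> nat) \<Rightarrow> (nat \<Rightarrow> nat) \<Rightarrow>
    ((nat \<Rightarrow> nat multiset) \<Rightarrow> complex) set set"
  where "segre_veronese r n d =
    {proj_point (sv_map r n d v) | v. \<forall>i\<in>{1..r}. v i \<in> vecs {0..n i} - {0}}"

lemma card_sv_index: "card (sv_index r n d) = (\<Prod>i=1..r. (n i + d i) choose n i)"
proof -
  have "card (multisets_of_size {0..m} k) = (m + k) choose m" for m k :: nat
    by (simp add: card_multisets_of_size binomial_symmetric[of m "m + k"])
  then show ?thesis
    by (simp add: sv_index_def card_PiE)
qed

lemma segre_veronese_subset: "segre_veronese r n d \<subseteq> proj_space (sv_index r n d)"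
proof -
  have "sv_map r n d v \<in> vecs (sv_index r n d) - {0}"
    if v: "\<forall>i\<in>{1..r}. v i \<in> vecs {0..n i} - {0}" for v
  proof -
    have "\<forall>i\<in>{1..r}. \<exists>j\<in>{0..n i}. v i j \<noteq> 0"
      using v by (force simp: vecs_def fun_eq_iff)
    then obtain j where j: "\<And>i. i \<in> {1..r} \<Longrightarrow> j i \<in> {0..n i} \<and> v i (j i) \<noteq> 0"
      by metis
    define M where "M = (\<lambda>i\<in>{1..r}. replicate_mset (d i) (j i))"
    have "M \<in> sv_index r n d"
      using j by (force simp: M_def sv_index_def multisets_of_size_def)
    moreover have "mon (M i) (v i) \<noteq> 0" if "i \<in> {1..r}" for i
      using j[OF that] that by (simp add: M_def mon_def)
    ultimately have "sv_map r n d v M \<noteq> 0"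
      by (simp add: sv_map_def)
    then have "sv_map r n d v \<noteq> 0"
      by auto
    then show ?thesis
      by (simp add: vecs_def sv_map_def)
  qed
  then show ?thesis
    by (auto simp: segre_veronese_def proj_space_def)
qed

end

theory Submission
  imports Defs "HOL-Analysis.Derivative" "HOL-Computational_Algebra.Polynomial"
begin

text \<open>
  Dimensions are bounded from below by Terracini's lemma: the span of the first order jets of
  multiforms at \<open>h\<close> points is the tangent space of the cone over the secant variety. The points are
  taken on the small diagonal \<open>P\<^sup>m \<subseteq> P\<^bsup>n1\<^esup> \<times> \<dots> \<times> P\<^bsup>nr\<^esup>\<close>, \<open>m = n1\<close>, where the tangential
  conditions become the double point conditions in \<open>P\<^sup>m\<close> on forms of degree \<open>d\<close>; the normal directions
  only need the points to impose independent simple conditions in degree \<open>d - 2\<close>. For double points in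
  \<open>P\<^sup>m\<close> the required bound follows from a parameter count when \<open>d\<close> is large and from Terracini's
  specialisation to a hyperplane in the remaining cases. The one exception is \<open>m = 2\<close>, \<open>d = 9\<close>,
  \<open>h = 19\<close>, since \<open>3 \<cdot> 19 > 55\<close>: there either the secant variety is the whole space (\<open>r = 1\<close>), or a
  nineteenth point off the diagonal is added, or the points are spread over three coordinate fibres.

  Upper and lower bounds on the Krull dimension come from the correspondence between chains of
  irreducible closed sets and algebraically independent tuples of forms.
\<close>

section \<open>Dual families of linear functionals\<close>

text \<open>The bound on \<open>h\<close> involves only \<open>n 1\<close> and the total degree
  \<open>d\<close>, which suggests the diagonal: multiforms restrict onto all forms of degree
  \<open>d\<close> on \<open>P^m\<close>, and the equations of the diagonal (surplus coordinates,
  2x2 minors), times forms that separate the points, supply the remaining derivatives. The powers of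
  \<open>m + 1\<close> reflect halving: with \<open>t = (d - 1) div 2\<close> the bound is
  \<open>bsum m t + 1\<close>, \<open>bsum\<close> obeys a recursion in \<open>t div 2\<close>, and
  \<open>C(m + 2t, m)\<close> is at least \<open>(m + 1) C(m + t, m)\<close> from
  \<open>m = 2\<close>, \<open>t = 4\<close> on, so a parameter count propagates from
  \<open>t div 2\<close> to \<open>t\<close>. Specialisation is needed where this count has not yet
  taken hold. Independence of conditions is always witnessed by a dual family of forms. This notion
  is open in the points, loses at most one functional per added condition, and bounds dimensions
  from both sides. The expected dimension is computed from the Krull dimension of the variety
  itself, so an upper bound for that is needed besides the lower bound for the secant variety. Both
  rest on growth rates of spaces of forms.\<close>

definition lin_on :: "('a \<Rightarrow> complex) set \<Rightarrow> (('a \<Rightarrow> complex) \<Rightarrow> complex) \<Rightarrow> bool"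
  where "lin_on V l \<longleftrightarrow> (\<forall>F\<in>V. \<forall>G\<in>V. \<forall>c. l (F + cscale c G) = l F + c * l G)"

text \<open>For finite \<open>J\<close> and functionals linear on the subspace \<open>V\<close> this
  is linear independence of their restrictions to \<open>V\<close>. The explicit witnesses are what
  later constructions produce and consume, and indexing by \<open>k\<close> makes a repeated
  functional count as a dependence.\<close>

definition dual_on :: "('a \<Rightarrow> complex) set \<Rightarrow> ('k \<Rightarrow> ('a \<Rightarrow> complex) \<Rightarrow> complex) \<Rightarrow> 'k set \<Rightarrow> bool"
  where "dual_on V L J \<longleftrightarrow>
    (\<exists>F. \<forall>i\<in>J. F i \<in> V \<and> (\<forall>k\<in>J. L k (F i) = (if k = i then 1 else 0)))"

lemma cscale_apply: "cscale c F x = c * F x"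
  by (simp add: cscale_def)

lemma lin_on_mono: "lin_on V l \<Longrightarrow> W \<subseteq> V \<Longrightarrow> lin_on W l"
  unfolding lin_on_def by blast

lemma lin_on_add: "lin_on V l \<Longrightarrow> F \<in> V \<Longrightarrow> G \<in> V \<Longrightarrow> l (F + G) = l F + l G"
proof -
  assume "lin_on V l" "F \<in> V" "G \<in> V"
  then have "l (F + cscale 1 G) = l F + 1 * l G" unfolding lin_on_def by blast
  then show ?thesis by (simp only: cfun.scale_one mult_1)
qed

lemma lin_on_0:
  assumes "lin_on V l" "cfun.subspace V" shows "l 0 = 0"
  using lin_on_add[OF assms(1), of 0 0] cfun.subspace_0[OF assms(2)] by simp

lemma lin_on_scale: "lin_on V l \<Longrightarrow> cfun.subspace V \<Longrightarrow> F \<in> V \<Longrightarrow> l (cscale c F) = c * l F"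
proof -
  assume *: "lin_on V l" "cfun.subspace V" "F \<in> V"
  then have "l (0 + cscale c F) = l 0 + c * l F"
    using cfun.subspace_0[of V] unfolding lin_on_def by blast
  then show ?thesis using lin_on_0[OF *(1,2)] by simp
qed

lemma lin_on_diff:
  assumes "lin_on V l" "F \<in> V" "G \<in> V" shows "l (F - cscale c G) = l F - c * l G"
proof -
  have "F - cscale c G = F + cscale (- c) G" by (simp add: fun_eq_iff cscale_apply)
  moreover have "l (F + cscale (- c) G) = l F + - c * l G"
    using assms unfolding lin_on_def by blast
  ultimately show ?thesis by simp
qed

lemma lin_on_sum:
  assumes l: "lin_on V l" and V: "cfun.subspace V" and F: "\<And>i. i \<in> J \<Longrightarrow> F i \<in> V"
  shows "l (\<Sum>i\<in>J. cscale (c i) (F i)) = (\<Sum>i\<in>J. c i * l (F i))"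
  using F
proof (induction J rule: infinite_finite_induct)
  case (insert x J)
  have "(\<Sum>i\<in>J. cscale (c i) (F i)) \<in> V"
    using insert.prems by (intro cfun.subspace_sum[OF V] cfun.subspace_scale[OF V]) auto
  then have "l (cscale (c x) (F x) + (\<Sum>i\<in>J. cscale (c i) (F i)))
      = c x * l (F x) + l (\<Sum>i\<in>J. cscale (c i) (F i))"
    using insert.prems by (metis lin_on_add[OF l] lin_on_scale[OF l V] cfun.subspace_scale[OF V] insertI1)
  then show ?case using insert by (simp del: plus_fun_apply)
qed (use lin_on_0[OF l V] in auto)

definition kern :: "('a \<Rightarrow> complex) set \<Rightarrow> ('k \<Rightarrow> ('a \<Rightarrow> complex) \<Rightarrow> complex) \<Rightarrow> 'k set \<Rightarrow> ('a \<Rightarrow> complex) set"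
  where "kern V L S = {F\<in>V. \<forall>k\<in>S. L k F = 0}"

lemma kern_subset: "kern V L S \<subseteq> V" by (auto simp: kern_def)

lemma kern_subspace:
  assumes "cfun.subspace V" "\<And>k. k \<in> S \<Longrightarrow> lin_on V (L k)"
  shows "cfun.subspace (kern V L S)"
proof -
  have "L k 0 = 0" if "k \<in> S" for k using lin_on_0 assms that by blast
  moreover have "L k (F + G) = L k F + L k G" if "k \<in> S" "F \<in> V" "G \<in> V" for k F G
    using lin_on_add assms that by blast
  moreover have "L k (cscale c F) = c * L k F" if "k \<in> S" "F \<in> V" for k F c
    using lin_on_scale assms that by blast
  ultimately show ?thesis
    unfolding cfun.subspace_def[of "kern V L S"] using assms(1)
    by (auto simp: kern_def cfun.subspace_0 cfun.subspace_add cfun.subspace_scale)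
qed

lemma dual_on_mono: "dual_on V L J \<Longrightarrow> J' \<subseteq> J \<Longrightarrow> V \<subseteq> W \<Longrightarrow> dual_on W L J'"
  unfolding dual_on_def subset_iff by (elim exE, rule_tac x = F in exI) simp

lemma dual_on_empty [simp]: "dual_on V L {}"
  by (simp add: dual_on_def)

lemma dual_on_cong:
  assumes "\<And>k F. k \<in> J \<Longrightarrow> F \<in> V \<Longrightarrow> L k F = L' k F"
  shows "dual_on V L J = dual_on V L' J"
proof -
  have "(\<forall>i\<in>J. F i \<in> V \<and> (\<forall>k\<in>J. L k (F i) = (if k = i then 1 else 0)))
     = (\<forall>i\<in>J. F i \<in> V \<and> (\<forall>k\<in>J. L' k (F i) = (if k = i then 1 else 0)))" for F
    using assms by (smt (verit))
  then show ?thesis by (simp add: dual_on_def)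
qed

lemma dual_on_reindex:
  assumes "inj_on f J"
  shows "dual_on V L (f ` J) \<longleftrightarrow> dual_on V (\<lambda>k. L (f k)) J"
proof
  assume "dual_on V L (f ` J)"
  then obtain F where F: "\<forall>i\<in>f ` J. F i \<in> V \<and> (\<forall>k\<in>f ` J. L k (F i) = (if k = i then 1 else 0))"
    unfolding dual_on_def by blast
  show "dual_on V (\<lambda>k. L (f k)) J" unfolding dual_on_def
    using F assms by (intro exI[of _ "F \<circ> f"]) (auto simp: inj_on_eq_iff)
next
  assume "dual_on V (\<lambda>k. L (f k)) J"
  then obtain F where F: "\<forall>i\<in>J. F i \<in> V \<and> (\<forall>k\<in>J. L (f k) (F i) = (if k = i then 1 else 0))"
    unfolding dual_on_def by blast
  show "dual_on V L (f ` J)" unfolding dual_on_def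
    using F assms by (intro exI[of _ "F \<circ> the_inv_into J f"]) (auto simp: the_inv_into_f_f inj_on_eq_iff)
qed

lemma dual_on_interp:
  assumes D: "dual_on V L J" and V: "cfun.subspace V" and lin: "\<And>k. k \<in> J \<Longrightarrow> lin_on V (L k)" and fin: "finite J"
  shows "\<exists>F\<in>V. \<forall>k\<in>J. L k F = c k"
proof -
  obtain F where F: "\<forall>i\<in>J. F i \<in> V \<and> (\<forall>k\<in>J. L k (F i) = (if k = i then 1 else 0))"
    using D unfolding dual_on_def by blast
  let ?G = "\<Sum>i\<in>J. cscale (c i) (F i)"
  have "L k ?G = c k" if "k \<in> J" for k
  proof -
    have "L k ?G = (\<Sum>i\<in>J. c i * L k (F i))"
      using F that by (intro lin_on_sum[OF lin V]) auto
    also have "\<dots> = (\<Sum>i\<in>J. if i = k then c i else 0)"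
      using F that by (intro sum.cong) auto
    finally show ?thesis using that fin by simp
  qed
  moreover have "?G \<in> V"
    using F by (intro cfun.subspace_sum[OF V] cfun.subspace_scale[OF V]) auto
  ultimately show ?thesis by blast
qed

text \<open>Subtracting from each member of the first dual family the element of the kernel with the
  same values on \<open>J2\<close> makes it vanish there. This is block triangular elimination: a
  second group of conditions needs to be tested only on elements that satisfy the first.\<close>

lemma dual_on_Un:
  assumes D1: "dual_on V L J1" and D2: "dual_on (kern V L J1) L J2" and dis: "J1 \<inter> J2 = {}"
    and V: "cfun.subspace V" and lin: "\<And>k. k \<in> J1 \<union> J2 \<Longrightarrow> lin_on V (L k)" and fin: "finite J1" "finite J2"
  shows "dual_on V L (J1 \<union> J2)"
proof -
  obtain F where F: "\<forall>i\<in>J1. F i \<in> V \<and> (\<forall>k\<in>J1. L k (F i) = (if k = i then 1 else 0))"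
    using D1 unfolding dual_on_def by blast
  obtain G where G: "\<forall>i\<in>J2. G i \<in> kern V L J1 \<and> (\<forall>k\<in>J2. L k (G i) = (if k = i then 1 else 0))"
    using D2 unfolding dual_on_def by blast
  let ?K = "kern V L J1"
  have K: "cfun.subspace ?K" using V lin by (intro kern_subspace) auto
  have linK: "\<And>k. k \<in> J2 \<Longrightarrow> lin_on ?K (L k)" using lin lin_on_mono[OF _ kern_subset] by blast
  have "\<exists>C\<in>?K. \<forall>k\<in>J2. L k C = L k (F i)" for i
    by (rule dual_on_interp[OF D2 K linK fin(2)])
  then obtain C where C: "\<And>i. C i \<in> ?K" "\<And>i k. k \<in> J2 \<Longrightarrow> L k (C i) = L k (F i)" by metis
  define H where "H i = (if i \<in> J1 then F i - cscale 1 (C i) else G i)" for i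
  have "H i \<in> V \<and> (\<forall>k\<in>J1 \<union> J2. L k (H i) = (if k = i then 1 else 0))" if "i \<in> J1 \<union> J2" for i
  proof (cases "i \<in> J1")
    case True
    have CV: "C i \<in> V" using C(1) kern_subset by blast
    have "H i \<in> V" using True F CV by (simp add: H_def cfun.subspace_diff[OF V])
    moreover have "L k (H i) = L k (F i) - L k (C i)" if "k \<in> J1 \<union> J2" for k
      using lin_on_diff[OF lin[OF that], of "F i" "C i" 1] True F CV by (simp add: H_def)
    moreover have "L k (C i) = 0" if "k \<in> J1" for k using C(1)[of i] that by (auto simp: kern_def)
    ultimately show ?thesis using F True C(2) dis by auto
  next
    case False
    then show ?thesis using that G dis by (auto simp: H_def kern_def)
  qed
  then show ?thesis unfolding dual_on_def by blast
qed

lemma dual_on_insert: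
  assumes D: "dual_on V L J" and G: "G \<in> V" "\<And>k. k \<in> J \<Longrightarrow> L k G = 0" "L s G \<noteq> 0"
    and V: "cfun.subspace V" and lin: "\<And>k. k \<in> insert s J \<Longrightarrow> lin_on V (L k)" and fin: "finite J"
  shows "s \<notin> J" "dual_on V L (insert s J)"
proof -
  show s: "s \<notin> J" using G by blast
  let ?K = "kern V L J"
  have "cscale (1 / L s G) G \<in> ?K" using G lin
    by (auto simp: kern_def cfun.subspace_scale[OF V] lin_on_scale[OF _ V])
  then have "dual_on ?K L {s}" using G lin unfolding dual_on_def
    by (intro exI[of _ "\<lambda>_. cscale (1 / L s G) G"]) (auto simp: lin_on_scale[OF _ V])
  then show "dual_on V L (insert s J)"
    using dual_on_Un[OF D, of "{s}"] s V lin fin by simp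
qed

text \<open>One new condition costs at most one functional: some \<open>F i0\<close> on which the
  condition is nonzero serves as pivot, is subtracted from the others and dropped. Lower bounds for
  dimensions of linear systems come from here.\<close>

lemma dual_on_kern:
  assumes "finite S" "dual_on V L J" "finite J" "cfun.subspace V"
    "\<And>k. k \<in> J \<Longrightarrow> lin_on V (L k)" "\<And>s. s \<in> S \<Longrightarrow> lin_on V (M s)"
  shows "\<exists>J'\<subseteq>J. card J \<le> card J' + card S \<and> dual_on (kern V M S) L J'"
  using assms
proof (induction S rule: finite_induct)
  case empty
  then show ?case by (auto simp: kern_def intro!: exI[of _ J])
next
  case (insert s S)
  let ?K = "kern V M S"
  from insert obtain J1 where J1: "J1 \<subseteq> J" "card J \<le> card J1 + card S" "dual_on ?K L J1" by auto
  have K: "cfun.subspace ?K" using insert.prems by (intro kern_subspace) auto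
  have eq: "kern V M (insert s S) = {F\<in>?K. M s F = 0}" by (auto simp: kern_def)
  have linK: "\<And>k. k \<in> J1 \<Longrightarrow> lin_on ?K (L k)" "lin_on ?K (M s)"
    using insert.prems J1 lin_on_mono[OF _ kern_subset] by blast+
  obtain F where F: "\<forall>i\<in>J1. F i \<in> ?K \<and> (\<forall>k\<in>J1. L k (F i) = (if k = i then 1 else 0))"
    using J1(3) unfolding dual_on_def by blast
  show ?case
  proof (cases "\<forall>i\<in>J1. M s (F i) = 0")
    case True
    then have "dual_on (kern V M (insert s S)) L J1"
      unfolding eq dual_on_def using F by (intro exI[of _ F]) auto
    then show ?thesis using J1 insert.hyps by (intro exI[of _ J1]) auto
  next
    case False
    then obtain i0 where i0: "i0 \<in> J1" "M s (F i0) \<noteq> 0" by blast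
    define G where "G i = F i - cscale (M s (F i) / M s (F i0)) (F i0)" for i
    have "dual_on (kern V M (insert s S)) L (J1 - {i0})"
      unfolding dual_on_def eq
    proof (intro exI[of _ G] ballI conjI)
      fix i assume i: "i \<in> J1 - {i0}"
      show "G i \<in> {F \<in> ?K. M s F = 0}"
      proof -
        have Fi: "F i \<in> ?K" "F i0 \<in> ?K" using i i0 F by blast+
        have "G i \<in> ?K" unfolding G_def
          by (rule cfun.subspace_diff[OF K Fi(1) cfun.subspace_scale[OF K Fi(2)]])
        moreover have "M s (G i) = 0" unfolding G_def lin_on_diff[OF linK(2) Fi] using i0 by simp
        ultimately show ?thesis by blast
      qed
      fix k assume k: "k \<in> J1 - {i0}"
      have "L k (G i) = L k (F i) - M s (F i) / M s (F i0) * L k (F i0)"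
        unfolding G_def using F i i0 k by (intro lin_on_diff[OF linK(1)]) auto
      then show "L k (G i) = (if k = i then 1 else 0)" using F i i0 k by auto
    qed
    moreover have "card J1 \<le> card (J1 - {i0}) + 1" using i0(1) by (simp add: card_Diff_singleton_if)
    ultimately show ?thesis using J1 insert.hyps by (intro exI[of _ "J1 - {i0}"]) auto
  qed
qed

text \<open>Greedy choice. As long as fewer than \<open>u\<close> members of \<open>S\<close> are
  chosen, their common kernel carries more than \<open>nn\<close> independent functionals from
  \<open>L\<close>, while the kernel of all of \<open>S\<close> carries at most \<open>nn\<close>;
  so some member of \<open>S\<close> does not vanish on the former and can be added.\<close>

lemma dual_on_extend:
  assumes D: "dual_on V L J" "finite J" and V: "cfun.subspace V"
    and lin: "\<And>k. k \<in> J \<Longrightarrow> lin_on V (L k)" "\<And>s. s \<in> S \<Longrightarrow> lin_on V (M s)"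
    and D0: "dual_on V M T" "finite T" "T \<subseteq> S"
    and small: "\<And>J'. J' \<subseteq> J \<Longrightarrow> dual_on (kern V M S) L J' \<Longrightarrow> card J' \<le> nn"
    and u: "card T \<le> u" "nn + u \<le> card J"
  shows "\<exists>S1. T \<subseteq> S1 \<and> S1 \<subseteq> S \<and> finite S1 \<and> card S1 = u \<and> dual_on V M S1"
  using u
proof (induction u rule: dec_induct)
  case base
  then show ?case using D0 by blast
next
  case (step u)
  then obtain S1 where S1: "T \<subseteq> S1" "S1 \<subseteq> S" "finite S1" "card S1 = u" "dual_on V M S1" by auto
  have "lin_on V (M s)" if "s \<in> S1" for s using lin(2) S1(2) that by blast
  then have "\<exists>J'\<subseteq>J. card J \<le> card J' + card S1 \<and> dual_on (kern V M S1) L J'"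
    using dual_on_kern[OF S1(3) D V lin(1)] by simp
  then obtain J' where J': "J' \<subseteq> J" "card J \<le> card J' + card S1" "dual_on (kern V M S1) L J'" by blast
  have "\<exists>F\<in>kern V M S1. F \<notin> kern V M S"
  proof (rule ccontr)
    assume "\<not> ?thesis"
    then have "dual_on (kern V M S) L J'" using dual_on_mono[OF J'(3) order_refl] by blast
    then have "card J' \<le> nn" using small J'(1) by blast
    then show False using J'(2) step.prems step.hyps S1(4) by linarith
  qed
  then obtain F where F': "F \<in> kern V M S1" "F \<notin> kern V M S" by blast
  then obtain s where F: "F \<in> V" "\<And>k. k \<in> S1 \<Longrightarrow> M k F = 0" "s \<in> S" "M s F \<noteq> 0"
    unfolding kern_def by blast
  have "\<And>k. k \<in> insert s S1 \<Longrightarrow> lin_on V (M k)" using lin(2) S1(2) F(3) by blast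
  then have "s \<notin> S1 \<and> dual_on V M (insert s S1)"
    using dual_on_insert[OF S1(5) F(1) F(2) F(4) V _ S1(3)] by blast
  then show ?case using S1 F(3) by (intro exI[of _ "insert s S1"]) auto
qed

text \<open>Steinitz exchange: by \<open>dep\<close> the functionals \<open>L\<close> vanish on the
  kernel of \<open>S\<close>, so the greedy choice runs with \<open>nn = 0\<close>. Starting from
  \<open>T\<close> forces prescribed functionals into the result.\<close>

lemma dual_on_exchange:
  assumes D: "dual_on V L J" "finite J" and V: "cfun.subspace V"
    and lin: "\<And>k. k \<in> J \<Longrightarrow> lin_on V (L k)" "\<And>s. s \<in> S \<Longrightarrow> lin_on V (M s)"
    and D0: "dual_on V M T" "finite T" "T \<subseteq> S" "card T \<le> card J"
    and dep: "\<And>F k. F \<in> V \<Longrightarrow> (\<And>s. s \<in> S \<Longrightarrow> M s F = 0) \<Longrightarrow> k \<in> J \<Longrightarrow> L k F = 0"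
  shows "\<exists>S1. T \<subseteq> S1 \<and> S1 \<subseteq> S \<and> finite S1 \<and> card S1 = card J \<and> dual_on V M S1"
proof -
  have "card J' \<le> 0" if J': "J' \<subseteq> J" "dual_on (kern V M S) L J'" for J'
  proof -
    have "J' = {}"
    proof (rule ccontr)
      assume "J' \<noteq> {}"
      then obtain k where k: "k \<in> J'" by blast
      obtain E where "\<forall>i\<in>J'. E i \<in> kern V M S \<and> (\<forall>k\<in>J'. L k (E i) = (if k = i then 1 else 0))"
        using J'(2) unfolding dual_on_def by blast
      with k have "k \<in> J'" "E k \<in> kern V M S" "L k (E k) = 1" by auto
      moreover define F where "F = E k"
      ultimately have "k \<in> J'" "F \<in> kern V M S" "L k F = 1" by auto
      then show False using dep[of F k] J'(1) by (auto simp: kern_def)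
    qed
    then show ?thesis by simp
  qed
  note small = this
  show ?thesis
    by (rule dual_on_extend[where nn = 0 and L = L and M = M and S = S and J = J and V = V and T = T])
       (use assms small in simp_all)
qed

text \<open>The members of the dual family other than \<open>F i\<close> lie in the kernel of
  \<open>L i\<close>, and \<open>F i\<close> does not, so the family is linearly
  independent.\<close>

lemma dual_on_card_le:
  assumes D: "dual_on V L J" and V: "V \<subseteq> cfun.span T" "finite T"
    and lin: "\<And>k. k \<in> J \<Longrightarrow> lin_on (cfun.span T) (L k)"
  shows "finite J \<and> card J \<le> card T"
proof -
  obtain F where F: "\<forall>i\<in>J. F i \<in> V \<and> (\<forall>k\<in>J. L k (F i) = (if k = i then 1 else 0))"
    using D unfolding dual_on_def by blast
  have inj: "inj_on F J" using F by (metis inj_on_def zero_neq_one)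
  have "cfun.independent (F ` J)"
    unfolding cfun.dependent_def
  proof clarify
    fix i assume i: "i \<in> J" "F i \<in> cfun.span (F ` J - {F i})"
    have "F ` J - {F i} \<subseteq> kern (cfun.span T) L {i}"
      using F V i by (auto simp: kern_def)
    moreover have "cfun.subspace (kern (cfun.span T) L {i})"
      using lin i by (intro kern_subspace) auto
    ultimately have "F i \<in> kern (cfun.span T) L {i}"
      using cfun.span_minimal i(2) by blast
    then show False using F i by (auto simp: kern_def)
  qed
  then show ?thesis using cfun.independent_span_bound[OF V(2), of "F ` J"] F V inj
    by (auto simp: card_image finite_image_iff)
qed

section \<open>Polynomial functions and first order jets\<close>

text \<open>Functions rather than formal polynomials, so that composition and restriction need no
  substitution calculus. \<open>I\<close> may be infinite, as each such function involves only
  finitely many variables.\<close>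

inductive polyfun :: "'i set \<Rightarrow> (('i \<Rightarrow> complex) \<Rightarrow> complex) \<Rightarrow> bool" for I where
  const: "polyfun I (\<lambda>_. c)"
| var: "i \<in> I \<Longrightarrow> polyfun I (\<lambda>x. x i)"
| add: "polyfun I F \<Longrightarrow> polyfun I G \<Longrightarrow> polyfun I (\<lambda>x. F x + G x)"
| mult: "polyfun I F \<Longrightarrow> polyfun I G \<Longrightarrow> polyfun I (\<lambda>x. F x * G x)"

lemma polyfun_mono:
  assumes "polyfun I F" "I \<subseteq> J" shows "polyfun J F"
  using assms by (induction) (auto intro: polyfun.intros)

lemma polyfun_cong:
  assumes "polyfun I F" "\<And>i. i \<in> I \<Longrightarrow> x i = y i" shows "F x = F y"
  using assms by (induction) auto

lemma polyfun_minus: "polyfun I F \<Longrightarrow> polyfun I (\<lambda>x. - F x)"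
  using polyfun.mult[OF polyfun.const[of I "-1"]] by force

lemma polyfun_diff: "polyfun I F \<Longrightarrow> polyfun I G \<Longrightarrow> polyfun I (\<lambda>x. F x - G x)"
  using polyfun.add[OF _ polyfun_minus] by force

lemma polyfun_power: "polyfun I F \<Longrightarrow> polyfun I (\<lambda>x. F x ^ n)"
  by (induction n) (auto intro: polyfun.intros)

lemma polyfun_sum: "(\<And>k. k \<in> S \<Longrightarrow> polyfun I (F k)) \<Longrightarrow> polyfun I (\<lambda>x. \<Sum>k\<in>S. F k x)"
  by (induction S rule: infinite_finite_induct) (auto intro: polyfun.intros)

lemma polyfun_prod: "(\<And>k. k \<in> S \<Longrightarrow> polyfun I (F k)) \<Longrightarrow> polyfun I (\<lambda>x. \<Prod>k\<in>S. F k x)"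
  by (induction S rule: infinite_finite_induct) (auto intro: polyfun.intros)

lemma polyfun_comp:
  assumes "polyfun I F" "\<And>i. i \<in> I \<Longrightarrow> polyfun J (\<lambda>y. g y i)"
  shows "polyfun J (\<lambda>y. F (g y))"
  using assms by (induction) (auto intro: polyfun.intros)

text \<open>Density arguments are reduced to one variable here, where a nonzero \<open>poly\<close>
  has only finitely many roots.\<close>

lemma polyfun_curve:
  assumes "polyfun I F" "\<And>i. i \<in> I \<Longrightarrow> \<exists>q. \<forall>t. \<gamma> t i = poly q t"
  shows "\<exists>p. \<forall>t. F (\<gamma> t) = poly p t"
  using assms
proof induction
  case (const c)
  show ?case by (intro exI[of _ "[:c:]"]) auto
next
  case (add F G)
  then obtain p q where "\<forall>t. F (\<gamma> t) = poly p t" "\<forall>t. G (\<gamma> t) = poly q t" by auto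
  then show ?case by (intro exI[of _ "p + q"]) auto
next
  case (mult F G)
  then obtain p q where "\<forall>t. F (\<gamma> t) = poly p t" "\<forall>t. G (\<gamma> t) = poly q t" by auto
  then show ?case by (intro exI[of _ "p * q"]) auto
qed auto

text \<open>On the line through \<open>a\<close> and \<open>b\<close> both functions become nonzero
  polynomials in \<open>t\<close>, and so does their product. This is the irreducibility of affine
  space in the form needed.\<close>

lemma polyfun_common:
  assumes "polyfun I F" "polyfun I G" "F a \<noteq> 0" "G b \<noteq> 0"
  shows "\<exists>t. F (\<lambda>i. a i + t * (b i - a i)) \<noteq> 0 \<and> G (\<lambda>i. a i + t * (b i - a i)) \<noteq> 0"
proof -
  have q: "\<exists>q. \<forall>t. a i + t * (b i - a i) = poly q t" for i
    by (intro exI[of _ "[:a i, b i - a i:]"]) auto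
  obtain p where p: "\<And>t. F (\<lambda>i. a i + t * (b i - a i)) = poly p t"
    using polyfun_curve[OF assms(1), of "\<lambda>t i. a i + t * (b i - a i)"] q by blast
  obtain r where r: "\<And>t. G (\<lambda>i. a i + t * (b i - a i)) = poly r t"
    using polyfun_curve[OF assms(2), of "\<lambda>t i. a i + t * (b i - a i)"] q by blast
  have "poly p 0 \<noteq> 0" "poly r 1 \<noteq> 0" using p[of 0] r[of 1] assms by auto
  then have "p * r \<noteq> 0" by auto
  then obtain t where "poly (p * r) t \<noteq> 0" using poly_all_0_iff_0 by blast
  then show ?thesis using p r by (intro exI[of _ t]) auto
qed

text \<open>Validity on a nonempty principal open set. By \<open>polyfun_common\<close> finitely
  many such sets always meet, so properties known to hold at different vectors can be realised by a
  single one.\<close>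

definition generically :: "(('i \<Rightarrow> complex) \<Rightarrow> bool) \<Rightarrow> bool"
  where "generically P \<longleftrightarrow> (\<exists>D. polyfun UNIV D \<and> (\<exists>y. D y \<noteq> 0) \<and> (\<forall>y. D y \<noteq> 0 \<longrightarrow> P y))"

lemma genericallyI: "polyfun UNIV D \<Longrightarrow> D y \<noteq> 0 \<Longrightarrow> (\<And>y. D y \<noteq> 0 \<Longrightarrow> P y) \<Longrightarrow> generically P"
  unfolding generically_def by (rule exI[of _ D]) auto

lemma generically_ex: "generically P \<Longrightarrow> \<exists>y. P y"
  unfolding generically_def by blast

lemma generically_conj:
  assumes "generically P" "generically Q" shows "generically (\<lambda>y. P y \<and> Q y)"
proof -
  obtain D y where D: "polyfun UNIV D" "D y \<noteq> 0" "\<forall>y. D y \<noteq> 0 \<longrightarrow> P y"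
    using assms(1) unfolding generically_def by blast
  obtain E z where E: "polyfun UNIV E" "E z \<noteq> 0" "\<forall>y. E y \<noteq> 0 \<longrightarrow> Q y"
    using assms(2) unfolding generically_def by blast
  obtain t where "D (\<lambda>i. y i + t * (z i - y i)) \<noteq> 0 \<and> E (\<lambda>i. y i + t * (z i - y i)) \<noteq> 0"
    using polyfun_common[of UNIV D E y z] D E by blast
  moreover have "polyfun UNIV (\<lambda>x. D x * E x)" by (rule polyfun.mult[OF D(1) E(1)])
  ultimately show ?thesis
    by (rule_tac genericallyI[of "\<lambda>x. D x * E x" "\<lambda>i. y i + t * (z i - y i)"]) (use D(3) E(3) in simp_all)
qed

lemma generically_True: "generically (\<lambda>_. True)"
  by (rule genericallyI[of "\<lambda>_. 1"]) (simp_all add: polyfun.const)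

lemma generically_ball: "finite S \<Longrightarrow> (\<And>s. s \<in> S \<Longrightarrow> generically (P s)) \<Longrightarrow> generically (\<lambda>y. \<forall>s\<in>S. P s y)"
proof (induction S rule: finite_induct)
  case empty
  then show ?case using generically_True by simp
next
  case (insert s S)
  have "generically (\<lambda>y. P s y \<and> (\<forall>s\<in>S. P s y))"
    by (rule generically_conj) (use insert in simp_all)
  then show ?case by simp
qed

lemma generically_coord: "generically (\<lambda>y. y i \<noteq> 0)"
  by (rule genericallyI[of "\<lambda>y. y i" "\<lambda>_. 1"]) (simp_all add: polyfun.var)

section \<open>Partial derivatives of polynomial functions\<close>

definition pd :: "'i \<Rightarrow> (('i \<Rightarrow> complex) \<Rightarrow> complex) \<Rightarrow> ('i \<Rightarrow> complex) \<Rightarrow> complex"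
  where "pd b F x = deriv (\<lambda>t. F (x(b := t))) (x b)"

lemma polyfun_differentiable:
  assumes "polyfun I F" shows "(\<lambda>t. F (x(b := t))) field_differentiable (at z)"
  using assms
proof induction
  case (var i)
  show ?case by (cases "i = b") (auto intro: derivative_intros)
qed (auto intro: derivative_intros)

lemma pd_const [simp]: "pd b (\<lambda>_. c) x = 0"
  by (simp add: pd_def)

lemma pd_var [simp]: "pd b (\<lambda>x. x i) x = (if i = b then 1 else 0)"
  by (simp add: pd_def)

lemma pd_add: "polyfun I F \<Longrightarrow> polyfun J G \<Longrightarrow> pd b (\<lambda>x. F x + G x) x = pd b F x + pd b G x"
  by (simp add: pd_def deriv_add polyfun_differentiable)

lemma pd_mult:
  "polyfun I F \<Longrightarrow> polyfun J G \<Longrightarrow> pd b (\<lambda>x. F x * G x) x = F x * pd b G x + pd b F x * G x"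
  by (simp add: pd_def deriv_mult polyfun_differentiable)

lemma pd_cmult: "polyfun I F \<Longrightarrow> pd b (\<lambda>x. c * F x) x = c * pd b F x"
  using pd_mult[OF polyfun.const[of I c]] by fastforce

lemma pd_sum:
  "(\<And>k. k \<in> S \<Longrightarrow> polyfun I (F k)) \<Longrightarrow> pd b (\<lambda>x. \<Sum>k\<in>S. F k x) x = (\<Sum>k\<in>S. pd b (F k) x)"
proof (induction S rule: infinite_finite_induct)
  case (insert k S)
  then show ?case by (simp add: pd_add[OF _ polyfun_sum, of I _ S I])
qed auto

lemma pd_diff: "polyfun I F \<Longrightarrow> polyfun I G \<Longrightarrow> pd b (\<lambda>x. F x - G x) x = pd b F x - pd b G x"
  by (simp add: pd_def deriv_diff polyfun_differentiable)

lemma polyfun_pd: "polyfun I F \<Longrightarrow> polyfun I (pd b F)"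
proof (induction rule: polyfun.induct)
  case (const c)
  have "pd b (\<lambda>_::'a \<Rightarrow> complex. c) = (\<lambda>_. 0)" by auto
  then show ?case by (metis polyfun.const)
next
  case (var i)
  have "pd b (\<lambda>x. x i) = (\<lambda>_. if i = b then 1 else 0)" by auto
  then show ?case by (metis polyfun.const)
next
  case (add F G)
  then have "pd b (\<lambda>x. F x + G x) = (\<lambda>x. pd b F x + pd b G x)" by (auto simp: pd_add)
  then show ?case using add by (auto intro: polyfun.intros)
next
  case (mult F G)
  then have "pd b (\<lambda>x. F x * G x) = (\<lambda>x. F x * pd b G x + pd b F x * G x)" by (auto simp: pd_mult)
  then show ?case using mult by (auto intro: polyfun.intros)
qed

lemma pd_chain:
  assumes "polyfun I F" "finite I" "\<And>i. i \<in> I \<Longrightarrow> polyfun J (\<lambda>y. g y i)"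
  shows "pd a (\<lambda>y. F (g y)) y = (\<Sum>i\<in>I. pd i F (g y) * pd a (\<lambda>y. g y i) y)"
  using assms
proof (induction rule: polyfun.induct)
  case (var i)
  have "(\<Sum>k\<in>I. pd k (\<lambda>x. x i) (g y) * pd a (\<lambda>y. g y k) y)
      = (\<Sum>k\<in>I. if k = i then pd a (\<lambda>y. g y k) y else 0)"
    by (intro sum.cong) auto
  then show ?case using var by simp
next
  case (add F G)
  have "polyfun J (\<lambda>y. F (g y))" "polyfun J (\<lambda>y. G (g y))"
    using add by (auto intro: polyfun_comp)
  then show ?case using add by (simp add: pd_add sum.distrib algebra_simps)
next
  case (mult F G)
  have "polyfun J (\<lambda>y. F (g y))" "polyfun J (\<lambda>y. G (g y))"
    using mult by (auto intro: polyfun_comp)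
  then show ?case using mult
    by (simp add: pd_mult sum.distrib algebra_simps sum_distrib_left)
qed auto

lemma lin_on_eval: "lin_on V (\<lambda>F. F x)"
  by (simp add: lin_on_def cscale_apply)

lemma lin_on_pd: "(\<And>F. F \<in> V \<Longrightarrow> polyfun I F) \<Longrightarrow> lin_on V (\<lambda>F. pd b F x)"
proof (unfold lin_on_def, intro ballI allI)
  fix F G c assume *: "\<And>F. F \<in> V \<Longrightarrow> polyfun I F" "F \<in> V" "G \<in> V"
  have "F + cscale c G = (\<lambda>x. F x + c * G x)" by (simp add: fun_eq_iff cscale_apply)
  moreover have "polyfun I (\<lambda>x. c * G x)" using * by (intro polyfun.intros) auto
  ultimately show "pd b (F + cscale c G) x = pd b F x + c * pd b G x"
    using * by (simp add: pd_add[of I F I] pd_cmult[of I G])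
qed

lemma polyfun_span:
  assumes "\<And>F. F \<in> B \<Longrightarrow> polyfun I F" "F \<in> cfun.span B" shows "polyfun I F"
  using assms(2)
proof (induction rule: cfun.span_induct_alt)
  case base
  show ?case using polyfun.const[of I 0] by (simp add: zero_fun_def)
next
  case (step c F G)
  have "cscale c F + G = (\<lambda>x. c * F x + G x)" by (simp add: fun_eq_iff cscale_apply)
  then show ?case using polyfun.add[OF polyfun.mult[OF polyfun.const assms(1)] step(2)] step(1) by simp
qed

section \<open>Forms and Euler's relation\<close>

lemma mon_empty: "mon {#} = (\<lambda>x. 1)" by (simp add: mon_def fun_eq_iff)
lemma mon_add: "mon (add_mset a M) = (\<lambda>x. x a * mon M x)" by (simp add: mon_def fun_eq_iff)

lemma polyfun_mon: "set_mset M \<subseteq> I \<Longrightarrow> polyfun I (mon M)"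
  by (induction M) (auto simp: mon_empty mon_add intro: polyfun.intros)

lemma polyfun_forms: "F \<in> forms I e \<Longrightarrow> polyfun I F"
  unfolding forms_def
  by (rule polyfun_span) (auto simp: multisets_of_size_def polyfun_mon)

lemma forms_subspace: "cfun.subspace (forms I e)"
  by (simp add: forms_def)

lemma forms_mono: "I \<subseteq> J \<Longrightarrow> forms I e \<subseteq> forms J e"
  unfolding forms_def by (intro cfun.span_mono image_mono multisets_of_size_mono)

lemma forms_add: "F \<in> forms I e \<Longrightarrow> G \<in> forms I e \<Longrightarrow> (\<lambda>x. F x + G x) \<in> forms I e"
  using cfun.subspace_add[OF forms_subspace] by (fastforce simp: plus_fun_def)

lemma forms_cmult: "F \<in> forms I e \<Longrightarrow> (\<lambda>x. c * F x) \<in> forms I e"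
  using cfun.subspace_scale[OF forms_subspace] by (fastforce simp: cscale_def)

lemma forms_diff: "F \<in> forms I e \<Longrightarrow> G \<in> forms I e \<Longrightarrow> (\<lambda>x. F x - G x) \<in> forms I e"
  using forms_add[of F I e "\<lambda>x. - 1 * G x"] forms_cmult[of G I e "-1"] by simp

lemma forms_sum: "(\<And>k. k \<in> S \<Longrightarrow> F k \<in> forms I e) \<Longrightarrow> (\<lambda>x. \<Sum>k\<in>S. F k x) \<in> forms I e"
proof (induction S rule: infinite_finite_induct)
  case (insert k S)
  then show ?case by (auto intro!: forms_add)
qed (use cfun.subspace_0[OF forms_subspace] in \<open>auto simp: zero_fun_def\<close>)

lemma forms_const: "(\<lambda>x. c) \<in> forms I 0"
proof -
  have "mon {#} \<in> forms I 0" unfolding forms_def by (intro cfun.span_base) auto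
  then show ?thesis using forms_cmult[of "mon {#}" I 0 c] by (simp add: mon_empty)
qed

lemma forms_var: "i \<in> I \<Longrightarrow> (\<lambda>x. x i) \<in> forms I 1"
proof -
  assume "i \<in> I"
  then have "mon {#i#} \<in> forms I 1"
    unfolding forms_def by (intro cfun.span_base) (auto simp: multisets_of_size_def)
  moreover have "mon {#i#} = (\<lambda>x. x i)" by (simp add: mon_def fun_eq_iff)
  ultimately show ?thesis by simp
qed

lemma forms_var_mult: "i \<in> I \<Longrightarrow> F \<in> forms I e \<Longrightarrow> (\<lambda>x. x i * F x) \<in> forms I (Suc e)"
  using forms_mult[OF forms_var] by fastforce

lemma forms_prod:
  "(\<And>k. k \<in> S \<Longrightarrow> F k \<in> forms I (e k)) \<Longrightarrow> (\<lambda>x. \<Prod>k\<in>S. F k x) \<in> forms I (\<Sum>k\<in>S. e k)"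
proof (induction S rule: infinite_finite_induct)
  case (insert k S)
  then show ?case using forms_mult[of "F k" I "e k"] by simp
qed (auto simp: forms_const)

lemma forms_power: "F \<in> forms I e \<Longrightarrow> (\<lambda>x. F x ^ k) \<in> forms I (k * e)"
  using forms_prod[of "{..<k}" "\<lambda>_. F" I "\<lambda>_. e"] by simp

lemma forms_euler:
  assumes "F \<in> forms I e" "finite I"
  shows "(\<Sum>a\<in>I. x a * pd a F x) = of_nat e * F x"
proof -
\<comment> \<open>\<open>polyfun I F\<close> is carried through the induction, because the sum rule
  for \<open>pd\<close> is available only for polynomial functions.\<close>
have "polyfun I F \<and> (\<Sum>a\<in>I. x a * pd a F x) = of_nat e * F x"
  using assms(1) unfolding forms_def
proof (induction rule: cfun.span_induct_alt)
  case base
  have "pd a (0 :: ('a \<Rightarrow> complex) \<Rightarrow> complex) x = 0" for a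
    using pd_const[of a 0] by (simp add: zero_fun_def)
  then show ?case using polyfun.const[of I 0] by (simp add: zero_fun_def)
next
  case (step c f g)
  then obtain M where M: "f = mon M" "set_mset M \<subseteq> I" "size M = e" by (auto simp: multisets_of_size_def)
  have "(\<Sum>a\<in>I. x a * pd a (mon M) x) = of_nat (size M) * mon M x"
    using M(2)
  proof (induction M)
    case empty
    then show ?case by (simp add: mon_empty)
  next
    case (add b M)
    have p: "polyfun I (mon M)" using add by (intro polyfun_mon) auto
    have b: "polyfun I (\<lambda>x. x b)" using add by (intro polyfun.var) auto
    have "(\<Sum>a\<in>I. x a * pd a (mon (add_mset b M)) x)
      = (\<Sum>a\<in>I. x b * (x a * pd a (mon M) x) + (if a = b then x b * mon M x else 0))"
      unfolding mon_add by (intro sum.cong) (auto simp: pd_mult[OF b p] algebra_simps)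
    also have "\<dots> = x b * (\<Sum>a\<in>I. x a * pd a (mon M) x) + x b * mon M x"
      using add.prems assms(2) by (simp add: sum.distrib sum_distrib_left)
    finally show ?case using add by (simp add: mon_add algebra_simps)
  qed
  moreover have g: "polyfun I g" using step by blast
  moreover have sm: "polyfun I (cscale c f + g)"
  proof -
    have "cscale c f + g = (\<lambda>x. c * f x + g x)" by (simp add: fun_eq_iff cscale_apply)
    then show ?thesis using polyfun.add[OF polyfun.mult[OF polyfun.const polyfun_mon[OF M(2)]] g] M(1) by simp
  qed
  moreover have "pd a (cscale c f + g) x = c * pd a f x + pd a g x" for a
  proof -
    have "cscale c f + g = (\<lambda>x. c * f x + g x)" by (simp add: fun_eq_iff cscale_apply)
    moreover have "polyfun I f" using M polyfun_mon by auto
    ultimately show ?thesis using g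
      by (simp add: pd_add[OF polyfun.mult[OF polyfun.const]] pd_cmult)
  qed
  moreover have "(\<Sum>a\<in>I. x a * pd a (cscale c f + g) x) = of_nat e * (cscale c f + g) x"
    using step M calculation
    by (simp add: algebra_simps sum.distrib sum_distrib_left cscale_apply)
       (simp add: algebra_simps flip: sum_distrib_left)
  ultimately show ?case by blast
qed
then show ?thesis by blast
qed

text \<open>\<open>None\<close> is the value and \<open>Some b\<close> a first derivative, so that
  one index type describes simple and double point conditions alike.\<close>

primrec jet :: "('i \<Rightarrow> complex) \<Rightarrow> 'i option \<Rightarrow> (('i \<Rightarrow> complex) \<Rightarrow> complex) \<Rightarrow> complex" where
  "jet x None F = F x"
| "jet x (Some b) F = pd b F x"

lemma lin_on_jet: "(\<And>F. F \<in> V \<Longrightarrow> polyfun I F) \<Longrightarrow> lin_on V (jet x k)"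
  by (cases k) (simp_all add: lin_on_eval lin_on_pd[of V I] del: split_paired_All, unfold jet.simps, auto simp: lin_on_eval lin_on_pd[of V I])

lemma polyfun_jet:
  assumes "polyfun I F" "\<And>i. i \<in> I \<Longrightarrow> polyfun J (\<lambda>y. g y i)"
  shows "polyfun J (\<lambda>y. jet (g y) k F)"
proof (cases k)
  case None
  then show ?thesis using polyfun_comp[OF assms] by simp
next
  case (Some b)
  then show ?thesis using polyfun_comp[OF polyfun_pd[OF assms(1)] assms(2)] by simp
qed

text \<open>Gaussian elimination with polynomial entries: no division is carried out until the end.\<close>

lemma generically_dual:
  fixes V :: "('a \<Rightarrow> complex) set" and L :: "('i \<Rightarrow> complex) \<Rightarrow> 'k \<Rightarrow> ('a \<Rightarrow> complex) \<Rightarrow> complex"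
  assumes J: "finite J" and V: "cfun.subspace V"
    and lin: "\<And>k y. k \<in> J \<Longrightarrow> lin_on V (L y k)"
    and pol: "\<And>k F. k \<in> J \<Longrightarrow> F \<in> V \<Longrightarrow> polyfun UNIV (\<lambda>y. L y k F)"
    and dual: "dual_on V (L y0) J"
  shows "generically (\<lambda>y. dual_on V (L y) J)"
proof -
  obtain E where E: "\<forall>i\<in>J. E i \<in> V \<and> (\<forall>k\<in>J. L y0 k (E i) = (if k = i then 1 else 0))"
    using dual unfolding dual_on_def by (rule exE)
  define good where "good G \<longleftrightarrow> (\<forall>y. G y \<in> V) \<and> (\<forall>k\<in>J. polyfun UNIV (\<lambda>y. L y k (G y)))" for G
  have good_comb: "good (\<lambda>y. cscale (c y) (G y) - cscale (e y) (H y))" (is ?g)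
    and L_comb: "\<And>k y. k \<in> J \<Longrightarrow> L y k (cscale (c y) (G y) - cscale (e y) (H y)) = c y * L y k (G y) - e y * L y k (H y)"
    if "good G" "good H" "polyfun UNIV c" "polyfun UNIV e" for G H c e
  proof -
    have GH: "G y \<in> V" "H y \<in> V" for y using that by (auto simp: good_def)
    show L: "L y k (cscale (c y) (G y) - cscale (e y) (H y)) = c y * L y k (G y) - e y * L y k (H y)"
      if "k \<in> J" for k y
      using lin_on_diff[OF lin[OF that] cfun.subspace_scale[OF V GH(1)] GH(2), of y "c y" y "e y" y]
        lin_on_scale[OF lin[OF that] V GH(1), of y "c y" y] by simp
    have "polyfun UNIV (\<lambda>y. c y * L y k (G y) - e y * L y k (H y))" if "k \<in> J" for k
      using \<open>good G\<close> \<open>good H\<close> that \<open>polyfun UNIV c\<close> \<open>polyfun UNIV e\<close>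
      by (intro polyfun_diff polyfun.mult) (auto simp: good_def)
    moreover have "cscale (c y) (G y) - cscale (e y) (H y) \<in> V" for y
      by (intro cfun.subspace_diff[OF V] cfun.subspace_scale[OF V] GH)
    ultimately show ?g unfolding good_def using L by simp
  qed
  have good_sum: "good (\<lambda>y. \<Sum>i\<in>S. cscale (c i y) (F i y))" (is ?g)
    and L_sum: "\<And>k y. k \<in> J \<Longrightarrow> L y k (\<Sum>i\<in>S. cscale (c i y) (F i y)) = (\<Sum>i\<in>S. c i y * L y k (F i y))"
    if S: "\<And>i. i \<in> S \<Longrightarrow> good (F i)" "\<And>i. i \<in> S \<Longrightarrow> polyfun UNIV (c i)" for S :: "'k set" and F c
  proof -
    have F: "F i y \<in> V" if "i \<in> S" for i y using S(1)[OF that] by (auto simp: good_def)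
    show L: "L y k (\<Sum>i\<in>S. cscale (c i y) (F i y)) = (\<Sum>i\<in>S. c i y * L y k (F i y))"
      if "k \<in> J" for k y
      by (rule lin_on_sum[OF lin[OF that] V]) (use F in auto)
    have "polyfun UNIV (\<lambda>y. \<Sum>i\<in>S. c i y * L y k (F i y))" if "k \<in> J" for k
      using S that by (intro polyfun_sum polyfun.mult) (auto simp: good_def)
    moreover have "(\<Sum>i\<in>S. cscale (c i y) (F i y)) \<in> V" for y
      by (intro cfun.subspace_sum[OF V] cfun.subspace_scale[OF V] F)
    ultimately show ?g unfolding good_def using L by simp
  qed
  have goodE: "good (\<lambda>_. E i)" if "i \<in> J" for i
    using E pol that by (auto simp: good_def)
  \<comment> \<open>Invariant of the elimination: the values of \<open>Fam\<close> are polynomial in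
    \<open>y\<close>, and on \<open>S\<close> their matrix is \<open>D y\<close> times the identity,
    with \<open>D\<close> nonzero at \<open>y0\<close>.\<close>
  have "\<exists>D Fam. polyfun UNIV D \<and> D y0 \<noteq> 0 \<and>
      (\<forall>i\<in>S. good (Fam i) \<and> (\<forall>k\<in>S. \<forall>y. L y k (Fam i y) = (if k = i then D y else 0)))" if "S \<subseteq> J" for S
    using finite_subset[OF that J] that
  proof (induction S rule: finite_induct)
    case empty
    show ?case by (rule exI[of _ "\<lambda>_. 1"]) (simp add: polyfun.const)
  next
    case (insert k0 S)
    then have "\<exists>D Fam. polyfun UNIV D \<and> D y0 \<noteq> 0 \<and>
      (\<forall>i\<in>S. good (Fam i) \<and> (\<forall>k\<in>S. \<forall>y. L y k (Fam i y) = (if k = i then D y else 0)))" by simp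
    then obtain D Fam where D: "polyfun UNIV D" "D y0 \<noteq> 0"
      and F0: "\<forall>i\<in>S. good (Fam i) \<and> (\<forall>k\<in>S. \<forall>y. L y k (Fam i y) = (if k = i then D y else 0))"
      by (elim exE conjE)
    have F: "good (Fam i)" if "i \<in> S" for i using F0 that by blast
    have FL: "L y k (Fam i y) = (if k = i then D y else 0)" if "i \<in> S" "k \<in> S" for i k y
      using F0 that by blast
    have k0: "k0 \<in> J" "k0 \<notin> S" and SJ: "S \<subseteq> J" using insert by auto
    have polE: "polyfun UNIV (\<lambda>y. L y i (E k0))" if "i \<in> S" for i using pol E k0 SJ that by auto
    define T where "T y = (\<Sum>i\<in>S. cscale (L y i (E k0)) (Fam i y))" for y
    have gT: "good T" unfolding T_def[abs_def] by (rule good_sum) (use F polE in auto)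
    have LT: "L y k (T y) = (\<Sum>i\<in>S. L y i (E k0) * L y k (Fam i y))" if "k \<in> J" for k y
      unfolding T_def by (rule L_sum[OF _ _ that]) (use F polE in auto)
    \<comment> \<open>\<open>D y\<close> times the projection of \<open>E k0\<close> to the common
      kernel of \<open>S\<close>; the factor replaces a division.\<close>
    define G where "G y = cscale (D y) (E k0) - cscale 1 (T y)" for y
    have gG: "good G" unfolding G_def[abs_def]
      by (rule good_comb[OF goodE[OF k0(1)] gT D(1) polyfun.const])
    have LG: "L y k (G y) = D y * L y k (E k0) - L y k (T y)" if "k \<in> J" for k y
      unfolding G_def using L_comb[OF goodE[OF k0(1)] gT D(1) polyfun.const that, of y 1] by simp
    have G0: "L y k (G y) = 0" if "k \<in> S" for k y
    proof -
      have "L y k (T y) = (\<Sum>i\<in>S. if i = k then L y i (E k0) * D y else 0)"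
      proof -
        have "L y k (T y) = (\<Sum>i\<in>S. L y i (E k0) * L y k (Fam i y))" using LT that SJ by blast
        also have "\<dots> = (\<Sum>i\<in>S. if i = k then L y i (E k0) * D y else 0)"
          using FL that by (intro sum.cong) auto
        finally show ?thesis .
      qed
      then show ?thesis using LG[of k y] that SJ insert.hyps by auto
    qed
    define c where "c y = L y k0 (G y)" for y
    have c: "polyfun UNIV c" using gG k0 by (auto simp: good_def c_def[abs_def])
    have "L y0 k0 (T y0) = 0" using LT[of k0 y0] k0 E SJ by (auto intro!: sum.neutral)
    then have c0: "c y0 = D y0" using LG[of k0 y0] k0 E by (simp add: c_def)
    have pF: "polyfun UNIV (\<lambda>y. L y k0 (Fam i y))" if "i \<in> S" for i
      using F[OF that] k0 by (auto simp: good_def)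
    \<comment> \<open>The new common diagonal value is \<open>D y * c y\<close>: \<open>G\<close> is
      multiplied by \<open>D y\<close>, and the old members by \<open>c y\<close> before their value
      at \<open>k0\<close> is cleared. The term \<open>cscale 0 (G y)\<close> gives the first case
      the shape of \<open>good_comb\<close>.\<close>
    define Fam' where "Fam' i = (if i = k0 then (\<lambda>y. cscale (D y) (G y) - cscale 0 (G y))
        else (\<lambda>y. cscale (c y) (Fam i y) - cscale (L y k0 (Fam i y)) (G y)))" for i
    have L1: "L y k (Fam' k0 y) = D y * L y k (G y)" if "k \<in> J" for k y
      using L_comb[OF gG gG D(1) polyfun.const that, of y 0] by (simp add: Fam'_def)
    have L2: "L y k (Fam' i y) = c y * L y k (Fam i y) - L y k0 (Fam i y) * L y k (G y)"
      if "k \<in> J" "i \<in> S" for k i y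
      using L_comb[OF F[OF that(2)] gG c pF[OF that(2)] that(1), of y] k0 that(2) by (auto simp: Fam'_def)
    have "good (Fam' i)" if "i \<in> insert k0 S" for i
      using that good_comb[OF gG gG D(1) polyfun.const[of UNIV 0]] good_comb[OF F gG c pF]
      by (auto simp: Fam'_def)
    moreover have "L y k (Fam' i y) = (if k = i then D y * c y else 0)"
      if ik: "i \<in> insert k0 S" "k \<in> insert k0 S" for i k y
    proof (cases "i = k0")
      case True
      then show ?thesis using L1[of k y] ik k0 SJ G0[of k y] by (auto simp: c_def)
    next
      case False
      then have "i \<in> S" using ik by auto
      then show ?thesis using L2[of k i y] ik k0 SJ G0[of k y] FL[of i k y] by (auto simp: c_def)
    qed
    moreover have "polyfun UNIV (\<lambda>y. D y * c y)" by (rule polyfun.mult[OF D(1) c])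
    ultimately show ?case using D(2) c0
      by (intro exI[of _ "\<lambda>y. D y * c y"] exI[of _ Fam']) auto
  qed
  then obtain D Fam where D: "polyfun UNIV D" "D y0 \<noteq> 0"
      and F: "\<forall>i\<in>J. good (Fam i) \<and> (\<forall>k\<in>J. \<forall>y. L y k (Fam i y) = (if k = i then D y else 0))"
    by blast
  have "dual_on V (L y) J" if "D y \<noteq> 0" for y
    unfolding dual_on_def
  proof (intro exI[of _ "\<lambda>i. cscale (1 / D y) (Fam i y)"] ballI conjI)
    fix i assume i: "i \<in> J"
    then have FV: "Fam i y \<in> V" using F by (auto simp: good_def)
    then show "cscale (1 / D y) (Fam i y) \<in> V" by (rule cfun.subspace_scale[OF V])
    fix k assume k: "k \<in> J"
    show "L y k (cscale (1 / D y) (Fam i y)) = (if k = i then 1 else 0)"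
      using lin_on_scale[OF lin[OF k] V FV] F i k that by auto
  qed
  then show ?thesis by (rule genericallyI[of D y0, OF D])
qed

text \<open>The principal lattice: at a point with coordinates \<open>count M' i\<close>, whose sum
  is \<open>d\<close>, the linear form \<open>x i - (s / d) * (sum of x)\<close> takes the value
  \<open>count M' i - s\<close>. The product over \<open>s < count M i\<close> kills every lattice
  point with \<open>count M' i < count M i\<close>, and two different multisets of equal size always
  have such an \<open>i\<close>.\<close>

lemma forms_lattice_dual:
  assumes I: "finite I"
  shows "dual_on (forms I d) (\<lambda>M F. F (\<lambda>i. of_nat (count M i))) (multisets_of_size I d)"
proof -
  have cnt: "(\<Sum>i\<in>I. count M i) = d" if "M \<in> multisets_of_size I d" for M
  proof -
    have "size M = (\<Sum>i\<in>set_mset M. count M i)" by (simp add: size_multiset_overloaded_eq)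
    also have "\<dots> = (\<Sum>i\<in>I. count M i)"
      using that I by (intro sum.mono_neutral_left) (auto simp: multisets_of_size_def count_eq_zero_iff)
    finally show ?thesis using that by (simp add: multisets_of_size_def)
  qed
  define P where "P M x = (\<Prod>i\<in>I. \<Prod>s<count M i. x i - (of_nat s / of_nat d) * (\<Sum>k\<in>I. x k))"
    for M :: "'a multiset" and x :: "'a \<Rightarrow> complex"
  have P: "P M \<in> forms I d" if "M \<in> multisets_of_size I d" for M
  proof -
    have sm: "(\<lambda>x. \<Sum>k\<in>I. x k) \<in> forms I 1" by (intro forms_sum forms_var)
    have "(\<lambda>x. x i - (of_nat s / of_nat d) * (\<Sum>k\<in>I. x k)) \<in> forms I 1" if "i \<in> I" for i and s :: nat
      by (rule forms_diff[OF forms_var[OF that] forms_cmult[OF sm]])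
    then have "(\<lambda>x. \<Prod>s<count M i. x i - (of_nat s / of_nat d) * (\<Sum>k\<in>I. x k)) \<in> forms I (\<Sum>s<count M i. 1)"
      if "i \<in> I" for i by (rule forms_prod) (use that in auto)
    then have "(\<lambda>x. \<Prod>i\<in>I. \<Prod>s<count M i. x i - (of_nat s / of_nat d) * (\<Sum>k\<in>I. x k)) \<in> forms I (\<Sum>i\<in>I. \<Sum>s<count M i. 1)"
      by (rule forms_prod)
    then show ?thesis unfolding P_def[abs_def] using cnt[OF that] by simp
  qed
  have val: "P M (\<lambda>i. of_nat (count M' i)) = (\<Prod>i\<in>I. \<Prod>s<count M i. of_nat (count M' i) - of_nat s)"
    if "M \<in> multisets_of_size I d" "M' \<in> multisets_of_size I d" for M M'
  \<comment> \<open>For \<open>d = 0\<close> the quotient \<open>of_nat s / of_nat d\<close> is a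
    default value, but then all products over \<open>s\<close> are empty.\<close>
  proof (cases "d = 0")
    case True
    then have "count M i = 0" if "i \<in> I" for i using cnt[OF \<open>M \<in> _\<close>] I that by auto
    then show ?thesis by (simp add: P_def)
  next
    case False
    have "(\<Sum>k\<in>I. of_nat (count M' k)) = (of_nat d :: complex)" using cnt[OF that(2)] by (metis of_nat_sum)
    then show ?thesis using False by (simp add: P_def)
  qed
  have diag: "P M (\<lambda>i. of_nat (count M i)) \<noteq> 0" if "M \<in> multisets_of_size I d" for M
    unfolding val[OF that that] using I by auto
  have off: "P M (\<lambda>i. of_nat (count M' i)) = 0"
    if "M \<in> multisets_of_size I d" "M' \<in> multisets_of_size I d" "M \<noteq> M'" for M M'
  proof -
    have "\<exists>i\<in>I. count M' i < count M i"
    proof (rule ccontr)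
      assume "\<not> ?thesis"
      then have le: "count M i \<le> count M' i" if "i \<in> I" for i using that by (meson not_le)
      have "count M i \<le> count M' i" for i
      proof (cases "i \<in> I")
        case False
        then have "i \<notin># M" using that(1) by (auto simp: multisets_of_size_def)
        then show ?thesis by (simp add: not_in_iff)
      qed (rule le)
      then have "M \<subseteq># M'" by (simp add: subseteq_mset_def)
      moreover have "size M = size M'" using that by (simp add: multisets_of_size_def)
      ultimately show False using that(3) by (metis mset_subset_size nat_less_le subset_mset.le_less)
    qed
    then obtain i where i: "i \<in> I" "count M' i < count M i" by blast
    then have "(\<Prod>s<count M i. of_nat (count M' i) - of_nat s) = (0 :: complex)"
      by (intro prod_zero) auto
    then show ?thesis unfolding val[OF that(1,2)] using i I by (intro prod_zero) auto
  qed
  show ?thesis unfolding dual_on_def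
  proof (intro exI[of _ "\<lambda>M x. (1 / P M (\<lambda>i. of_nat (count M i))) * P M x"] ballI conjI)
    fix M assume M: "M \<in> multisets_of_size I d"
    show "(\<lambda>x. (1 / P M (\<lambda>i. of_nat (count M i))) * P M x) \<in> forms I d"
      by (rule forms_cmult[OF P[OF M]])
    fix M' assume M': "M' \<in> multisets_of_size I d"
    show "1 / P M (\<lambda>i. of_nat (count M i)) * P M (\<lambda>i. of_nat (count M' i)) = (if M' = M then 1 else 0)"
      using diag[OF M] off[OF M M'] by auto
  qed
qed

text \<open>Distinct monomials are independent as functions, so the space of forms has its full
  dimension. In dimension counts this is the family from which conditions are subtracted.\<close>

lemma forms_dual_points:
  assumes I: "finite I"
  shows "\<exists>X. finite X \<and> card X = card (multisets_of_size I d) \<and> dual_on (forms I d) (\<lambda>x F. F x) X"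
proof -
  define f where "f M = (\<lambda>i. complex_of_nat (count M i))" for M :: "'a multiset"
  have inj: "inj_on f S" for S
    by (auto simp: inj_on_def f_def fun_eq_iff multiset_eq_iff)
  have fin: "finite (multisets_of_size I d)" using I by (rule finite_multisets_of_size)
  have "dual_on (forms I d) (\<lambda>x F. F x) (f ` multisets_of_size I d)"
    using forms_lattice_dual[OF I, of d] unfolding dual_on_reindex[OF inj] f_def .
  then show ?thesis using fin inj by (intro exI[of _ "f ` multisets_of_size I d"]) (auto simp: card_image)
qed

lemma dual_on_forms_card_le:
  assumes "dual_on V L J" "V \<subseteq> forms I d" "\<And>k. k \<in> J \<Longrightarrow> lin_on (forms I d) (L k)" "finite I"
  shows "finite J \<and> card J \<le> card (multisets_of_size I d)"
proof -
  have fin: "finite (multisets_of_size I d)" using assms(4) by (rule finite_multisets_of_size)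
  have "finite J \<and> card J \<le> card ((mon :: 'a multiset \<Rightarrow> _) ` multisets_of_size I d)"
    using assms fin by (intro dual_on_card_le[of V L J]) (auto simp: forms_def)
  then show ?thesis using card_image_le[OF fin, of mon] by auto
qed

lemma card_multisets_atMost: "card (multisets_of_size {..m} d) = (m + d) choose m"
  by (simp add: card_multisets_of_size binomial_symmetric[of m "m + d"])

section \<open>Double points in projective space\<close>

text \<open>One vector \<open>y\<close> holds the coordinates of all points, \<open>j\<close> being
  the point and \<open>a\<close> the coordinate, so that a generic configuration is a generic
  vector.\<close>

definition pt :: "(nat \<times> nat \<Rightarrow> complex) \<Rightarrow> nat \<Rightarrow> nat \<Rightarrow> complex"
  where "pt y j = (\<lambda>a. y (j, a))"

definition jets :: "(nat \<times> nat \<Rightarrow> complex) \<Rightarrow> nat \<times> nat option \<Rightarrow> ((nat \<Rightarrow> complex) \<Rightarrow> complex) \<Rightarrow> complex"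
  where "jets y k F = jet (pt y (fst k)) (snd k) F"

definition indep :: "nat \<Rightarrow> nat \<Rightarrow> (nat \<times> nat option) set \<Rightarrow> bool"
  where "indep m d J \<longleftrightarrow> (\<exists>y. dual_on (forms {..m} d) (jets y) J)"

text \<open>A double point is given by its \<open>m + 1\<close> partial derivatives alone; in
  positive degree Euler's relation recovers the value.\<close>

definition dbl :: "nat \<Rightarrow> nat set \<Rightarrow> (nat \<times> nat option) set"
  where "dbl m G = G \<times> Some ` {..m}"

definition dp_indep :: "nat \<Rightarrow> nat \<Rightarrow> nat \<Rightarrow> bool"
  where "dp_indep m d h \<longleftrightarrow> indep m d (dbl m {..<h})"

lemma indepI: "dual_on (forms {..m} d) (jets y) J \<Longrightarrow> indep m d J"
  unfolding indep_def by (rule exI[of _ y])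

lemma jets_None [simp]: "jets y (j, None) F = F (pt y j)"
  and jets_Some [simp]: "jets y (j, Some b) F = pd b F (pt y j)"
  by (simp_all add: jets_def)

lemma finite_dbl [simp]: "finite G \<Longrightarrow> finite (dbl m G)"
  by (simp add: dbl_def)

lemma card_dbl: "card (dbl m G) = (m + 1) * card G"
  by (simp add: dbl_def card_cartesian_product card_image)

lemma dbl_mono: "G \<subseteq> H \<Longrightarrow> dbl m G \<subseteq> dbl m H"
  by (auto simp: dbl_def)

lemma lin_on_jets: "V \<subseteq> forms I d \<Longrightarrow> lin_on V (jets y k)"
  unfolding jets_def by (rule lin_on_jet[of V I]) (use polyfun_forms in blast)

lemma polyfun_jets:
  assumes "F \<in> forms {..m} d" "\<And>i. polyfun UNIV (\<lambda>y. g y i)"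
  shows "polyfun UNIV (\<lambda>y. jets (g y) k F)"
  unfolding jets_def pt_def
  by (rule polyfun_jet[OF polyfun_forms[OF assms(1)] assms(2)])

lemma jets_cong: "(\<And>a. y (fst k, a) = z (fst k, a)) \<Longrightarrow> jets y k F = jets z k F"
  by (simp add: jets_def pt_def)

lemma indep_gen:
  assumes "indep m d J" "finite J"
  shows "generically (\<lambda>y. dual_on (forms {..m} d) (jets y) J)"
proof -
  obtain y0 where y0: "dual_on (forms {..m} d) (jets y0) J"
    using assms(1) unfolding indep_def by (rule exE)
  show ?thesis
    by (rule generically_dual[of J "forms {..m} d" jets y0, OF assms(2) forms_subspace lin_on_jets[OF order_refl] _ y0])
       (rule polyfun_jets, assumption, rule polyfun.var, simp)
qed

lemma indep_mono:
  assumes "indep m d J" "J' \<subseteq> J" shows "indep m d J'"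
proof -
  obtain y where "dual_on (forms {..m} d) (jets y) J"
    using assms(1) unfolding indep_def by (rule exE)
  from dual_on_mono[OF this assms(2) order_refl] show ?thesis by (rule indepI)
qed

lemma indep_reindex:
  assumes "indep m d J" "inj_on \<sigma> (fst ` J)"
  shows "indep m d ((\<lambda>k. (\<sigma> (fst k), snd k)) ` J)"
proof -
  obtain y where y: "dual_on (forms {..m} d) (jets y) J"
    using assms(1) unfolding indep_def by (rule exE)
  define z where "z = (\<lambda>(j, a). y (the_inv_into (fst ` J) \<sigma> j, a))"
  let ?f = "\<lambda>k. (\<sigma> (fst k), snd k)"
  have inj: "inj_on ?f J"
    using assms(2) by (auto simp: inj_on_def)
  have "jets z (?f k) F = jets y k F" if "k \<in> J" for k F
  proof -
    have "the_inv_into (fst ` J) \<sigma> (\<sigma> (fst k)) = fst k"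
      using assms(2) that by (intro the_inv_into_f_f) auto
    then show ?thesis by (simp add: jets_def pt_def z_def)
  qed
  then have "dual_on (forms {..m} d) (\<lambda>k. jets z (?f k)) J = dual_on (forms {..m} d) (jets y) J"
    by (intro dual_on_cong) auto
  then have "dual_on (forms {..m} d) (jets z) (?f ` J)"
    using y unfolding dual_on_reindex[OF inj] by simp
  then show ?thesis by (rule indepI)
qed

lemma dp_indep_indep:
  assumes "dp_indep m d h" "finite G" "card G \<le> h"
  shows "indep m d (dbl m G)"
proof -
  have ind: "indep m d (dbl m {..<card G})"
    using assms unfolding dp_indep_def by (rule_tac indep_mono[OF assms(1)[unfolded dp_indep_def]]) (auto simp: dbl_def)
  obtain \<sigma> where \<sigma>: "bij_betw \<sigma> {..<card G} G"
    using ex_bij_betw_nat_finite[OF assms(2)] by (auto simp: atLeast0LessThan)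
  have "inj_on \<sigma> (fst ` dbl m {..<card G})"
    using \<sigma> by (auto simp: bij_betw_def dbl_def intro: inj_on_subset)
  from indep_reindex[OF ind this] have "indep m d ((\<lambda>k. (\<sigma> (fst k), snd k)) ` dbl m {..<card G})" .
  moreover have "(\<lambda>k. (\<sigma> (fst k), snd k)) ` dbl m {..<card G} = dbl m G"
    using \<sigma> by (force simp: bij_betw_def dbl_def image_iff)
  ultimately show ?thesis by simp
qed

lemma dp_indep_mono: "dp_indep m d h \<Longrightarrow> h' \<le> h \<Longrightarrow> dp_indep m d h'"
  unfolding dp_indep_def by (erule indep_mono) (auto simp: dbl_def)

lemma euler_zero:
  fixes m :: nat
  assumes "F \<in> forms {..m} e" "e \<ge> 1" "\<And>b. b \<le> m \<Longrightarrow> pd b F x = 0"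
  shows "F x = 0"
  using forms_euler[OF assms(1) finite_atMost, of x] assms(2,3) by auto

text \<open>Fewer conditions than coefficients: of a separating set of evaluations at least one
  stays nonzero on the kernel.\<close>

lemma kern_forms_nonzero:
  assumes "finite S" "card S < (m + d) choose m"
  shows "\<exists>F\<in>kern (forms {..m} d) (jets y) S. \<exists>x. F x \<noteq> 0"
proof -
  obtain X where X: "finite X" "card X = (m + d) choose m" "dual_on (forms {..m} d) (\<lambda>x F. F x) X"
    using forms_dual_points[of "{..m}" d] by (auto simp: card_multisets_atMost)
  have "\<exists>J'\<subseteq>X. card X \<le> card J' + card S \<and> dual_on (kern (forms {..m} d) (jets y) S) (\<lambda>x F. F x) J'"
    by (rule dual_on_kern[OF assms(1) X(3,1) forms_subspace lin_on_eval lin_on_jets[OF order_refl]])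
  then obtain J' where J': "card X \<le> card J' + card S" "dual_on (kern (forms {..m} d) (jets y) S) (\<lambda>x F. F x) J'"
    by blast
  then have "J' \<noteq> {}" using X assms by auto
  then obtain x where "x \<in> J'" by blast
  moreover obtain E where "\<forall>i\<in>J'. E i \<in> kern (forms {..m} d) (jets y) S \<and> (\<forall>k\<in>J'. E i k = (if k = i then 1 else 0))"
    using J'(2) unfolding dual_on_def by (rule exE)
  ultimately show ?thesis by (intro bexI[of _ "E x"] exI[of _ x]) auto
qed

lemma dp_indep_0: "dp_indep m d 0" by (auto simp: dp_indep_def indep_def dbl_def dual_on_def)

text \<open>A nonzero form \<open>F\<close> of degree \<open>d - 1\<close> singular at the first
  \<open>h\<close> points exists by counting. The new point is chosen outside its zero set; products
  of \<open>F\<close> with linear forms are singular at the old points and realise every gradient at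
  the new one.\<close>

lemma dp_indep_Suc:
  assumes "dp_indep m d h" "d \<ge> 2" "(m + 1) * h < (m + (d - 1)) choose m"
  shows "dp_indep m d (Suc h)"
proof -
  obtain y0 where y0: "dual_on (forms {..m} d) (jets y0) (dbl m {..<h})"
    using assms(1) unfolding dp_indep_def indep_def by (rule exE)
  have "\<exists>F\<in>kern (forms {..m} (d - 1)) (jets y0) (dbl m {..<h}). \<exists>x. F x \<noteq> 0"
    by (rule kern_forms_nonzero) (use assms(3) in \<open>simp_all add: card_dbl\<close>)
  then obtain F x where F: "F \<in> forms {..m} (d - 1)" "\<And>k. k \<in> dbl m {..<h} \<Longrightarrow> jets y0 k F = 0" "F x \<noteq> 0"
    unfolding kern_def by blast
  define y where "y = (\<lambda>(j, a). if j = h then x a else y0 (j, a))"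
  have yk: "jets y k G = jets y0 k G" if "k \<in> dbl m {..<h}" for k G
    using that by (intro jets_cong) (auto simp: y_def dbl_def)
  have yx: "pt y h = x" by (auto simp: pt_def y_def)
  have 1: "dual_on (forms {..m} d) (jets y) (dbl m {..<h})"
    using y0 dual_on_cong[of "dbl m {..<h}" "forms {..m} d" "jets y" "jets y0"] yk by auto
  have pF: "polyfun {..m} F" by (rule polyfun_forms[OF F(1)])
  have F0: "pd b F (pt y j) = 0" if "j < h" "b \<le> m" for j b
    using F(2)[of "(j, Some b)"] yk[of "(j, Some b)" F] that by (auto simp: dbl_def)
  have F1: "F (pt y j) = 0" if "j < h" for j
    by (rule euler_zero[OF F(1)]) (use assms(2) F0 that in auto)
  have d0: "(of_nat d :: complex) \<noteq> 0" using assms(2) by simp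
  \<comment> \<open>\<open>L b\<close> is to solve
    \<open>F(x) * grad L + L(x) * grad F = e_b\<close> at \<open>x\<close>. Pairing with
    \<open>x\<close> and using Euler's relation in degree \<open>d\<close> gives
    \<open>d * L(x) * F(x) = x_b\<close>, hence the value \<open>s b\<close>; the coefficients
    \<open>c b\<close> follow.\<close>
  define s where "s b = x b / (of_nat d * F x)" for b
  define c where "c b a = ((if a = b then 1 else 0) - s b * pd a F x) / F x" for a b
  define L where "L b z = (\<Sum>a\<in>{..m}. c b a * z a)" for b and z :: "nat \<Rightarrow> complex"
  have Lf: "L b \<in> forms {..m} 1" for b
    unfolding L_def[abs_def] by (intro forms_sum forms_cmult forms_var)
  have pL: "polyfun {..m} (L b)" for b by (rule polyfun_forms[OF Lf])
  have pdL: "pd a (L b) z = c b a" if "a \<le> m" for a b z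
  proof -
    have v: "polyfun {..m} (\<lambda>z. z k)" if "k \<in> {..m}" for k using that by (rule polyfun.var)
    have "pd a (L b) z = (\<Sum>k\<in>{..m}. pd a (\<lambda>z. c b k * z k) z)"
      unfolding L_def[abs_def] by (rule pd_sum[of _ "{..m}"]) (intro polyfun.mult polyfun.const v)
    also have "\<dots> = (\<Sum>k\<in>{..m}. if k = a then c b k else 0)"
      using pd_cmult[OF v] by (intro sum.cong) auto
    finally show ?thesis using that by simp
  qed
  have Lx: "L b x = s b" if "b \<le> m" for b
  proof -
    have eu: "(\<Sum>a\<in>{..m}. x a * pd a F x) = of_nat (d - 1) * F x"
      by (rule forms_euler[OF F(1)]) simp
    have "L b x * F x = (\<Sum>a\<in>{..m}. (if a = b then x a else 0) - s b * (x a * pd a F x))"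
      unfolding L_def sum_distrib_right using F(3) by (intro sum.cong) (auto simp: c_def field_simps)
    also have "\<dots> = x b - s b * (of_nat (d - 1) * F x)"
      using that eu by (simp add: sum_subtractf flip: sum_distrib_left)
    also have "\<dots> = s b * F x"
      using F(3) d0 assms(2) by (simp add: s_def of_nat_diff field_simps)
    finally show ?thesis using F(3) by simp
  qed
  define G where "G b z = L b z * F z" for b z
  have Gf: "G b \<in> forms {..m} d" for b
    using forms_mult[OF Lf F(1), of b] assms(2) by (simp add: G_def[abs_def])
  have pdG: "pd a (G b) z = L b z * pd a F z + c b a * F z" if "a \<le> m" for a b z
    unfolding G_def[abs_def] using pd_mult[OF pL pF] pdL that by simp
  have "dual_on (kern (forms {..m} d) (jets y) (dbl m {..<h})) (jets y) (dbl m {h})"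
    unfolding dual_on_def
  proof (intro exI[of _ "\<lambda>k. G (the (snd k))"] ballI conjI)
    fix k assume "k \<in> dbl m {h}"
    then obtain b where k: "k = (h, Some b)" "b \<le> m" by (auto simp: dbl_def)
    show "G (the (snd k)) \<in> kern (forms {..m} d) (jets y) (dbl m {..<h})"
      using Gf F0 F1 pdG by (auto simp: kern_def dbl_def)
    fix l assume "l \<in> dbl m {h}"
    then obtain a where l: "l = (h, Some a)" "a \<le> m" by (auto simp: dbl_def)
    have "pd a (G b) x = (if a = b then 1 else 0)"
      using pdG[OF l(2), of b x] Lx[OF k(2)] F(3) by (simp add: c_def)
    then show "jets y l (G (the (snd k))) = (if l = k then 1 else 0)"
      using k l yx by simp
  qed
  then have "dual_on (forms {..m} d) (jets y) (dbl m {..<h} \<union> dbl m {h})"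
    by (intro dual_on_Un[OF 1]) (auto simp: forms_subspace dbl_def lin_on_jets[OF order_refl])
  moreover have "dbl m {..<h} \<union> dbl m {h} = dbl m {..<Suc h}" by (auto simp: dbl_def)
  ultimately show ?thesis unfolding dp_indep_def by (intro indepI[of m d y]) simp
qed

text \<open>Only the first \<open>h - 1\<close> double points have to leave a form of degree
  \<open>d - 1\<close>; it then accommodates the last point.\<close>

lemma dp_indep_count:
  assumes "d \<ge> 2" "(m + 1) * (h - 1) < (m + (d - 1)) choose m"
  shows "dp_indep m d h"
  using assms(2)
proof (induction h)
  case (Suc h)
  have "(m + 1) * (h - 1) \<le> (m + 1) * h" by (rule mult_left_mono) auto
  then have "dp_indep m d h" using Suc by (intro Suc.IH) auto
  then show ?case using dp_indep_Suc[OF _ assms(1)] Suc by simp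
qed (rule dp_indep_0)

lemma pd_power:
  assumes "polyfun I F"
  shows "pd b (\<lambda>x. F x ^ n) x = of_nat n * F x ^ (n - 1) * pd b F x"
proof (induction n)
  case (Suc n)
  have "pd b (\<lambda>x. F x ^ Suc n) x = F x * pd b (\<lambda>x. F x ^ n) x + pd b F x * F x ^ n"
    unfolding power_Suc by (rule pd_mult[OF assms polyfun_power[OF assms]])
  then show ?case using Suc by (cases n) (simp_all add: algebra_simps)
qed simp

text \<open>Coordinate points, with multiples of the monomials \<open>x_a * x_j ^ (d - 1)\<close> as
  dual family. From degree 3 on such a monomial is singular at every coordinate point other than the
  \<open>j\<close>-th; in degree 2 it would also be seen at the \<open>a\<close>-th. The factor
  \<open>1 / d\<close> belongs to the pure power \<open>a = j\<close>.\<close>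

lemma dp_indep_coord:
  assumes "d \<ge> 3" shows "dp_indep m d (m + 1)"
proof -
  define y where "y = (\<lambda>(j :: nat, a). if a = j then 1 else (0 :: complex))"
  have ya: "pt y j a = (if a = j then 1 else 0)" for j a by (simp add: pt_def y_def)
  define F where "F j a x = (if a = j then 1 / of_nat d else 1) * (x a * x j ^ (d - 1))"
    for j a and x :: "nat \<Rightarrow> complex"
  have v: "polyfun {..m} (\<lambda>z. z k)" if "k \<le> m" for k using that by (intro polyfun.var) auto
  have Ff: "F j a \<in> forms {..m} d" if "j \<le> m" "a \<le> m" for j a
  proof -
    have "(\<lambda>x. x a * x j ^ (d - 1)) \<in> forms {..m} (1 + (d - 1) * 1)"
      using that by (intro forms_mult forms_power forms_var) auto
    then show ?thesis unfolding F_def[abs_def] using assms by (intro forms_cmult) simp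
  qed
  have pdF: "pd b (F j a) x = (if a = j then 1 / of_nat d else 1) *
      (x a * (of_nat (d - 1) * x j ^ (d - 2) * (if j = b then 1 else 0)) + (if a = b then 1 else 0) * x j ^ (d - 1))"
    if "j \<le> m" "a \<le> m" for j a b x
  proof -
    have p: "polyfun {..m} (\<lambda>x. x j ^ (d - 1))" by (intro polyfun_power v that)
    have e: "d - 1 - 1 = d - 2" by simp
    show ?thesis unfolding F_def[abs_def] pd_cmult[OF polyfun.mult[OF v[OF that(2)] p]]
        pd_mult[OF v[OF that(2)] p] pd_power[OF v[OF that(1)]] pd_var e by simp
  qed
  have "dual_on (forms {..m} d) (jets y) (dbl m {..<m + 1})"
    unfolding dual_on_def
  proof (intro exI[of _ "\<lambda>k. F (fst k) (the (snd k))"] ballI conjI)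
    fix k assume "k \<in> dbl m {..<m + 1}"
    then obtain j a where k: "k = (j, Some a)" "a \<le> m" "j \<le> m" by (auto simp: dbl_def)
    then show "F (fst k) (the (snd k)) \<in> forms {..m} d" using Ff by auto
    fix l assume "l \<in> dbl m {..<m + 1}"
    then obtain i b where l: "l = (i, Some b)" "b \<le> m" "i \<le> m" by (auto simp: dbl_def)
    have "pd b (F j a) (pt y i) = (if i = j \<and> b = a then 1 else 0)"
      unfolding pdF[OF k(3,2)] ya using assms by (auto simp: of_nat_diff field_simps)
    then show "jets y l (F (fst k) (the (snd k))) = (if l = k then 1 else 0)" using k l by auto
  qed
  then show ?thesis unfolding dp_indep_def by (rule indepI)
qed

text \<open>A lower bound for the rank of the double points on \<open>G\<close>, which may be
  dependent: in the residual degree \<open>d - 2\<close> of the hyperplane method full independence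
  is too much to ask.\<close>

definition dp_rank :: "nat \<Rightarrow> nat \<Rightarrow> nat set \<Rightarrow> nat \<Rightarrow> bool"
  where "dp_rank m d G \<rho> \<longleftrightarrow> (\<exists>J\<subseteq>dbl m G. card J = \<rho> \<and> indep m d J)"

text \<open>A form killed by \<open>J\<close> and nonzero at \<open>x\<close> has a nonvanishing
  derivative at \<open>x\<close> by Euler's relation, so a new point placed at \<open>x\<close>
  raises the rank by at least one.\<close>

lemma dp_rank_insert:
  assumes "dp_rank m d G \<rho>" "finite G" "j \<notin> G" "\<rho> < (m + d) choose m" "d \<ge> 1"
  shows "dp_rank m d (insert j G) (Suc \<rho>)"
proof -
  obtain J y0 where J: "J \<subseteq> dbl m G" "card J = \<rho>" "dual_on (forms {..m} d) (jets y0) J"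
    using assms(1) unfolding dp_rank_def indep_def by blast
  have fin: "finite J" using J(1) assms(2) by (auto intro: finite_subset)
  have "\<exists>F\<in>kern (forms {..m} d) (jets y0) J. \<exists>x. F x \<noteq> 0"
    by (rule kern_forms_nonzero) (use fin J assms in auto)
  then obtain F x where F: "F \<in> forms {..m} d" "\<And>k. k \<in> J \<Longrightarrow> jets y0 k F = 0" "F x \<noteq> 0"
    unfolding kern_def by blast
  define y where "y = (\<lambda>(i, a). if i = j then x a else y0 (i, a))"
  have yk: "jets y k G = jets y0 k G" if "k \<in> J" for k G
    using that J(1) assms(3) by (intro jets_cong) (auto simp: y_def dbl_def)
  have yx: "pt y j = x" by (auto simp: pt_def y_def)
  have 1: "dual_on (forms {..m} d) (jets y) J"
    using J(3) dual_on_cong[of J "forms {..m} d" "jets y" "jets y0"] yk by auto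
  obtain b where b: "b \<le> m" "pd b F x \<noteq> 0" using euler_zero[OF F(1) assms(5)] F(3) by blast
  have n: "(j, Some b) \<notin> J" using J(1) assms(3) by (auto simp: dbl_def)
  have "dual_on (forms {..m} d) (jets y) (insert (j, Some b) J)"
    by (rule dual_on_insert[OF 1 F(1)])
       (use F yk yx b fin in \<open>auto simp: forms_subspace lin_on_jets[OF order_refl]\<close>)
  moreover have "insert (j, Some b) J \<subseteq> dbl m (insert j G)" using J(1) b by (auto simp: dbl_def)
  moreover have "card (insert (j, Some b) J) = Suc \<rho>" using n fin J by simp
  ultimately show ?thesis unfolding dp_rank_def indep_def by blast
qed

text \<open>\<open>k\<close> points count in full, and each of \<open>e\<close> further ones
  contributes at least one condition.\<close>

lemma dp_rank_dp_indep:
  assumes "dp_indep m d k" "finite G" "k \<le> card G" "d \<ge> 1"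
    "e \<le> card G - k" "(m + 1) * k + e \<le> (m + d) choose m"
  shows "dp_rank m d G ((m + 1) * k + e)"
proof -
  obtain K where K: "K \<subseteq> G" "card K = k" "finite K"
    using obtain_subset_with_card_n[OF assms(3)] by blast
  have "\<exists>H. K \<subseteq> H \<and> H \<subseteq> G \<and> card H = k + e \<and> dp_rank m d H ((m + 1) * k + e)"
    using assms(5,6)
  proof (induction e)
    case 0
    have "indep m d (dbl m K)" using dp_indep_indep[OF assms(1) K(3)] K by simp
    then have "dp_rank m d K ((m + 1) * k)"
      unfolding dp_rank_def by (intro exI[of _ "dbl m K"]) (simp add: card_dbl K)
    then show ?case using K by auto
  next
    case (Suc e)
    then obtain H where H: "K \<subseteq> H" "H \<subseteq> G" "card H = k + e" "dp_rank m d H ((m + 1) * k + e)" by auto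
    have "H \<noteq> G" using H(3) Suc.prems by auto
    then obtain j where j: "j \<in> G" "j \<notin> H" using H by blast
    have fin: "finite H" using H(2) assms(2) by (rule finite_subset)
    have "dp_rank m d (insert j H) (Suc ((m + 1) * k + e))"
      by (rule dp_rank_insert[OF H(4) fin j(2)]) (use Suc.prems assms in auto)
    then show ?case using H j fin by (intro exI[of _ "insert j H"]) auto
  qed
  then obtain H where H: "H \<subseteq> G" "dp_rank m d H ((m + 1) * k + e)" by blast
  then obtain J where "J \<subseteq> dbl m H" "card J = (m + 1) * k + e" "indep m d J"
    unfolding dp_rank_def by blast
  then show ?thesis unfolding dp_rank_def using dbl_mono[OF H(1), of m] by (intro exI[of _ J]) auto
qed

section \<open>Specialisation to a hyperplane\<close>

lemma forms_insert_decomp: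
  assumes "F \<in> forms (insert j I) (Suc e)"
  shows "\<exists>G\<in>forms I (Suc e). \<exists>H\<in>forms (insert j I) e. \<forall>x. F x = G x + x j * H x"
  using assms unfolding forms_def[of "insert j I" "Suc e"]
proof (induction rule: cfun.span_induct_alt)
  case base
  show ?case
    using cfun.subspace_0[OF forms_subspace[of I "Suc e"]] cfun.subspace_0[OF forms_subspace[of "insert j I" e]]
    by (intro bexI[of _ 0]) auto
next
  case (step c f g)
  then obtain M where M: "f = mon M" "set_mset M \<subseteq> insert j I" "size M = Suc e"
    by (auto simp: multisets_of_size_def)
  obtain G H where GH: "G \<in> forms I (Suc e)" "H \<in> forms (insert j I) e" "\<And>x. g x = G x + x j * H x"
    using step by blast
  show ?case
  proof (cases "j \<in># M")
    case True
    then obtain M' where M': "M = add_mset j M'" by (metis mset_add)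
    have "mon M' \<in> forms (insert j I) e"
      unfolding forms_def using M M' by (intro cfun.span_base) (auto simp: multisets_of_size_def)
    then have "(\<lambda>x. c * mon M' x + H x) \<in> forms (insert j I) e"
      by (intro forms_add forms_cmult GH)
    then show ?thesis using GH M
      by (intro bexI[of _ G] bexI[of _ "\<lambda>x. c * mon M' x + H x"])
         (auto simp: M' mon_add cscale_apply algebra_simps)
  next
    case False
    then have "mon M \<in> forms I (Suc e)"
      unfolding forms_def using M by (intro cfun.span_base) (auto simp: multisets_of_size_def)
    then have "(\<lambda>x. c * mon M x + G x) \<in> forms I (Suc e)"
      by (intro forms_add forms_cmult GH)
    then show ?thesis using GH M
      by (intro bexI[of _ "\<lambda>x. c * mon M x + G x"] bexI[of _ H]) (auto simp: cscale_apply algebra_simps)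
  qed
qed

text \<open>The remainder of the division by \<open>x_j\<close> does not involve \<open>x_j\<close>,
  so it equals its own restriction to \<open>x_j = 0\<close>, which vanishes.\<close>

lemma forms_divide_var:
  assumes "F \<in> forms (insert j I) (Suc e)" "j \<notin> I" "\<And>x. x j = 0 \<Longrightarrow> F x = 0"
  shows "\<exists>H\<in>forms (insert j I) e. \<forall>x. F x = x j * H x"
proof -
  obtain G H where GH: "G \<in> forms I (Suc e)" "H \<in> forms (insert j I) e" "\<And>x. F x = G x + x j * H x"
    using forms_insert_decomp[OF assms(1)] by blast
  have "G x = 0" for x
  proof -
    have "G x = G (x(j := 0))"
      by (rule polyfun_cong[OF polyfun_forms[OF GH(1)]]) (use assms(2) in auto)
    then show ?thesis using GH(3)[of "x(j := 0)"] assms(3)[of "x(j := 0)"] by simp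
  qed
  then show ?thesis using GH by auto
qed

text \<open>Rank of \<open>M\<close> plus dimension of its kernel is at most the dimension of
  \<open>V\<close>. The two families have different index types and are joined over the sum type,
  hence the form of \<open>bound\<close>.\<close>

lemma dual_on_add_card:
  fixes M :: "'k \<Rightarrow> ('a \<Rightarrow> complex) \<Rightarrow> complex" and E :: "'l \<Rightarrow> ('a \<Rightarrow> complex) \<Rightarrow> complex"
  assumes D1: "dual_on V M J" and D2: "dual_on (kern V M J) E X" and V: "cfun.subspace V"
    and lin: "\<And>k. k \<in> J \<Longrightarrow> lin_on V (M k)" "\<And>k. k \<in> X \<Longrightarrow> lin_on V (E k)" and fin: "finite J" "finite X"
    and bound: "\<And>(L :: 'k + 'l \<Rightarrow> _) K. finite K \<Longrightarrow> (\<And>k. k \<in> K \<Longrightarrow> lin_on V (L k)) \<Longrightarrow> dual_on V L K \<Longrightarrow> card K \<le> n"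
  shows "card J + card X \<le> n"
proof -
  define L where "L = case_sum M E"
  have inj: "inj_on Inl J" "inj_on Inr X" by auto
  have 1: "dual_on V L (Inl ` J)"
    using D1 dual_on_reindex[OF inj(1), of V L] by (simp add: L_def)
  have "kern V L (Inl ` J) = kern V M J" by (auto simp: kern_def L_def)
  then have 2: "dual_on (kern V L (Inl ` J)) L (Inr ` X)"
    using D2 dual_on_reindex[OF inj(2), of "kern V M J" L] by (simp add: L_def)
  have l: "lin_on V (L k)" if "k \<in> Inl ` J \<union> Inr ` X" for k
    using that lin by (auto simp: L_def)
  have "dual_on V L (Inl ` J \<union> Inr ` X)"
    by (rule dual_on_Un[OF 1 2 _ V l]) (use fin in auto)
  then have "card (Inl ` J \<union> Inr ` X) \<le> n" using bound[of "Inl ` J \<union> Inr ` X" L] fin l by auto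
  moreover have "card (Inl ` J \<union> Inr ` X) = card J + card X"
    using fin by (subst card_Un_disjoint) (auto simp: card_image)
  ultimately show ?thesis by simp
qed

text \<open>
  Residual half of Terracini's method: simple points on the hyperplane \<open>x\<^sub>m\<^sub>+\<^sub>1 = 0\<close> are added to the
  double points \<open>V\<close>. They are independent as long as forms through \<open>V\<close> restrict to the hyperplane
  with small enough kernel, and this kernel is the space of forms of degree \<open>d - 2\<close> through \<open>V\<close>.
\<close>

lemma horace_residual:
  assumes AV: "dp_indep (Suc m) (Suc e) (card V)" and V: "finite V" and rkV: "dp_rank (Suc m) e V \<rho>" and e: "e \<ge> 1"
    and U: "finite U" "U \<inter> V = {}"
    and num: "card U + (m + 2) * card V + ((Suc m + e) choose Suc m) \<le> ((Suc m + Suc e) choose Suc m) + \<rho>"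
  shows "\<exists>y. (\<forall>j\<in>U. y (j, Suc m) = 0) \<and>
    dual_on (forms {..Suc m} (Suc e)) (jets y) (dbl (Suc m) V \<union> U \<times> {None})"
proof -
  let ?F = "forms {..Suc m} (Suc e)" and ?F' = "forms {..Suc m} e"
  obtain J where J: "J \<subseteq> dbl (Suc m) V" "card J = \<rho>" "indep (Suc m) e J"
    using rkV unfolding dp_rank_def by blast
  have finJ: "finite J" using J(1) V by (auto intro: finite_subset)
  have g1: "generically (\<lambda>y. dual_on ?F (jets y) (dbl (Suc m) V))"
    by (rule indep_gen[OF dp_indep_indep[OF AV V order_refl]]) (use V in auto)
  have g2: "generically (\<lambda>y. dual_on ?F' (jets y) J)"
    by (rule indep_gen[OF J(3) finJ])
  have g3: "generically (\<lambda>y. \<forall>j\<in>V. y (j, Suc m) \<noteq> 0)"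
    by (rule generically_ball[OF V generically_coord])
  obtain y where y: "dual_on ?F (jets y) (dbl (Suc m) V)" "dual_on ?F' (jets y) J"
      "\<And>j. j \<in> V \<Longrightarrow> y (j, Suc m) \<noteq> 0"
    using generically_ex[OF generically_conj[OF g1 generically_conj[OF g2 g3]]] by blast
  define K where "K = kern ?F (jets y) (dbl (Suc m) V)"
  have linF: "lin_on ?F (jets z k)" for z k by (rule lin_on_jets[OF order_refl])
  have K: "cfun.subspace K" "K \<subseteq> ?F"
    unfolding K_def by (auto simp: kern_subset kern_subspace forms_subspace linF)
  \<comment> \<open>\<open>X\<close> measures the dimension of \<open>K\<close> from below: at most
    \<open>(m + 2) * card V\<close> of these evaluations are lost on passing to
    \<open>K\<close>.\<close>
  obtain X where X: "finite X" "card X = (Suc m + Suc e) choose Suc m" "dual_on ?F (\<lambda>x F. F x) X"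
    using forms_dual_points[of "{..Suc m}" "Suc e"] unfolding card_multisets_atMost by auto
  have "\<exists>J'\<subseteq>X. card X \<le> card J' + card (dbl (Suc m) V) \<and> dual_on K (\<lambda>x F. F x) J'"
    unfolding K_def by (rule dual_on_kern[OF _ X(3,1) forms_subspace lin_on_eval linF]) (simp add: V)
  then obtain X' where X': "X' \<subseteq> X" "card X \<le> card X' + card (dbl (Suc m) V)" "dual_on K (\<lambda>x F. F x) X'"
    by blast
  have finX': "finite X'" using X' X finite_subset by auto
  define H where "H = {p :: nat \<Rightarrow> complex. p (Suc m) = 0}"
  \<comment> \<open>Bound for the forms of \<open>K\<close> that vanish on \<open>H\<close>: they
    are \<open>x (Suc m) * G\<close> with \<open>G\<close> of degree \<open>e\<close> satisfying the
    \<rho> independent conditions \<open>J\<close>.\<close>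
  define nn where "nn = ((Suc m + e) choose Suc m) - \<rho>"
  have eul: "F (pt y j) = 0" if "j \<in> V" "F \<in> K" for F j
  proof -
    have "F \<in> ?F" using K(2) that by blast
    moreover have "pd b F (pt y j) = 0" if "b \<le> Suc m" for b
      using \<open>F \<in> K\<close> \<open>j \<in> V\<close> that by (force simp: K_def kern_def dbl_def)
    ultimately show ?thesis using euler_zero[of F "Suc m" "Suc e" "pt y j"] by simp
  qed
  have small: "card X'' \<le> nn" if X'': "X'' \<subseteq> X'" "dual_on (kern K (\<lambda>x F. F x) H) (\<lambda>x F. F x) X''" for X''
  proof -
    have fin: "finite X''" using X'' finX' finite_subset by auto
    obtain E where E: "\<forall>i\<in>X''. E i \<in> kern K (\<lambda>x F. F x) H \<and> (\<forall>k\<in>X''. E i k = (if k = i then 1 else 0))"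
      using X''(2) unfolding dual_on_def by (rule exE)
    have "\<exists>G\<in>kern ?F' (jets y) J. \<forall>x. E i x = x (Suc m) * G x" if i: "i \<in> X''" for i
    proof -
      have Ei: "E i \<in> ?F" "E i \<in> K" "\<And>x. x (Suc m) = 0 \<Longrightarrow> E i x = 0"
        using E i K by (auto simp: kern_def H_def)
      have ins: "insert (Suc m) {..m} = {..Suc m}" by auto
      have "\<exists>G\<in>?F'. \<forall>x. E i x = x (Suc m) * G x"
        using forms_divide_var[of "E i" "Suc m" "{..m}" e] Ei unfolding ins by auto
      then obtain G where G: "G \<in> ?F'" "\<And>x. E i x = x (Suc m) * G x" by blast
      have Gx: "E i = (\<lambda>x. x (Suc m) * G x)" using G(2) by (simp add: fun_eq_iff)
      have pG: "polyfun {..Suc m} G" by (rule polyfun_forms[OF G(1)])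
      have pv: "polyfun {..Suc m} (\<lambda>x. x (Suc m))" by (rule polyfun.var) simp
      have "jets y k G = 0" if kJ: "k \<in> J" for k
      proof -
        obtain j b where k: "k = (j, Some b)" "j \<in> V" "b \<le> Suc m"
          using kJ J(1) by (auto simp: dbl_def)
        \<comment> \<open>The points of \<open>V\<close> lie off the hyperplane, so singularity
          passes from \<open>E i\<close> to the quotient \<open>G\<close>.\<close>
        have nz: "pt y j (Suc m) \<noteq> 0" using y(3)[OF k(2)] by (simp add: pt_def)
        have "G (pt y j) = 0" using eul[OF k(2) Ei(2)] G(2) nz by simp
        moreover have "pd b (E i) (pt y j) = 0"
          using Ei(2) k by (force simp: K_def kern_def dbl_def)
        ultimately have "pt y j (Suc m) * pd b G (pt y j) = 0"
          unfolding Gx using pd_mult[OF pv pG, of b "pt y j"] by simp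
        then show ?thesis using nz k by simp
      qed
      then show ?thesis using G by (auto simp: kern_def)
    qed
    then obtain G where G: "\<And>i. i \<in> X'' \<Longrightarrow> G i \<in> kern ?F' (jets y) J"
        "\<And>i x. i \<in> X'' \<Longrightarrow> E i x = x (Suc m) * G i x" by metis
    have d2: "dual_on (kern ?F' (jets y) J) (\<lambda>x F. x (Suc m) * F x) X''"
      unfolding dual_on_def using G E by (intro exI[of _ G]) auto
    have l2: "lin_on ?F' (\<lambda>F. x (Suc m) * F x)" for x :: "nat \<Rightarrow> complex"
      by (simp add: lin_on_def cscale_apply algebra_simps)
    have "card J + card X'' \<le> (Suc m + e) choose Suc m"
    proof (rule dual_on_add_card[OF y(2) d2 forms_subspace lin_on_jets[OF order_refl] l2 finJ fin])
      fix L :: "(nat \<times> nat option) + (nat \<Rightarrow> complex) \<Rightarrow> ((nat \<Rightarrow> complex) \<Rightarrow> complex) \<Rightarrow> complex" and S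
      assume "finite S" "\<And>k. k \<in> S \<Longrightarrow> lin_on ?F' (L k)" "dual_on ?F' L S"
      then show "card S \<le> (Suc m + e) choose Suc m"
        using dual_on_forms_card_le[of ?F' L S "{..Suc m}" e] unfolding card_multisets_atMost by auto
    qed
    then show ?thesis using J(2) by (simp add: nn_def)
  qed
  have rho: "\<rho> \<le> (Suc m + e) choose Suc m"
    using dual_on_forms_card_le[OF y(2) order_refl lin_on_jets[OF order_refl] finite_atMost] J(2)
    unfolding card_multisets_atMost by simp
  \<comment> \<open>Points of the hyperplane are chosen greedily on \<open>K\<close>; they become
    the points of \<open>U\<close> below.\<close>
  have "\<exists>S1. {} \<subseteq> S1 \<and> S1 \<subseteq> H \<and> finite S1 \<and> card S1 = card U \<and> dual_on K (\<lambda>x F. F x) S1"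
  proof (rule dual_on_extend[of K "\<lambda>x F. F x" X' H "\<lambda>x F. F x" "{}" nn "card U"])
    show "nn + card U \<le> card X'"
      using num X X'(2) rho by (simp add: nn_def card_dbl)
  qed (use X' finX' K small in \<open>auto simp: lin_on_eval\<close>)
  then obtain S1 where S1: "S1 \<subseteq> H" "finite S1" "card S1 = card U" "dual_on K (\<lambda>x F. F x) S1" by auto
  obtain f where f: "bij_betw f U S1" using finite_same_card_bij[OF U(1) S1(2)] S1(3) by auto
  define z where "z = (\<lambda>(j, a). if j \<in> U then f j a else y (j, a))"
  have zV: "jets z k F = jets y k F" if "k \<in> dbl (Suc m) V" for k F
    using that U by (intro jets_cong) (auto simp: z_def dbl_def)
  have zU: "pt z j = f j" if "j \<in> U" for j using that by (simp add: pt_def z_def)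
  have 1: "dual_on ?F (jets z) (dbl (Suc m) V)"
    using y(1) dual_on_cong[of "dbl (Suc m) V" ?F "jets z" "jets y"] zV by auto
  have "kern ?F (jets z) (dbl (Suc m) V) = K" using zV by (auto simp: K_def kern_def)
  moreover have "dual_on K (jets z) (U \<times> {None})"
  proof -
    have inj: "inj_on f U" "inj_on (\<lambda>j. (j, None :: nat option)) U" using f by (auto simp: bij_betw_def inj_on_def)
    have "dual_on K (\<lambda>j F. F (f j)) U"
      using S1(4) f dual_on_reindex[OF inj(1), of K "\<lambda>x F. F x"] by (simp add: bij_betw_def)
    then have "dual_on K (\<lambda>j. jets z (j, None)) U"
      using dual_on_cong[of U K "\<lambda>j F. F (f j)" "\<lambda>j. jets z (j, None)"] zU by auto
    moreover have "(\<lambda>j. (j, None :: nat option)) ` U = U \<times> {None}" by auto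
    ultimately show ?thesis using dual_on_reindex[OF inj(2), of K "jets z"] by simp
  qed
  ultimately have "dual_on ?F (jets z) (dbl (Suc m) V \<union> U \<times> {None})"
    by (intro dual_on_Un[OF 1]) (use V U in \<open>auto simp: forms_subspace linF dbl_def\<close>)
  moreover have "\<forall>j\<in>U. z (j, Suc m) = 0"
    using f S1(1) by (auto simp: z_def H_def bij_betw_def)
  ultimately show ?thesis by blast
qed

text \<open>The points of \<open>U\<close> are put on the hyperplane \<open>x_{m+1} = 0\<close>.
  Their tangential derivatives are handled by forms of degree \<open>d\<close> in
  \<open>x_0, ..., x_m\<close>. Everything else is left to products \<open>x_{m+1} * G\<close> with
  \<open>G\<close> of degree \<open>d - 1\<close>: these have no tangential derivative at
  \<open>U\<close>, their normal derivative there is the value of \<open>G\<close>, and their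
  gradient at \<open>V\<close> can be prescribed if that of \<open>G\<close> can. The residual lemma
  provides such \<open>G\<close>.\<close>

lemma horace_sets:
  assumes AU: "dp_indep m (Suc (Suc e)) (card U)"
    and AV: "dp_indep (Suc m) (Suc e) (card V)" and V: "finite V" and rkV: "dp_rank (Suc m) e V \<rho>" and e: "e \<ge> 1"
    and U: "finite U" "U \<inter> V = {}"
    and num: "card U + (m + 2) * card V + ((Suc m + e) choose Suc m) \<le> ((Suc m + Suc e) choose Suc m) + \<rho>"
  shows "indep (Suc m) (Suc (Suc e)) (dbl (Suc m) (U \<union> V))"
proof -
  let ?d = "Suc (Suc e)"
  let ?Ftot = "forms {..Suc m} ?d" and ?Fres = "forms {..Suc m} (Suc e)" and ?Ftr = "forms {..m} ?d"
  let ?R = "dbl (Suc m) V \<union> U \<times> {None}"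
  \<comment> \<open>Projection of the points of \<open>U\<close> to the hyperplane. Composing with
    it keeps \<open>y\<close> unconstrained, so that genericity applies although the points are
    special.\<close>
  define pr where "pr y = (\<lambda>(j, a). if j \<in> U \<and> a = Suc m then 0 else y (j, a))"
    for y :: "nat \<times> nat \<Rightarrow> complex"
  obtain y0 where y0: "\<forall>j\<in>U. y0 (j, Suc m) = 0" "dual_on ?Fres (jets y0) ?R"
    using horace_residual[OF AV V rkV e U num] by blast
  have pr0: "pr y0 = y0" using y0 by (auto simp: pr_def fun_eq_iff)
  have finR: "finite ?R" using V U by auto
  have g1: "generically (\<lambda>y. dual_on ?Fres (jets (pr y)) ?R)"
  proof (rule generically_dual[of ?R ?Fres "\<lambda>y. jets (pr y)" y0, OF finR forms_subspace lin_on_jets[OF order_refl]])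
    show "polyfun UNIV (\<lambda>y. jets (pr y) k F)" if "F \<in> ?Fres" for k F
    proof (rule polyfun_jets[OF that])
      fix i show "polyfun UNIV (\<lambda>y. pr y i)"
        by (cases i; cases "fst i \<in> U \<and> snd i = Suc m") (auto simp: pr_def polyfun.const polyfun.var)
    qed
    show "dual_on ?Fres (jets (pr y0)) ?R" using y0 pr0 by simp
  qed
  have g2: "generically (\<lambda>y. dual_on ?Ftr (jets y) (dbl m U))"
    by (rule indep_gen[OF dp_indep_indep[OF AU U(1) order_refl]]) (use U in auto)
  have g3: "generically (\<lambda>y. \<forall>j\<in>V. y (j, Suc m) \<noteq> 0)"
    by (rule generically_ball[OF V generically_coord])
  obtain y where y: "dual_on ?Fres (jets (pr y)) ?R" "dual_on ?Ftr (jets y) (dbl m U)"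
      "\<And>j. j \<in> V \<Longrightarrow> y (j, Suc m) \<noteq> 0"
    using generically_ex[OF generically_conj[OF g1 generically_conj[OF g2 g3]]] by blast
  define z where "z = pr y"
  have zU: "pt z j (Suc m) = 0" if "j \<in> U" for j using that by (simp add: z_def pr_def pt_def)
  have zV: "pt z j (Suc m) \<noteq> 0" if "j \<in> V" for j
    using that y(3)[OF that] U by (auto simp: z_def pr_def pt_def)
  have j0: "jets z k F = jets y k F" if Fk: "F \<in> ?Ftr" "k \<in> dbl m U" for k F
  proof -
    obtain j b where k: "k = (j, Some b)" using Fk by (auto simp: dbl_def)
    have "pd b F (pt z j) = pd b F (pt y j)"
      by (rule polyfun_cong[OF polyfun_pd[OF polyfun_forms[OF Fk(1)]]]) (auto simp: pt_def z_def pr_def)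
    then show ?thesis using k by simp
  qed
  have d1: "dual_on ?Ftot (jets z) (dbl m U)"
  proof (rule dual_on_mono[OF _ order_refl])
    show "dual_on ?Ftr (jets z) (dbl m U)"
      using y(2) dual_on_cong[of "dbl m U" ?Ftr "jets z" "jets y"] j0 by auto
    show "?Ftr \<subseteq> ?Ftot" by (rule forms_mono) auto
  qed
  define J2 where "J2 = dbl (Suc m) V \<union> U \<times> {Some (Suc m)}"
  have "\<exists>F\<in>kern ?Ftot (jets z) (dbl m U). \<forall>l\<in>J2. jets z l F = (if l = k then 1 else 0)"
    if k: "k \<in> J2" for k
  proof -
    define \<xi> where "\<xi> j b = (if (j, Some b) = k then 1 else (0::complex))" for j :: nat and b :: nat
    \<comment> \<open>\<open>g j\<close> is the value that \<open>G\<close> must have at a point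
      \<open>p\<close> of \<open>V\<close>: Euler's relation for \<open>x_{m+1} * G\<close> with
      prescribed gradient \<xi> says that \<open>d * p_{m+1} * G(p)\<close> is the sum of the
      \<open>\<xi>_a * p_a\<close>. The product rule then yields the gradient \<eta> of
      \<open>G\<close>.\<close>
    define g where "g j = (\<Sum>a\<in>{..Suc m}. \<xi> j a * pt z j a) / (pt z j (Suc m) * of_nat ?d)" for j
    define \<eta> where "\<eta> j b = (\<xi> j b - (if b = Suc m then g j else 0)) / pt z j (Suc m)" for j b
    define c where "c l = (case snd l of None \<Rightarrow> \<xi> (fst l) (Suc m) | Some b \<Rightarrow> \<eta> (fst l) b)"
      for l :: "nat \<times> nat option"
    have "\<exists>G\<in>?Fres. \<forall>l\<in>?R. jets z l G = c l"
      by (rule dual_on_interp[OF y(1)[folded z_def] forms_subspace lin_on_jets[OF order_refl] finR])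
    then obtain G where G: "G \<in> ?Fres" "\<And>l. l \<in> ?R \<Longrightarrow> jets z l G = c l" by blast
    have GU: "G (pt z j) = \<xi> j (Suc m)" if "j \<in> U" for j
      using G(2)[of "(j, None)"] that by (simp add: c_def)
    have GV: "pd b G (pt z j) = \<eta> j b" if "j \<in> V" "b \<le> Suc m" for j b
      using G(2)[of "(j, Some b)"] that by (simp add: c_def dbl_def)
    \<comment> \<open>The prescription is consistent: Euler's relation in degree
      \<open>d - 1\<close>, applied to \<eta>, returns \<open>g j\<close>.\<close>
    have Gg: "G (pt z j) = g j" if j: "j \<in> V" for j
    proof -
      let ?p = "pt z j"
      have "of_nat (Suc e) * G ?p = (\<Sum>a\<in>{..Suc m}. ?p a * pd a G ?p)"
        by (rule forms_euler[OF G(1) finite_atMost, symmetric])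
      also have "\<dots> = (\<Sum>a\<in>{..Suc m}. \<xi> j a * ?p a / ?p (Suc m) - (if a = Suc m then g j else 0))"
      proof (rule sum.cong[OF refl])
        fix a assume "a \<in> {..Suc m}"
        then have "pd a G ?p = \<eta> j a" using GV[OF j] by simp
        then show "?p a * pd a G ?p = \<xi> j a * ?p a / ?p (Suc m) - (if a = Suc m then g j else 0)"
          using zV[OF j] by (cases "a = Suc m") (simp_all only: \<eta>_def if_True if_False refl, simp_all)
      qed
      also have "\<dots> = (\<Sum>a\<in>{..Suc m}. \<xi> j a * ?p a) / ?p (Suc m) - g j"
        by (simp add: sum_subtractf sum_divide_distrib del: sum.atMost_Suc)
      also have "\<dots> = g j * of_nat ?d - g j"
        using zV[OF j] by (simp add: g_def field_simps del: sum.atMost_Suc of_nat_Suc)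
      also have "\<dots> = of_nat (Suc e) * g j" by (simp add: algebra_simps)
      finally show ?thesis by (metis mult_cancel_left of_nat_eq_0_iff nat.distinct(2))
    qed
    define F where "F = (\<lambda>x. x (Suc m) * G x)"
    have Ff: "F \<in> ?Ftot" unfolding F_def by (rule forms_var_mult[OF _ G(1)]) simp
    have pv: "polyfun {..Suc m} (\<lambda>x. x (Suc m))" by (rule polyfun.var) simp
    have pdF: "pd b F x = x (Suc m) * pd b G x + (if Suc m = b then G x else 0)" for b x
      unfolding F_def using pd_mult[OF pv polyfun_forms[OF G(1)], of b x] by auto
    have FU: "pd b F (pt z j) = (if Suc m = b then \<xi> j b else 0)" if "j \<in> U" for j b
      unfolding pdF using zU GU that by auto
    have FV: "pd b F (pt z j) = \<xi> j b" if "j \<in> V" "b \<le> Suc m" for j b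
      unfolding pdF using zV[OF that(1)] GV[OF that] Gg[OF that(1)] by (auto simp: \<eta>_def)
    have "F \<in> kern ?Ftot (jets z) (dbl m U)" using Ff FU by (auto simp: kern_def dbl_def)
    moreover have "jets z l F = (if l = k then 1 else 0)" if "l \<in> J2" for l
      using that FU FV by (auto simp: J2_def dbl_def \<xi>_def)
    ultimately show ?thesis by blast
  qed
  then obtain F where F: "\<And>k. k \<in> J2 \<Longrightarrow> F k \<in> kern ?Ftot (jets z) (dbl m U)"
    "\<And>k l. k \<in> J2 \<Longrightarrow> l \<in> J2 \<Longrightarrow> jets z l (F k) = (if l = k then 1 else 0)" by metis
  have d2: "dual_on (kern ?Ftot (jets z) (dbl m U)) (jets z) J2"
    unfolding dual_on_def using F by (intro exI[of _ F]) auto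
  have "dual_on ?Ftot (jets z) (dbl m U \<union> J2)"
    by (rule dual_on_Un[OF d1 d2])
       (use U V in \<open>auto simp: forms_subspace lin_on_jets[OF order_refl] J2_def dbl_def\<close>)
  moreover have "dbl m U \<union> J2 = dbl (Suc m) (U \<union> V)"
    by (auto simp: J2_def dbl_def atMost_Suc)
  ultimately show ?thesis by (simp add: indepI)
qed

text \<open>Numerical form: \<open>u\<close> points go to the hyperplane and \<open>v\<close> stay
  outside; of the latter, \<open>k\<close> are independent in degree \<open>d - 2\<close> and
  \<open>e\<close> more add one condition each to the residual rank.\<close>

lemma horace:
  assumes "dp_indep m d u" "dp_indep (Suc m) (d - 1) v" "dp_indep (Suc m) (d - 2) k" "k \<le> v" "d \<ge> 3"
    and num: "e \<le> v - k" "(m + 2) * k + e \<le> (Suc m + (d - 2)) choose Suc m"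
    "u + (m + 2) * v + ((Suc m + (d - 2)) choose Suc m) \<le> ((Suc m + (d - 1)) choose Suc m) + ((m + 2) * k + e)"
  shows "dp_indep (Suc m) d (u + v)"
proof -
  obtain c where c: "d = Suc (Suc c)" "c \<ge> 1" using assms(5) by (metis Suc_le_D numeral_3_eq_3 Suc_le_mono One_nat_def)
  have "dp_rank (Suc m) c {u..<u + v} ((Suc m + 1) * k + e)"
    by (rule dp_rank_dp_indep) (use assms c in auto)
  then have dp_rank: "dp_rank (Suc m) c {u..<u + v} ((m + 2) * k + e)"
    by (simp only: add_Suc_right add_Suc add_0_right One_nat_def numeral_2_eq_2)
  have "indep (Suc m) (Suc (Suc c)) (dbl (Suc m) ({..<u} \<union> {u..<u + v}))"
    by (rule horace_sets[OF _ _ _ dp_rank]) (use assms c in auto)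
  moreover have "{..<u} \<union> {u..<u + v} = {..<u + v}" by auto
  ultimately show ?thesis unfolding dp_indep_def c(1) by simp
qed

section \<open>Numerical bounds\<close>

text \<open>\<open>bsum m t = m * (\<Sum>l\<in>L. (m + 1) ^ l)\<close> if \<open>t = (\<Sum>l\<in>L. 2 ^ l)\<close> is the binary expansion of \<open>t\<close>.\<close>

fun bsum :: "nat \<Rightarrow> nat \<Rightarrow> nat" where
  "bsum m t = (if t = 0 then 0 else (m + 1) * bsum m (t div 2) + m * (t mod 2))"

declare bsum.simps [simp del]

lemma bsum_0 [simp]: "bsum m 0 = 0" by (simp add: bsum.simps)

lemma bsum_rec: "bsum m t = (m + 1) * bsum m (t div 2) + m * (t mod 2)"
  by (cases "t = 0") (simp_all add: bsum.simps[of m t])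

lemma bsum_small:
  "bsum m 1 = m" "bsum m 2 = (m + 1) * m" "bsum m 3 = (m + 1) * m + m"
  "bsum m 4 = (m + 1) * ((m + 1) * m)" "bsum m 5 = (m + 1) * ((m + 1) * m) + m"
  "bsum m 8 = (m + 1) * ((m + 1) * ((m + 1) * m))" "bsum m 9 = (m + 1) * ((m + 1) * ((m + 1) * m)) + m"
  "bsum m 16 = (m + 1) * ((m + 1) * ((m + 1) * ((m + 1) * m)))"
  "bsum m 17 = (m + 1) * ((m + 1) * ((m + 1) * ((m + 1) * m))) + m"
proof -
  show 1: "bsum m 1 = m" using bsum_rec[of m 1] by simp
  show 2: "bsum m 2 = (m + 1) * m" using bsum_rec[of m 2] 1 by simp
  show "bsum m 3 = (m + 1) * m + m" using bsum_rec[of m 3] 1 by simp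
  show 4: "bsum m 4 = (m + 1) * ((m + 1) * m)" using bsum_rec[of m 4] 2 by simp
  show "bsum m 5 = (m + 1) * ((m + 1) * m) + m" using bsum_rec[of m 5] 2 by simp
  show 8: "bsum m 8 = (m + 1) * ((m + 1) * ((m + 1) * m))" using bsum_rec[of m 8] 4 by simp
  show "bsum m 9 = (m + 1) * ((m + 1) * ((m + 1) * m)) + m" using bsum_rec[of m 9] 4 by simp
  show "bsum m 16 = (m + 1) * ((m + 1) * ((m + 1) * ((m + 1) * m)))" using bsum_rec[of m 16] 8 by simp
  show "bsum m 17 = (m + 1) * ((m + 1) * ((m + 1) * ((m + 1) * m))) + m" using bsum_rec[of m 17] 8 by simp
qed

text \<open>The lowest binary digit is split off on both sides; \<open>K\<close> is the set of
  remaining exponents, shifted down by one.\<close>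

lemma bsum_sum:
  assumes "finite L" shows "bsum m (\<Sum>l\<in>L. 2 ^ l) = m * (\<Sum>l\<in>L. (m + 1) ^ l)"
  using assms
proof (induction "\<Sum>l\<in>L. (2::nat) ^ l" arbitrary: L rule: less_induct)
  case less
  show ?case
  proof (cases "L = {}")
    case False
    define K where "K = {l. Suc l \<in> L}"
    have finK: "finite K" using less.prems finite_vimageI[of L Suc] by (simp add: K_def vimage_def)
    define b :: nat where "b = (if 0 \<in> L then 1 else 0)"
    have "L = (if 0 \<in> L then {0} else {}) \<union> Suc ` K"
      by (auto simp: K_def image_iff gr0_conv_Suc split: if_splits) (metis not0_implies_Suc)+
    then have "sum f L = sum f (if 0 \<in> L then {0} else {}) + sum f (Suc ` K)" for f :: "nat \<Rightarrow> nat"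
      using sum.union_disjoint[of "if 0 \<in> L then {0} else {}" "Suc ` K" f] finK by auto
    then have split: "(\<Sum>l\<in>L. f l) = (if 0 \<in> L then f 0 else 0) + (\<Sum>l\<in>K. f (Suc l))" for f :: "nat \<Rightarrow> nat"
      by (simp add: sum.reindex)
    have s2: "(\<Sum>l\<in>L. 2 ^ l) = b + 2 * (\<Sum>l\<in>K. 2 ^ l)"
      by (simp add: split b_def sum_distrib_left)
    have sm: "(\<Sum>l\<in>L. (m + 1) ^ l) = b + (m + 1) * (\<Sum>l\<in>K. (m + 1) ^ l)"
      by (simp add: split b_def sum_distrib_left sum_distrib_right)
    have pos: "(\<Sum>l\<in>L. (2::nat) ^ l) > 0" using False less.prems by (intro sum_pos) auto
    have "(\<Sum>l\<in>K. (2::nat) ^ l) < (\<Sum>l\<in>L. 2 ^ l)" using s2 pos by linarith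
    then have IH: "bsum m (\<Sum>l\<in>K. 2 ^ l) = m * (\<Sum>l\<in>K. (m + 1) ^ l)"
      using less.hyps finK by blast
    have "(b + 2 * (\<Sum>l\<in>K. 2 ^ l)) div 2 = (\<Sum>l\<in>K. 2 ^ l)" "(b + 2 * (\<Sum>l\<in>K. 2 ^ l)) mod 2 = b"
      by (auto simp: b_def)
    then have "bsum m (b + 2 * (\<Sum>l\<in>K. 2 ^ l)) = (m + 1) * (m * (\<Sum>l\<in>K. (m + 1) ^ l)) + m * b"
      using bsum_rec[of m "b + 2 * (\<Sum>l\<in>K. 2 ^ l)"] IH by (simp only:)
    then show ?thesis unfolding s2 sm by (simp add: algebra_simps)
  qed simp
qed

section \<open>Binomial estimates\<close>

lemma choose_fact: "((m + k) choose k) * fact k = (\<Prod>i<k. m + 1 + i)"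
proof (induction k)
  case (Suc k)
  have "Suc k * (Suc (m + k) choose Suc k) = Suc (m + k) * ((m + k) choose k)"
    using Suc_times_binomial_eq[of "m + k" k] by (simp only: mult.commute)
  then have "(Suc (m + k) choose Suc k) * fact (Suc k) = Suc (m + k) * (((m + k) choose k) * fact k)"
    by (metis fact_Suc mult.assoc mult.commute of_nat_id)
  moreover have "(\<Prod>i<Suc k. m + 1 + i) = (\<Prod>i<k. m + 1 + i) * Suc (m + k)" by simp
  ultimately show ?case using Suc by (simp only: add_Suc_right mult.commute)
qed simp

lemma choose_fact': "((m + k) choose m) * fact k = (\<Prod>i<k. m + 1 + i)"
  using choose_fact[of m k] binomial_symmetric[of m "m + k"] by simp

lemma choose_prod_div: "k \<le> n \<Longrightarrow> n choose k = (\<Prod>i<k. n - k + 1 + i) div fact k"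
proof -
  assume "k \<le> n"
  then have "(n choose k) * fact k = (\<Prod>i<k. n - k + 1 + i)" using choose_fact[of "n - k" k] by simp
  then have "(\<Prod>i<k. n - k + 1 + i) = fact k * (n choose k)" by (simp only: mult.commute)
  then show ?thesis by simp
qed

lemma choose_numerals:
  "(4 :: nat) choose 2 = 6"
  "(4 :: nat) choose 3 = 4"
  "(5 :: nat) choose 2 = 10"
  "(5 :: nat) choose 3 = 10"
  "(5 :: nat) choose 4 = 5"
  "(6 :: nat) choose 2 = 15"
  "(6 :: nat) choose 3 = 20"
  "(6 :: nat) choose 4 = 15"
  "(7 :: nat) choose 2 = 21"
  "(7 :: nat) choose 3 = 35"
  "(7 :: nat) choose 4 = 35"
  "(8 :: nat) choose 2 = 28"
  "(8 :: nat) choose 3 = 56"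
  "(8 :: nat) choose 4 = 70"
  "(9 :: nat) choose 2 = 36"
  "(9 :: nat) choose 3 = 84"
  "(9 :: nat) choose 4 = 126"
  "(10 :: nat) choose 2 = 45"
  "(10 :: nat) choose 3 = 120"
  "(10 :: nat) choose 4 = 210"
  "(11 :: nat) choose 2 = 55"
  "(11 :: nat) choose 3 = 165"
  "(11 :: nat) choose 4 = 330"
  "(12 :: nat) choose 2 = 66"
  "(12 :: nat) choose 3 = 220"
  "(12 :: nat) choose 4 = 495"
  "(13 :: nat) choose 2 = 78"
  "(14 :: nat) choose 2 = 91"
  "(15 :: nat) choose 2 = 105"
  "(16 :: nat) choose 2 = 120"
  "(17 :: nat) choose 2 = 136"
  "(18 :: nat) choose 2 = 153"
  "(19 :: nat) choose 2 = 171"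
  "(13 :: nat) choose 4 = 715"
  "(19 :: nat) choose 3 = 969"
  "(20 :: nat) choose 2 = 190"
  "(20 :: nat) choose 4 = 4845"
  "(21 :: nat) choose 3 = 1330"
  "(22 :: nat) choose 4 = 7315"
  "(34 :: nat) choose 2 = 561"
  "(36 :: nat) choose 2 = 630"
  by (simp_all add: choose_prod_div lessThan_nat_numeral lessThan_Suc fact_numeral)

text \<open>The factor \<open>m + 1\<close> is the one by which \<open>bsum m\<close> grows when its
  argument is doubled. The start \<open>t = 4\<close> cannot be lowered: for \<open>m = 2\<close>,
  \<open>t = 3\<close> the two sides are 30 and 28.\<close>

lemma choose_double:
  assumes "m \<ge> 2" "t \<ge> 4"
  shows "(m + 1) * ((m + t) choose m) \<le> (m + 2 * t) choose m"
  using assms(1)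
proof (induction m rule: dec_induct)
  case base
  have c2: "((2 + k) choose 2) * 2 = (k + 1) * (k + 2)" for k :: nat
    using choose_fact[of k 2] by (simp add: add.commute numeral_2_eq_2 lessThan_Suc algebra_simps)
  have "3 * ((t + 1) * (t + 2)) \<le> (2 * t + 1) * (2 * t + 2)"
  proof -
    obtain s where "t = s + 4" using assms(2) by (metis le_add_diff_inverse2)
    then show ?thesis by (simp add: algebra_simps)
  qed
  then have "3 * ((2 + t) choose 2) * 2 \<le> ((2 + 2 * t) choose 2) * 2"
    using c2[of t] c2[of "2 * t"] by (simp add: algebra_simps)
  then show ?case by simp
next
  case (step m)
  have s: "Suc m * ((Suc m + k) choose Suc m) = (Suc m + k) * ((m + k) choose m)" for k
    using Suc_times_binomial_eq[of "m + k" m] by (simp only: mult.commute add_Suc)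
  have "(Suc m + 1) * (Suc m + t) \<le> (Suc m + 2 * t) * (m + 1)"
  proof -
    obtain s where s: "m = s + 2" using step.hyps by (metis le_add_diff_inverse2)
    obtain q where q: "t = q + 4" using assms(2) by (metis le_add_diff_inverse2)
    show ?thesis unfolding s q by (simp add: algebra_simps)
  qed
  then have "(Suc m + 1) * (Suc m + t) * ((m + t) choose m) \<le> (Suc m + 2 * t) * ((m + 1) * ((m + t) choose m))"
    by (metis mult.assoc mult_le_mono1)
  also have "\<dots> \<le> (Suc m + 2 * t) * ((m + 2 * t) choose m)"
    using step.IH by (rule mult_le_mono2)
  finally have "Suc m * ((Suc m + 1) * ((Suc m + t) choose Suc m)) \<le> Suc m * ((Suc m + 2 * t) choose Suc m)"
    unfolding s[of "2 * t"] by (simp only: mult.assoc mult.left_commute[of "Suc m"] s[of t])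
  then show ?case by (simp only: mult_le_cancel1)
qed

lemma choose_3: "((m + 3) choose m) * 6 = (m + 1)*(m + 2)*(m + 3)"
proof -
  have "(\<Prod>i<3. m + 1 + i) = (m + 1)*(m + 2)*(m + 3)"
    by (simp add: lessThan_nat_numeral lessThan_Suc) (simp add: algebra_simps)
  moreover have "fact 3 = (6 :: nat)" by (simp add: fact_numeral)
  ultimately show ?thesis using choose_fact'[of m 3] by simp
qed

lemma choose_4: "((m + 4) choose m) * 24 = (m + 1)*(m + 2)*(m + 3)*(m + 4)"
proof -
  have "(\<Prod>i<4. m + 1 + i) = (m + 1)*(m + 2)*(m + 3)*(m + 4)"
    by (simp add: lessThan_nat_numeral lessThan_Suc) (simp add: algebra_simps)
  moreover have "fact 4 = (24 :: nat)" by (simp add: fact_numeral)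
  ultimately show ?thesis using choose_fact'[of m 4] by simp
qed

lemma choose_5: "((m + 5) choose m) * 120 = (m + 1)*(m + 2)*(m + 3)*(m + 4)*(m + 5)"
proof -
  have "(\<Prod>i<5. m + 1 + i) = (m + 1)*(m + 2)*(m + 3)*(m + 4)*(m + 5)"
    by (simp add: lessThan_nat_numeral lessThan_Suc) (simp add: algebra_simps)
  moreover have "fact 5 = (120 :: nat)" by (simp add: fact_numeral)
  ultimately show ?thesis using choose_fact'[of m 5] by simp
qed

lemma choose_6: "((m + 6) choose m) * 720 = (m + 1)*(m + 2)*(m + 3)*(m + 4)*(m + 5)*(m + 6)"
proof -
  have "(\<Prod>i<6. m + 1 + i) = (m + 1)*(m + 2)*(m + 3)*(m + 4)*(m + 5)*(m + 6)"
    by (simp add: lessThan_nat_numeral lessThan_Suc) (simp add: algebra_simps)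
  moreover have "fact 6 = (720 :: nat)" by (simp add: fact_numeral)
  ultimately show ?thesis using choose_fact'[of m 6] by simp
qed

lemma choose_8: "((m + 8) choose m) * 40320 = (m + 1)*(m + 2)*(m + 3)*(m + 4)*(m + 5)*(m + 6)*(m + 7)*(m + 8)"
proof -
  have "(\<Prod>i<8. m + 1 + i) = (m + 1)*(m + 2)*(m + 3)*(m + 4)*(m + 5)*(m + 6)*(m + 7)*(m + 8)"
    by (simp add: lessThan_nat_numeral lessThan_Suc) (simp add: algebra_simps)
  moreover have "fact 8 = (40320 :: nat)" by (simp add: fact_numeral)
  ultimately show ?thesis using choose_fact'[of m 8] by simp
qed

text \<open>Induction by halving: the inequality at \<open>t div 2\<close> gives
  \<open>bsum m t < C(m + t, m)\<close>, and \<open>choose_double\<close> turns this into the claim.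
  The excluded pairs are genuine: for \<open>t = 4\<close> the two sides are 54, 45 if
  \<open>m = 2\<close>; 192, 165 if \<open>m = 3\<close>; 500, 495 if \<open>m = 4\<close>; for
  \<open>t = 8\<close>, \<open>m = 2\<close> they are 162, 153.\<close>

lemma bsum_less_choose:
  assumes "m \<ge> 2" "t \<ge> 3" "\<not> (t = 4 \<and> m \<le> 4)" "\<not> (t = 8 \<and> m = 2)"
  shows "(m + 1) * bsum m t < (m + 2 * t) choose m"
  using assms(2-)
proof (induction t rule: less_induct)
  case (less t)
  obtain q where q: "m = q + 2" using assms(1) by (metis le_add_diff_inverse2)
  have t3: "3 \<le> t" by (rule less.prems(1))
  have "t = 3 \<or> t = 4 \<or> t = 5 \<or> t \<ge> 6" using t3 by linarith
  then consider "t = 3" | "t = 4" | "t = 5" | "t \<ge> 6" by blast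
  then show ?case
  proof cases
    case 1
    have "((m + 1) * bsum m 3) * 720 < ((m + 6) choose m) * 720"
      unfolding choose_6 bsum_small q by (simp add: algebra_simps)
    then show ?thesis using 1 by simp
  next
    case 2
    then obtain p where p: "m = p + 5" using less.prems le_Suc_ex[of 5 m] by (auto simp: add.commute)
    have "((m + 1) * bsum m 4) * 40320 < ((m + 8) choose m) * 40320"
      unfolding choose_8 bsum_small p by (simp add: algebra_simps)
    then show ?thesis using 2 by simp
  next
    case 3
    have "bsum m 5 * 120 < ((m + 5) choose m) * 120"
      unfolding choose_5 bsum_small q by (simp add: algebra_simps)
    then have "bsum m 5 < (m + 5) choose m" by simp
    then have "(m + 1) * bsum m 5 < (m + 1) * ((m + 5) choose m)" by (intro mult_strict_left_mono) simp_all
    also have "\<dots> \<le> (m + 2 * 5) choose m" by (rule choose_double[OF assms(1)]) simp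
    finally show ?thesis using 3 by simp
  next
    case 4
    show ?thesis
    proof (cases "(t div 2 = 4 \<and> m \<le> 4) \<or> (t div 2 = 8 \<and> m = 2)")
      case False
      then have IH: "(m + 1) * bsum m (t div 2) < (m + 2 * (t div 2)) choose m"
        using 4 by (intro less.IH) auto
      have "bsum m t < (m + t) choose m"
      proof (cases "even t")
        case True
        then show ?thesis using IH bsum_rec[of m t] by (simp add: even_iff_mod_2_eq_zero)
      next
        case odd: False
        then have t: "m + t = Suc (m + 2 * (t div 2))" by (simp add: odd_two_times_div_two_succ)
        obtain k where k: "m = Suc k" using assms(1) by (cases m) auto
        \<comment> \<open>For odd \<open>t\<close> the last step in Pascal's triangle adds at least
          \<open>m = k + 1\<close>, which absorbs the binary digit 1.\<close>
        have "k + 1 \<le> (m + 2 * (t div 2)) choose k"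
        proof -
          have "Suc k choose k \<le> (m + 2 * (t div 2)) choose k" using k by (intro binomial_right_mono) auto
          then show ?thesis by simp
        qed
        then have "((m + 2 * (t div 2)) choose m) + m \<le> (m + t) choose m"
          unfolding t using k by simp
        then show ?thesis using IH bsum_rec[of m t] odd by (simp add: odd_iff_mod_2_eq_one)
      qed
      then have "(m + 1) * bsum m t < (m + 1) * ((m + t) choose m)" by (intro mult_strict_left_mono) simp_all
      also have "\<dots> \<le> (m + 2 * t) choose m" by (rule choose_double[OF assms(1)]) (use 4 in simp)
      finally show ?thesis .
    next
      case True
      have "(m = 2 \<or> m = 3 \<or> m = 4) \<and> (t = 8 \<or> t = 9) \<or> m = 2 \<and> (t = 16 \<or> t = 17)"
        using True assms(1) by linarith
      moreover note choose_numerals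
      ultimately show ?thesis using less.prems bsum_small by (elim disjE conjE) simp_all
    qed
  qed
qed

text \<open>The dimension \<open>M\<close> is a variable of its own, so that instances are stated
  with numerals instead of \<open>Suc\<close>. The arguments of the instances below are
  \<open>M\<close>, \<open>m\<close>, the degree, \<open>u\<close>, \<open>v\<close>,
  \<open>k\<close>, \<open>e\<close> in this order.\<close>

lemma horace_numeral:
  assumes "M = Suc m" "dp_indep m d u" "dp_indep M (d - 1) v" "dp_indep M (d - 2) k" "k \<le> v" "d \<ge> 3"
    "e \<le> v - k" "(M + 1) * k + e \<le> (M + (d - 2)) choose M"
    "u + (M + 1) * v + ((M + (d - 2)) choose M) \<le> ((M + (d - 1)) choose M) + ((M + 1) * k + e)"
  shows "dp_indep M d (u + v)"
proof -
  have "m + 2 = M + 1" using assms(1) by simp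
  then show ?thesis using horace[of m d u v k e, folded assms(1)] assms(2-) by simp
qed

section \<open>Double points in small degree and dimension\<close>

lemma dp_indep_2_4_3: "dp_indep 2 4 3"
  using dp_indep_mono[OF dp_indep_coord[of 4 2], of 3] by simp

lemma dp_indep_3_3_3: "dp_indep 3 3 3"
  using dp_indep_mono[OF dp_indep_coord[of 3 3], of 3] by simp

lemma dp_indep_3_2_1: "dp_indep 3 2 1"
  by (rule dp_indep_count) (simp_all add: choose_numerals)

lemma dp_indep_3_4_6: "dp_indep 3 4 6"
  using horace_numeral[of 3 2 4 3 3 1 2] dp_indep_2_4_3 dp_indep_3_3_3 dp_indep_3_2_1
  by (simp add: choose_numerals)

lemma dp_indep_3_4_3: "dp_indep 3 4 3"
  using dp_indep_mono[OF dp_indep_coord[of 4 3], of 3] by simp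

lemma dp_indep_4_3_5: "dp_indep 4 3 5"
  using dp_indep_mono[OF dp_indep_coord[of 3 4], of 5] by simp

lemma dp_indep_4_2_1: "dp_indep 4 2 1"
  by (rule dp_indep_count) (simp_all add: choose_numerals)

lemma dp_indep_4_4_8: "dp_indep 4 4 8"
  using horace_numeral[of 4 3 4 3 5 1 4] dp_indep_3_4_3 dp_indep_4_3_5 dp_indep_4_2_1
  by (simp add: choose_numerals)

lemma dp_indep_1_9_5: "dp_indep 1 9 5"
  by (rule dp_indep_count) (simp_all add: choose_numerals)

lemma dp_indep_1_8_4: "dp_indep 1 8 4"
  by (rule dp_indep_count) (simp_all add: choose_numerals)

lemma dp_indep_2_7_9: "dp_indep 2 7 9"
  by (rule dp_indep_count) (simp_all add: choose_numerals)

lemma dp_indep_2_6_7: "dp_indep 2 6 7"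
  by (rule dp_indep_count) (simp_all add: choose_numerals)

lemma dp_indep_2_8_13: "dp_indep 2 8 13"
  using horace_numeral[of 2 1 8 4 9 7 2] dp_indep_1_8_4 dp_indep_2_7_9 dp_indep_2_6_7
  by (simp add: choose_numerals)

lemma dp_indep_1_7_4: "dp_indep 1 7 4"
  by (rule dp_indep_count) (simp_all add: choose_numerals)

lemma dp_indep_1_5_2: "dp_indep 1 5 2"
  using dp_indep_mono[OF dp_indep_coord[of 5 1], of 2] by simp

lemma dp_indep_2_4_4: "dp_indep 2 4 4"
  by (rule dp_indep_count) (simp_all add: choose_numerals)

lemma dp_indep_2_3_3: "dp_indep 2 3 3"
  using dp_indep_mono[OF dp_indep_coord[of 3 2], of 3] by simp

lemma dp_indep_2_5_6: "dp_indep 2 5 6"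
  using horace_numeral[of 2 1 5 2 4 3 1] dp_indep_1_5_2 dp_indep_2_4_4 dp_indep_2_3_3
  by (simp add: choose_numerals)

lemma dp_indep_2_7_11: "dp_indep 2 7 11"
  using horace_numeral[of 2 1 7 4 7 6 1] dp_indep_1_7_4 dp_indep_2_6_7 dp_indep_2_5_6
  by (simp add: choose_numerals)

text \<open>The numerical condition of the specialisation holds with equality:
  \<open>5 + 39 + 36 = 45 + 35\<close>.\<close>

lemma dp_indep_2_9_18: "dp_indep 2 9 18"
  using horace_numeral[of 2 1 9 5 13 11 2] dp_indep_1_9_5 dp_indep_2_8_13 dp_indep_2_7_11
  by (simp add: choose_numerals)

lemma dp_indep_1_17_9: "dp_indep 1 17 9"
  by (rule dp_indep_count) (simp_all add: choose_numerals)

lemma dp_indep_2_16_46: "dp_indep 2 16 46"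
  by (rule dp_indep_count) (simp_all add: choose_numerals)

lemma dp_indep_1_15_7: "dp_indep 1 15 7"
  by (rule dp_indep_count) (simp_all add: choose_numerals)

lemma dp_indep_2_14_35: "dp_indep 2 14 35"
  by (rule dp_indep_count) (simp_all add: choose_numerals)

lemma dp_indep_2_13_31: "dp_indep 2 13 31"
  by (rule dp_indep_count) (simp_all add: choose_numerals)

lemma dp_indep_2_15_42: "dp_indep 2 15 42"
  using horace_numeral[of 2 1 15 7 35 31 4] dp_indep_1_15_7 dp_indep_2_14_35 dp_indep_2_13_31
  by (simp add: choose_numerals)

text \<open>The number is \<open>bsum 2 8 + 1\<close>. The specialisation is again exact:
  \<open>9 + 138 + 136 = 153 + 130\<close>.\<close>

lemma dp_indep_2_17_55: "dp_indep 2 17 55"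
  using horace_numeral[of 2 1 17 9 46 42 4] dp_indep_1_17_9 dp_indep_2_16_46 dp_indep_2_15_42
  by (simp add: choose_numerals)

lemma dp_indep_2_9_15: "dp_indep 2 9 15"
  by (rule dp_indep_count) (simp_all add: choose_numerals)

lemma dp_indep_2_8_12: "dp_indep 2 8 12"
  by (rule dp_indep_count) (simp_all add: choose_numerals)

lemma dp_indep_2_7_8: "dp_indep 2 7 8"
  by (rule dp_indep_count) (simp_all add: choose_numerals)

lemma dp_indep_3_6_14: "dp_indep 3 6 14"
  by (rule dp_indep_count) (simp_all add: choose_numerals)

lemma dp_indep_3_5_8: "dp_indep 3 5 8"
  by (rule dp_indep_count) (simp_all add: choose_numerals)

lemma dp_indep_3_7_22: "dp_indep 3 7 22"
  using horace_numeral[of 3 2 7 8 14 8 6] dp_indep_2_7_8 dp_indep_3_6_14 dp_indep_3_5_8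
  by (simp add: choose_numerals)

lemma dp_indep_3_8_34: "dp_indep 3 8 34"
  using horace_numeral[of 3 2 8 12 22 14 8] dp_indep_2_8_12 dp_indep_3_7_22 dp_indep_3_6_14
  by (simp add: choose_numerals)

lemma dp_indep_2_7_10: "dp_indep 2 7 10"
  by (rule dp_indep_count) (simp_all add: choose_numerals)

lemma dp_indep_3_7_24: "dp_indep 3 7 24"
  using horace_numeral[of 3 2 7 10 14 8 6] dp_indep_2_7_10 dp_indep_3_6_14 dp_indep_3_5_8
  by (simp add: choose_numerals)

text \<open>The number is \<open>bsum 3 4 + 1\<close>, once more without slack:
  \<open>15 + 136 + 120 = 165 + 106\<close>.\<close>

lemma dp_indep_3_9_49: "dp_indep 3 9 49"
  using horace_numeral[of 3 2 9 15 34 24 10] dp_indep_2_9_15 dp_indep_3_8_34 dp_indep_3_7_24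
  by (simp add: choose_numerals)

lemma dp_indep_3_9_35: "dp_indep 3 9 35"
  by (rule dp_indep_count) (simp_all add: choose_numerals)

lemma dp_indep_4_8_66: "dp_indep 4 8 66"
  by (rule dp_indep_count) (simp_all add: choose_numerals)

lemma dp_indep_4_7_34: "dp_indep 4 7 34"
  by (rule dp_indep_count) (simp_all add: choose_numerals)

lemma dp_indep_4_9_101: "dp_indep 4 9 101"
  using horace_numeral[of 4 3 9 35 66 34 32] dp_indep_3_9_35 dp_indep_4_8_66 dp_indep_4_7_34
  by (simp add: choose_numerals)

text \<open>The supply of points outside the hyperplane for degree 5. The parameter count works for
  \<open>m = 2\<close> and from \<open>m = 5\<close> on; for \<open>m = 3\<close> and
  \<open>m = 4\<close> it fails by equality, 20 against 20 and 35 against 35.\<close>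

lemma dp_indep_4_double:
  assumes "m \<ge> 2" shows "dp_indep m 4 (2 * m)"
proof -
  consider "m = 2" | "m = 3" | "m = 4" | "m \<ge> 5" using assms by linarith
  then show ?thesis
  proof cases
    case 1
    show ?thesis unfolding 1 by (rule dp_indep_count) (simp_all add: choose_numerals)
  next
    case 4
    then obtain p where p: "m = p + 5" using le_Suc_ex[of 5 m] by (auto simp: add.commute)
    have "((m + 1) * (2 * m - 1)) * 6 < ((m + 3) choose m) * 6"
      unfolding choose_3 p by (simp add: algebra_simps)
    then show ?thesis by (intro dp_indep_count) simp_all
  qed (use dp_indep_3_4_6 dp_indep_4_4_8 in simp_all)
qed

text \<open>Induction on \<open>m\<close> by specialisation, up to the number
  \<open>bsum m 2 + 1\<close>: \<open>m * m + m + 1\<close> points move to the hyperplane and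
  \<open>2 * (m + 1)\<close> stay; of these, \<open>m + 2\<close> are independent in degree 3 as
  coordinate points are, and the other \<open>m\<close> give one condition each.\<close>

lemma dp_indep_5:
  assumes "m \<ge> 1" shows "dp_indep m 5 (m * m + m + 1)"
  using assms
proof (induction m rule: dec_induct)
  case base
  show ?case by (rule dp_indep_count) simp_all
next
  case (step m)
  obtain p where p: "m = p + 1" using step.hyps by (metis le_add_diff_inverse2)
  define M where "M = Suc m"
  have Mp: "M = p + 2" by (simp add: M_def p)
  have "((M + 1) * (M + 1) + m) * 6 \<le> ((M + 3) choose M) * 6"
    unfolding choose_3 Mp p by (simp add: algebra_simps)
  then have 1: "(M + 1) * (M + 1) + m \<le> (M + 3) choose M" by simp
  have "((m * m + m + 1) + (M + 1) * (2 * M)) * 24 + 4 * (((M + 3) choose M) * 6)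
      \<le> ((M + 4) choose M) * 24 + ((M + 1) * (M + 1) + m) * 24"
    unfolding choose_3 choose_4 Mp p by (simp add: algebra_simps)
  then have 2: "(m * m + m + 1) + (M + 1) * (2 * M) + ((M + 3) choose M) \<le> ((M + 4) choose M) + ((M + 1) * (M + 1) + m)"
  proof -
    have "a + b \<le> c + e" if "a * 24 + 4 * (b * 6) \<le> c * 24 + e * 24" for a b c e :: nat
      using that by simp
    then show ?thesis using \<open>_ \<le> _ * 24 + _\<close> by blast
  qed
  have "dp_indep M 5 ((m * m + m + 1) + 2 * M)"
  proof (rule horace_numeral[of M m 5 "m * m + m + 1" "2 * M" "M + 1" m])
    show "dp_indep M (5 - 1) (2 * M)" using dp_indep_4_double[of M] step.hyps by (simp add: M_def)
    show "dp_indep M (5 - 2) (M + 1)" using dp_indep_coord[of 3 M] by simp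
  qed (use 1 2 step.IH step.hyps in \<open>simp_all add: M_def\<close>)
  moreover have "(m * m + m + 1) + 2 * M = Suc m * Suc m + Suc m + 1" by (simp add: M_def)
  ultimately show ?case by (simp only: M_def)
qed

lemma bsum_1: "bsum 1 t = t"
proof (induction t rule: less_induct)
  case (less t)
  have "t div 2 + t div 2 + t mod 2 = t" by presburger
  then show ?case using less bsum_rec[of 1 t] by (cases "t = 0") auto
qed

text \<open>For \<open>m >= 2\<close> the count of \<open>bsum_less_choose\<close> settles all but a
  few \<open>t = (d - 1) div 2\<close>. For \<open>t = 1\<close> coordinate points suffice; for
  \<open>t = 2\<close>, degree 5 needs specialisation and degree 6 a count of its own. In the
  remaining pairs \<open>t = 4\<close>, \<open>m <= 4\<close> and \<open>t = 8\<close>,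
  \<open>m = 2\<close> an even \<open>d\<close> has one degree more to offer to the count, and an
  odd \<open>d\<close> is one of the small cases above.\<close>

theorem dp_indep_bound:
  assumes m: "m \<ge> 1" and d: "d \<ge> 3" and ex: "\<not> (m = 2 \<and> d = 9)"
  shows "dp_indep m d (bsum m ((d - 1) div 2) + 1)"
proof -
  define t where "t = (d - 1) div 2"
  have td: "d = 2 * t + 1 \<or> d = 2 * t + 2" using d by (auto simp: t_def)
  have t1: "t \<ge> 1" using d by (auto simp: t_def)
  have count: "dp_indep m d (bsum m t + 1)" if "(m + 1) * bsum m t < (m + 2 * t) choose m"
  proof -
    have "(m + 2 * t) choose m \<le> (m + (d - 1)) choose m"
      by (rule binomial_right_mono) (use td in auto)
    then show ?thesis using d that by (intro dp_indep_count) auto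
  qed
  have "dp_indep m d (bsum m t + 1)"
  proof (cases "m = 1")
    case True
    have "dp_indep 1 d (t + 1)" by (rule dp_indep_count) (use td t1 in auto)
    then show ?thesis using True bsum_1 by simp
  next
    case False
    then have m2: "m \<ge> 2" using m by simp
    consider "t = 1" | "t = 2" "d = 5" | "t = 2" "d = 6" | "t = 4" "m = 2 \<or> m = 3 \<or> m = 4" | "t = 8" "m = 2"
      | "t \<ge> 3" "\<not> (t = 4 \<and> m \<le> 4)" "\<not> (t = 8 \<and> m = 2)"
      using t1 td m2 by linarith
    then show ?thesis
    proof cases
      case 1
      then show ?thesis using dp_indep_coord[OF d, of m] bsum_small(1)[of m] by simp
    next
      case 2
      then show ?thesis using dp_indep_5[OF m] bsum_small(2)[of m] by (simp add: algebra_simps)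
    next
      case 3
      obtain q where q: "m = q + 2" using m2 by (metis le_add_diff_inverse2)
      have "((m + 1) * bsum m 2) * 120 < ((m + 5) choose m) * 120"
        unfolding choose_5 bsum_small q by (simp add: algebra_simps)
      then show ?thesis using 3 by (intro dp_indep_count) simp_all
    next
      case 4
      then have "d = 9 \<or> d = 10" using td by auto
      moreover have "dp_indep m d (bsum m t + 1)" if "d = 10"
        using 4 that by (intro dp_indep_count) (auto simp: bsum_small choose_numerals)
      moreover have "dp_indep m d (bsum m t + 1)" if "d = 9"
        using 4 that ex dp_indep_3_9_49 dp_indep_4_9_101 by (auto simp: bsum_small)
      ultimately show ?thesis by blast
    next
      case 5
      then have "d = 17 \<or> d = 18" using td by auto
      moreover have "dp_indep m d (bsum m t + 1)" if "d = 18"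
        using 5 that by (intro dp_indep_count) (auto simp: bsum_small choose_numerals)
      moreover have "dp_indep m d (bsum m t + 1)" if "d = 17"
        using 5 that dp_indep_2_17_55 by (auto simp: bsum_small)
      ultimately show ?thesis by blast
    next
      case 6
      show ?thesis by (rule count) (rule bsum_less_choose[OF m2 6])
    qed
  qed
  then show ?thesis by (simp add: t_def)
qed

lemma choose_double_Suc: "(m + 1) * ((m + k) choose m) \<le> (m + (2 * k + 1)) choose m"
proof (induction m)
  case (Suc m)
  have s: "Suc m * ((Suc m + k) choose Suc m) = (Suc m + k) * ((m + k) choose m)" for k
    using Suc_times_binomial_eq[of "m + k" m] by (simp only: mult.commute add_Suc)
  have "(Suc m + 1) * (Suc m + k) \<le> (Suc m + (2 * k + 1)) * (m + 1)"
    by (simp add: algebra_simps)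
  then have "(Suc m + 1) * (Suc m + k) * ((m + k) choose m) \<le> (Suc m + (2 * k + 1)) * ((m + 1) * ((m + k) choose m))"
    by (metis mult.assoc mult_le_mono1)
  also have "\<dots> \<le> (Suc m + (2 * k + 1)) * ((m + (2 * k + 1)) choose m)"
    using Suc.IH by (rule mult_le_mono2)
  finally have "Suc m * ((Suc m + 1) * ((Suc m + k) choose Suc m)) \<le> Suc m * ((Suc m + (2 * k + 1)) choose Suc m)"
    unfolding s[of "2 * k + 1"] by (simp only: mult.assoc mult.left_commute[of "Suc m"] s[of k])
  then show ?case by (simp only: mult_le_cancel1)
qed simp

text \<open>Meant for the simple points in degree \<open>d - 2\<close>, which is at least
  \<open>2 * t - 1\<close>. Doubling \<open>2 * s - 1\<close> and adding one gives
  \<open>4 * s - 1\<close>, so with \<open>choose_double_Suc\<close> the halving induction closes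
  for all \<open>t >= 1\<close>.\<close>

lemma bsum_less_choose':
  assumes m: "m \<ge> 1" and t: "t \<ge> 1"
  shows "bsum m t < (m + (2 * t - 1)) choose m"
  using t
proof (induction t rule: less_induct)
  case (less t)
  show ?case
  proof (cases "t = 1")
    case True
    have "(m + (2 * t - 1)) choose m = m + 1" using True binomial_symmetric[of m "m + 1"] by simp
    then show ?thesis using True bsum_small(1)[of m] by simp
  next
    case False
    define s b where "s = t div 2" and "b = t mod 2"
    have t: "t = 2 * s + b" "b \<le> 1" "s \<ge> 1" "s < t" using less.prems False by (auto simp: s_def b_def)
    have IH: "bsum m s < (m + (2 * s - 1)) choose m" using less.IH t by blast
    have "bsum m t = (m + 1) * bsum m s + m * b" using bsum_rec[of m t] by (simp only: s_def b_def)
    also have "\<dots> < (m + 1) * (bsum m s + 1)" using t(2) by (cases b) auto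
    also have "\<dots> \<le> (m + 1) * ((m + (2 * s - 1)) choose m)" using IH by (intro mult_le_mono2) auto
    also have "\<dots> \<le> (m + (2 * (2 * s - 1) + 1)) choose m" by (rule choose_double_Suc)
    also have "\<dots> \<le> (m + (2 * t - 1)) choose m" by (rule binomial_right_mono) (use t in auto)
    finally show ?thesis .
  qed
qed

section \<open>Multiforms and points on the small diagonal\<close>

definition sv_vars :: "nat \<Rightarrow> (nat \<Rightarrow> nat) \<Rightarrow> (nat \<times> nat) set"
  where "sv_vars r n = Sigma {1..r} (\<lambda>i. {..n i})"

definition sv_mon :: "nat \<Rightarrow> (nat \<Rightarrow> nat multiset) \<Rightarrow> (nat \<times> nat \<Rightarrow> complex) \<Rightarrow> complex"
  where "sv_mon r M w = (\<Prod>i=1..r. mon (M i) (\<lambda>a. w (i, a)))"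

text \<open>Multihomogeneous forms of multidegree \<open>d\<close>, as functions of all coordinates.
  They are the pullbacks of the linear forms on the ambient space of the Segre-Veronese
  embedding.\<close>

definition mforms :: "nat \<Rightarrow> (nat \<Rightarrow> nat) \<Rightarrow> (nat \<Rightarrow> nat) \<Rightarrow> ((nat \<times> nat \<Rightarrow> complex) \<Rightarrow> complex) set"
  where "mforms r n d = cfun.span (sv_mon r ` sv_index r n d)"

definition diag :: "(nat \<Rightarrow> complex) \<Rightarrow> nat \<times> nat \<Rightarrow> complex"
  where "diag x = (\<lambda>k. x (snd k))"

lemma finite_sv_vars [simp]: "finite (sv_vars r n)" by (simp add: sv_vars_def)

lemma mforms_subspace: "cfun.subspace (mforms r n d)" by (simp add: mforms_def)

lemma mforms_cong: "(\<And>i. i \<in> {1..r} \<Longrightarrow> d i = d' i) \<Longrightarrow> mforms r n d = mforms r n d'"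
proof -
  assume "\<And>i. i \<in> {1..r} \<Longrightarrow> d i = d' i"
  then have "sv_index r n d = sv_index r n d'" unfolding sv_index_def by (intro PiE_cong) simp
  then show ?thesis by (simp add: mforms_def)
qed

lemma mforms_add: "F \<in> mforms r n d \<Longrightarrow> G \<in> mforms r n d \<Longrightarrow> (\<lambda>w. F w + G w) \<in> mforms r n d"
  using cfun.subspace_add[OF mforms_subspace] by (fastforce simp: plus_fun_def)

lemma mforms_cmult: "F \<in> mforms r n d \<Longrightarrow> (\<lambda>w. c * F w) \<in> mforms r n d"
  using cfun.subspace_scale[OF mforms_subspace] by (fastforce simp: cscale_def)

lemma mforms_diff: "F \<in> mforms r n d \<Longrightarrow> G \<in> mforms r n d \<Longrightarrow> (\<lambda>x. F x - G x) \<in> mforms r n d"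
  using mforms_add[of F r n d "\<lambda>x. - 1 * G x"] mforms_cmult[of G r n d "-1"] by simp

lemma mforms_sum: "(\<And>k. k \<in> S \<Longrightarrow> F k \<in> mforms r n d) \<Longrightarrow> (\<lambda>x. \<Sum>k\<in>S. F k x) \<in> mforms r n d"
proof (induction S rule: infinite_finite_induct)
  case (insert k S)
  then show ?case by (auto intro!: mforms_add)
qed (use cfun.subspace_0[OF mforms_subspace] in \<open>auto simp: zero_fun_def\<close>)

lemma polyfun_sv_mon: "M \<in> sv_index r n d \<Longrightarrow> polyfun (sv_vars r n) (sv_mon r M)"
  unfolding sv_mon_def[abs_def]
proof (rule polyfun_prod)
  fix i assume M: "M \<in> sv_index r n d" and i: "i \<in> {1..r}"
  then have "M i \<in> multisets_of_size {0..n i} (d i)" unfolding sv_index_def by (rule PiE_mem)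
  then have "set_mset (M i) \<subseteq> {..n i}" by (auto simp: multisets_of_size_def)
  then have "polyfun {..n i} (mon (M i))" by (rule polyfun_mon)
  then show "polyfun (sv_vars r n) (\<lambda>w. mon (M i) (\<lambda>a. w (i, a)))"
    by (rule polyfun_comp) (use i in \<open>auto simp: sv_vars_def intro: polyfun.var\<close>)
qed

lemma polyfun_mforms: "F \<in> mforms r n d \<Longrightarrow> polyfun (sv_vars r n) F"
  unfolding mforms_def by (rule polyfun_span) (auto simp: polyfun_sv_mon)

lemma mforms_const:
  assumes "\<And>i. i \<in> {1..r} \<Longrightarrow> d i = 0" shows "(\<lambda>_. c) \<in> mforms r n d"
proof -
  define M where "M = (\<lambda>i\<in>{1..r}. {#} :: nat multiset)"
  have "M \<in> sv_index r n d" using assms by (auto simp: M_def sv_index_def)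
  then have "sv_mon r M \<in> mforms r n d" unfolding mforms_def by (intro cfun.span_base) auto
  moreover have "sv_mon r M = (\<lambda>_. 1)" by (simp add: sv_mon_def fun_eq_iff M_def mon_empty)
  ultimately show ?thesis using mforms_cmult[of "sv_mon r M" r n d c] by simp
qed

lemma mforms_var:
  assumes "F \<in> mforms r n d" "i \<in> {1..r}" "a \<le> n i"
  shows "(\<lambda>w. w (i, a) * F w) \<in> mforms r n (d(i := Suc (d i)))"
  using assms(1) unfolding mforms_def[of r n d]
proof (induction rule: cfun.span_induct_alt)
  case base
  then show ?case using cfun.subspace_0[OF mforms_subspace] by (simp add: zero_fun_def)
next
  case (step c f g)
  then obtain M where M: "f = sv_mon r M" "M \<in> sv_index r n d" by auto
  let ?M = "M(i := add_mset a (M i))"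
  have "?M \<in> sv_index r n (d(i := Suc (d i)))"
    using M(2) assms(2,3) by (auto simp: sv_index_def multisets_of_size_def PiE_iff extensional_def)
  then have "sv_mon r ?M \<in> mforms r n (d(i := Suc (d i)))" unfolding mforms_def by (intro cfun.span_base) auto
  moreover have "sv_mon r ?M = (\<lambda>w. w (i, a) * sv_mon r M w)"
  proof
    fix w
    have "sv_mon r ?M w = mon (?M i) (\<lambda>a. w (i, a)) * (\<Prod>k\<in>{1..r} - {i}. mon (?M k) (\<lambda>a. w (k, a)))"
      unfolding sv_mon_def using assms(2) by (intro prod.remove) auto
    also have "\<dots> = w (i, a) * (mon (M i) (\<lambda>a. w (i, a)) * (\<Prod>k\<in>{1..r} - {i}. mon (M k) (\<lambda>a. w (k, a))))"
      by (simp add: mon_add)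
    also have "\<dots> = w (i, a) * sv_mon r M w"
      unfolding sv_mon_def using assms(2) by (subst prod.remove[of "{1..r}" i]) auto
    finally show "sv_mon r ?M w = w (i, a) * sv_mon r M w" .
  qed
  ultimately have "(\<lambda>w. w (i, a) * f w) \<in> mforms r n (d(i := Suc (d i)))" by (simp only: M)
  then have "(\<lambda>w. c * (w (i, a) * f w) + w (i, a) * g w) \<in> mforms r n (d(i := Suc (d i)))"
    by (rule mforms_add[OF mforms_cmult step.IH])
  moreover have "(\<lambda>w. c * (w (i, a) * f w) + w (i, a) * g w) = (\<lambda>w. w (i, a) * (cscale c f + g) w)"
    by (simp add: fun_eq_iff cscale_apply algebra_simps)
  ultimately show ?case by (simp only:)
qed

lemma mforms_var':
  assumes "F \<in> mforms r n (d(i := d i - 1))" "i \<in> {1..r}" "a \<le> n i" "d i \<ge> 1"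
  shows "(\<lambda>w. w (i, a) * F w) \<in> mforms r n d"
  using mforms_var[OF assms(1-3)] assms(4) by simp

text \<open>Freezing all factors but the \<open>i\<close>-th leaves a form of degree
  \<open>d i\<close>, so there is one Euler relation for each factor.\<close>

lemma mforms_euler:
  assumes "F \<in> mforms r n d" "i \<in> {1..r}"
  shows "(\<Sum>a\<le>n i. w (i, a) * pd (i, a) F w) = of_nat (d i) * F w"
proof -
  define sl where "sl x = (\<lambda>k. if fst k = i then x (snd k) else w k)" for x
  have "(\<lambda>x. F (sl x)) \<in> forms {..n i} (d i)"
    using assms(1) unfolding mforms_def
  proof (induction rule: cfun.span_induct_alt)
    case base
    then show ?case using cfun.subspace_0[OF forms_subspace] by (simp add: zero_fun_def)
  next
    case (step c f g)
    then obtain M where M: "f = sv_mon r M" "M \<in> sv_index r n d" by auto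
    have "M i \<in> multisets_of_size {..n i} (d i)"
      using M(2) assms(2) by (auto simp: sv_index_def PiE_iff atLeast0AtMost)
    then have m: "mon (M i) \<in> forms {..n i} (d i)" unfolding forms_def by (intro cfun.span_base) auto
    have "f (sl x) = (\<Prod>k\<in>{1..r} - {i}. mon (M k) (\<lambda>a. w (k, a))) * mon (M i) x" for x
    proof -
      have "f (sl x) = mon (M i) (\<lambda>a. sl x (i, a)) * (\<Prod>k\<in>{1..r} - {i}. mon (M k) (\<lambda>a. sl x (k, a)))"
        unfolding M sv_mon_def using assms(2) by (intro prod.remove) auto
      also have "(\<Prod>k\<in>{1..r} - {i}. mon (M k) (\<lambda>a. sl x (k, a))) = (\<Prod>k\<in>{1..r} - {i}. mon (M k) (\<lambda>a. w (k, a)))"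
        by (intro prod.cong) (auto simp: sl_def)
      finally show ?thesis by (simp add: sl_def)
    qed
    then have "(\<lambda>x. (cscale c f + g) (sl x)) = (\<lambda>x. c * ((\<Prod>k\<in>{1..r} - {i}. mon (M k) (\<lambda>a. w (k, a))) * mon (M i) x) + g (sl x))"
      by (simp add: cscale_apply)
    then show ?case using m step.IH by (simp only:) (intro forms_add forms_cmult)
  qed
  from forms_euler[OF this finite_atMost, of "\<lambda>a. w (i, a)"]
  have "(\<Sum>a\<le>n i. w (i, a) * pd a (\<lambda>x. F (sl x)) (\<lambda>a. w (i, a))) = of_nat (d i) * F (sl (\<lambda>a. w (i, a)))" .
  moreover have "sl (\<lambda>a. w (i, a)) = w" by (auto simp: sl_def fun_eq_iff)
  moreover have "pd a (\<lambda>x. F (sl x)) (\<lambda>a. w (i, a)) = pd (i, a) F w" for a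
  proof -
    have "sl ((\<lambda>a. w (i, a))(a := t)) = w((i, a) := t)" for t by (auto simp: sl_def fun_eq_iff)
    then show ?thesis by (simp add: pd_def)
  qed
  ultimately show ?thesis by simp
qed

text \<open>Each variable of the monomial is charged to some factor that has degree left; on the
  diagonal it does not matter to which.\<close>

lemma mon_lift:
  assumes "set_mset M \<subseteq> {..m}" "size M = (\<Sum>i=1..r. d i)" "\<And>i. i \<in> {1..r} \<Longrightarrow> m \<le> n i"
  shows "\<exists>H\<in>mforms r n d. \<forall>x. H (diag x) = mon M x"
  using assms
proof (induction M arbitrary: d)
  case empty
  then have "(\<lambda>_. 1) \<in> mforms r n d" by (intro mforms_const) auto
  then show ?case by (intro bexI[of _ "\<lambda>_. 1"]) (auto simp: mon_empty)
next
  case (add a M)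
  have "\<exists>i\<in>{1..r}. d i \<noteq> 0"
  proof (rule ccontr)
    assume "\<not> ?thesis"
    then have "(\<Sum>i=1..r. d i) = 0" by simp
    then show False using add.prems(2) by simp
  qed
  then obtain i where i: "i \<in> {1..r}" "d i \<noteq> 0" by blast
  let ?d = "d(i := d i - 1)"
  have "(\<Sum>k=1..r. d k) = d i + (\<Sum>k\<in>{1..r} - {i}. d k)" using i by (intro sum.remove) auto
  moreover have "(\<Sum>k=1..r. ?d k) = ?d i + (\<Sum>k\<in>{1..r} - {i}. ?d k)" using i by (intro sum.remove) auto
  moreover have "(\<Sum>k\<in>{1..r} - {i}. ?d k) = (\<Sum>k\<in>{1..r} - {i}. d k)" by (intro sum.cong) auto
  ultimately have "size M = (\<Sum>k=1..r. ?d k)" using add.prems(2) i(2) by simp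
  moreover have "set_mset M \<subseteq> {..m}" using add.prems(1) by simp
  ultimately have "\<exists>H\<in>mforms r n ?d. \<forall>x. H (diag x) = mon M x" using add.prems(3) by (intro add.IH)
  then obtain H where H: "H \<in> mforms r n ?d" "\<And>x. H (diag x) = mon M x" by blast
  have "(\<lambda>w. w (i, a) * H w) \<in> mforms r n d"
    by (rule mforms_var'[OF H(1)]) (use i add.prems(1) add.prems(3)[OF i(1)] in auto)
  then show ?case using H(2) by (intro bexI[of _ "\<lambda>w. w (i, a) * H w"]) (auto simp: mon_add diag_def)
qed

lemma forms_lift:
  assumes "F \<in> forms {..m} (\<Sum>i=1..r. d i)" "\<And>i. i \<in> {1..r} \<Longrightarrow> m \<le> n i"
  shows "\<exists>H\<in>mforms r n d. \<forall>x. H (diag x) = F x"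
  using assms(1) unfolding forms_def
proof (induction rule: cfun.span_induct_alt)
  case base
  then show ?case using cfun.subspace_0[OF mforms_subspace] by (intro bexI[of _ 0]) auto
next
  case (step c f g)
  then obtain M where M: "f = mon M" "set_mset M \<subseteq> {..m}" "size M = (\<Sum>i=1..r. d i)"
    by (auto simp: multisets_of_size_def)
  obtain H1 where H1: "H1 \<in> mforms r n d" "\<And>x. H1 (diag x) = mon M x"
    using mon_lift[OF M(2,3), of n] assms(2) by blast
  obtain H2 where H2: "H2 \<in> mforms r n d" "\<And>x. H2 (diag x) = g x" using step.IH by blast
  have "(\<lambda>w. c * H1 w + H2 w) \<in> mforms r n d" by (intro mforms_add mforms_cmult H1 H2)
  then show ?case using H1 H2 M by (intro bexI[of _ "\<lambda>w. c * H1 w + H2 w"]) (auto simp: cscale_apply)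
qed

lemma sum_decrease:
  fixes i r :: nat
  assumes "i \<in> {1..r}" "d i \<ge> (1::nat)"
  shows "(\<Sum>k=1..r. (d(i := d i - 1)) k) = (\<Sum>k=1..r. d k) - 1"
proof -
  have "(\<Sum>k=1..r. d k) = d i + (\<Sum>k\<in>{1..r} - {i}. d k)" using assms by (intro sum.remove) auto
  moreover have "(\<Sum>k=1..r. (d(i := d i - 1)) k) = (d(i := d i - 1)) i + (\<Sum>k\<in>{1..r} - {i}. (d(i := d i - 1)) k)"
    using assms by (intro sum.remove) auto
  moreover have "(\<Sum>k\<in>{1..r} - {i}. (d(i := d i - 1)) k) = (\<Sum>k\<in>{1..r} - {i}. d k)" by (intro sum.cong) auto
  ultimately show ?thesis using assms(2) by simp
qed

text \<open>Along the diagonal only the sums over the factors are seen, and these are first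
  derivatives of a form on \<open>P^m\<close>.\<close>

lemma mforms_chain_diag:
  assumes "F \<in> mforms r n d" "\<And>i. i \<in> {1..r} \<Longrightarrow> a \<le> n i"
  shows "pd a (\<lambda>x. F (diag x)) x = (\<Sum>i=1..r. pd (i, a) F (diag x))"
proof -
  have "pd a (\<lambda>x. F (diag x)) x = (\<Sum>k\<in>sv_vars r n. pd k F (diag x) * pd a (\<lambda>y. diag y k) x)"
    by (rule pd_chain[OF polyfun_mforms[OF assms(1)] finite_sv_vars, of UNIV])
       (auto simp: diag_def polyfun.var)
  also have "\<dots> = (\<Sum>i=1..r. \<Sum>b\<le>n i. pd (i, b) F (diag x) * (if b = a then 1 else 0))"
    unfolding sv_vars_def by (subst sum.Sigma) (auto simp: diag_def intro!: sum.cong)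
  also have "\<dots> = (\<Sum>i=1..r. pd (i, a) F (diag x))"
    using assms(2) by (intro sum.cong) (auto simp: if_distrib cong: if_cong)
  finally show ?thesis .
qed

text \<open>
  First order data at \<open>h\<close> points can be prescribed as far as the Euler relations allow, \<open>c\<close> being the
  common value of the form at the point that they enforce.
\<close>

definition svfull :: "nat \<Rightarrow> (nat \<Rightarrow> nat) \<Rightarrow> (nat \<Rightarrow> nat) \<Rightarrow> (nat \<Rightarrow> nat \<times> nat \<Rightarrow> complex) \<Rightarrow> nat \<Rightarrow> bool"
  where "svfull r n d W h \<longleftrightarrow> (\<forall>j<h. \<forall>\<xi> c.
    (\<forall>i\<in>{1..r}. (\<Sum>a\<le>n i. \<xi> (i, a) * W j (i, a)) = of_nat (d i) * c) \<longrightarrow>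
    (\<exists>F\<in>mforms r n d. \<forall>k<h. \<forall>\<tau>\<in>sv_vars r n. pd \<tau> F (W k) = (if k = j then \<xi> \<tau> else 0)))"

text \<open>\<open>supp\<close> puts the points into \<open>P^m\<close>, \<open>p0\<close> supplies
  a coordinate to divide by, and \<open>simple\<close> provides forms that are 1 at one point and 0
  at the others. They have degree \<open>d - 2\<close> because a 2x2 minor of two factors uses up
  two units.\<close>

locale diagonal =
  fixes r m h :: nat and n d :: "nat \<Rightarrow> nat" and p :: "nat \<Rightarrow> nat \<Rightarrow> complex"
  assumes mn: "\<And>i. i \<in> {1..r} \<Longrightarrow> m \<le> n i" and d1: "\<And>i. i \<in> {1..r} \<Longrightarrow> d i \<ge> 1"
    and supp: "\<And>j a. a > m \<Longrightarrow> p j a = 0" and p0: "\<And>j. j < h \<Longrightarrow> p j 0 \<noteq> 0"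
    and r1: "r \<ge> 1" and D2: "(\<Sum>i=1..r. d i) \<ge> 2"
    and simple: "dual_on (forms {..m} ((\<Sum>i=1..r. d i) - 2)) (\<lambda>j F. F (p j)) {..<h}"
begin

lemma bump1:
  assumes k: "k < h" and i: "i \<in> {1..r}"
  shows "\<exists>G\<in>mforms r n (d(i := d i - 1)). \<forall>l<h. G (diag (p l)) = (if l = k then 1 else 0)"
proof -
  obtain E where E: "\<forall>i\<in>{..<h}. E i \<in> forms {..m} ((\<Sum>i=1..r. d i) - 2) \<and> (\<forall>k\<in>{..<h}. E i (p k) = (if k = i then 1 else 0))"
    using simple unfolding dual_on_def by (rule exE)
  have "(\<lambda>x. x 0 * E k x) \<in> forms {..m} (Suc ((\<Sum>i=1..r. d i) - 2))"
    using E k by (intro forms_var_mult) auto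
  then have "(\<lambda>x. 1 / p k 0 * (x 0 * E k x)) \<in> forms {..m} (\<Sum>l=1..r. (d(i := d i - 1)) l)"
    using sum_decrease[of i r d] i d1[OF i] D2 by (intro forms_cmult) (simp add: Suc_diff_Suc numeral_2_eq_2)
  from forms_lift[OF this, of n] mn obtain G where
    "G \<in> mforms r n (d(i := d i - 1))" "\<And>x. G (diag x) = 1 / p k 0 * (x 0 * E k x)" by blast
  then show ?thesis using E k p0[OF k] by (intro bexI[of _ G]) auto
qed

lemma bump2:
  assumes k: "k < h" and i: "i \<in> {1..r}" "i' \<in> {1..r}" "i \<noteq> i'"
  shows "\<exists>G\<in>mforms r n (d(i := d i - 1, i' := d i' - 1)). \<forall>l<h. G (diag (p l)) = (if l = k then 1 else 0)"
proof -
  obtain E where E: "\<forall>i\<in>{..<h}. E i \<in> forms {..m} ((\<Sum>i=1..r. d i) - 2) \<and> (\<forall>k\<in>{..<h}. E i (p k) = (if k = i then 1 else 0))"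
    using simple unfolding dual_on_def by (rule exE)
  let ?d = "d(i := d i - 1)"
  have "(\<Sum>l=1..r. (?d(i' := ?d i' - 1)) l) = (\<Sum>i=1..r. d i) - 2"
    using sum_decrease[of i' r ?d] sum_decrease[of i r d] i d1[OF i(1)] d1[OF i(2)] by simp
  then have "E k \<in> forms {..m} (\<Sum>l=1..r. (d(i := d i - 1, i' := d i' - 1)) l)"
    using E k i by simp
  from forms_lift[OF this, of n] mn obtain G where
    "G \<in> mforms r n (d(i := d i - 1, i' := d i' - 1))" "\<And>x. G (diag x) = E k x" by blast
  then show ?thesis using E k by (intro bexI[of _ G]) auto
qed

text \<open>Representatives of the directions normal to the diagonal: all surplus coordinates, and
  the coordinates \<open>1..m\<close> of every factor but the first. Coordinate 0 of those factors
  is recovered from the Euler relations, as \<open>p j 0\<close> is nonzero.\<close>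

definition normal_dirs :: "(nat \<times> nat) set"
  where "normal_dirs = {(i, a) \<in> sv_vars r n. a > m \<or> (i \<ge> 2 \<and> a \<ge> 1)}"

text \<open>The equations of the diagonal do the work: the coordinate \<open>w (i, a)\<close> for
  \<open>a > m\<close>, otherwise the minor with columns \<open>0\<close> and \<open>a\<close> of
  the factors \<open>i\<close> and \<open>1\<close>. They vanish at all the points, so after
  multiplication by a form separating \<open>p k\<close> from the other points only their own
  derivatives at \<open>p k\<close> survive.\<close>

lemma normal_jet:
  assumes k: "k < h" and \<tau>: "\<tau> \<in> normal_dirs"
  shows "\<exists>E\<in>mforms r n d. (\<forall>\<sigma>\<in>normal_dirs. pd \<sigma> E (diag (p k)) = (if \<sigma> = \<tau> then 1 else 0)) \<and>
    (\<forall>l<h. l \<noteq> k \<longrightarrow> (\<forall>\<sigma>\<in>sv_vars r n. pd \<sigma> E (diag (p l)) = 0)) \<and>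
    (\<forall>a\<le>m. (\<Sum>i=1..r. pd (i, a) E (diag (p k))) = 0) \<and> E (diag (p k)) = 0"
proof -
  obtain i a where ia: "\<tau> = (i, a)" "i \<in> {1..r}" "a \<le> n i" "a > m \<or> (a \<le> m \<and> i \<ge> 2 \<and> a \<ge> 1)"
    using \<tau> by (force simp: normal_dirs_def sv_vars_def)
  show ?thesis
  proof (cases "a > m")
    case True
    obtain G where G: "G \<in> mforms r n (d(i := d i - 1))" "\<And>l. l < h \<Longrightarrow> G (diag (p l)) = (if l = k then 1 else 0)"
      using bump1[OF k ia(2)] by blast
    define E where "E = (\<lambda>w. w (i, a) * G w)"
    have Ef: "E \<in> mforms r n d"
      unfolding E_def by (rule mforms_var'[OF G(1) ia(2,3) d1[OF ia(2)]])
    have pv: "polyfun UNIV (\<lambda>w. w (i, a))" by (rule polyfun.var) simp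
    have z: "diag (p l) (i, a) = 0" for l using supp True by (simp add: diag_def)
    have pdE: "pd \<sigma> E (diag (p l)) = (if \<sigma> = \<tau> then G (diag (p l)) else 0)" for \<sigma> l
      unfolding E_def using pd_mult[OF pv polyfun_mforms[OF G(1)], of \<sigma> "diag (p l)"] z ia(1) by auto
    have "E (diag (p k)) = 0" using z by (simp add: E_def)
    then show ?thesis
      by (rule_tac bexI[OF _ Ef]) (use pdE G(2) k True ia(1) in \<open>auto intro!: sum.neutral\<close>)
  next
    case False
    then have a: "a \<le> m" "i \<ge> 2" "a \<ge> 1" using ia(4) by auto
    have i1: "1 \<in> {1..r}" "i \<noteq> 1" using r1 a by auto
    obtain G where G: "G \<in> mforms r n (d(i := d i - 1, 1 := d 1 - 1))" "\<And>l. l < h \<Longrightarrow> G (diag (p l)) = (if l = k then 1 else 0)"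
      using bump2[OF k ia(2) i1(1) i1(2)] by blast
    let ?d = "d(i := d i - 1)"
    have G': "G \<in> mforms r n (?d(1 := ?d 1 - 1))" using G(1) i1 by simp
    have mono: "(\<lambda>w. w (i, x) * (w (1, y) * G w)) \<in> mforms r n d" if "x \<le> m" "y \<le> m" for x y
    proof -
      have "(\<lambda>w. w (1, y) * G w) \<in> mforms r n ?d"
        by (rule mforms_var'[OF G' i1(1)]) (use mn[OF i1(1)] that d1[OF i1(1)] i1 in auto)
      from mforms_var'[OF this ia(2) _ d1[OF ia(2)]] show ?thesis using mn[OF ia(2)] that by auto
    qed
    \<comment> \<open>Of the four derivatives of the minor only the one in direction
      \<open>(i, a)\<close> belongs to \<open>normal_dirs\<close>; \<open>1 / p k 0\<close>
      normalises it.\<close>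
    define E where "E = (\<lambda>w. 1 / p k 0 * (w (i, a) * (w (1, 0) * G w) - w (i, 0) * (w (1, a) * G w)))"
    define N where "N = (\<lambda>w :: nat \<times> nat \<Rightarrow> complex. 1 / p k 0 * (w (i, a) * w (1, 0) - w (i, 0) * w (1, a)))"
    have EN: "E = (\<lambda>w. N w * G w)" by (simp add: E_def N_def fun_eq_iff algebra_simps)
    have Ef: "E \<in> mforms r n d"
      unfolding E_def using a by (intro mforms_cmult mforms_diff mono) auto
    have pv: "polyfun UNIV (\<lambda>w :: nat \<times> nat \<Rightarrow> complex. w t)" for t by (rule polyfun.var) simp
    have pN: "polyfun UNIV N" unfolding N_def by (intro polyfun.mult polyfun.const polyfun_diff pv)
    have Nd: "N (diag x) = 0" for x by (simp add: N_def diag_def)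
    have Ed: "E (diag x) = 0" for x by (simp add: EN Nd)
    have pdE: "pd \<sigma> E (diag (p l)) = pd \<sigma> N (diag (p l)) * G (diag (p l))" for \<sigma> l
      unfolding EN using pd_mult[OF pN polyfun_mforms[OF G(1)], of \<sigma> "diag (p l)"] Nd by simp
    have pdN: "pd \<sigma> N w = 1 / p k 0 *
        ((w (i, a) * (if (1, 0) = \<sigma> then 1 else 0) + (if (i, a) = \<sigma> then 1 else 0) * w (1, 0))
        - (w (i, 0) * (if (1, a) = \<sigma> then 1 else 0) + (if (i, 0) = \<sigma> then 1 else 0) * w (1, a)))" for \<sigma> w
      unfolding N_def pd_cmult[OF polyfun_diff[OF polyfun.mult[OF pv pv] polyfun.mult[OF pv pv]]]
        pd_diff[OF polyfun.mult[OF pv pv] polyfun.mult[OF pv pv]] pd_mult[OF pv pv] pd_var ..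
    have "pd \<sigma> E (diag (p k)) = (if \<sigma> = \<tau> then 1 else 0)" if "\<sigma> \<in> normal_dirs" for \<sigma>
    proof -
      have "\<sigma> \<noteq> (1, 0)" "\<sigma> \<noteq> (1, a)" "\<sigma> \<noteq> (i, 0)" using that a by (auto simp: normal_dirs_def)
      then have "pd \<sigma> N (diag (p k)) = (if \<sigma> = \<tau> then 1 else 0)"
        unfolding pdN using p0[OF k] ia(1) by (auto simp: diag_def)
      then show ?thesis using pdE G(2)[OF k] by simp
    qed
    moreover have "pd \<sigma> E (diag (p l)) = 0" if "l < h" "l \<noteq> k" for \<sigma> l
      using pdE G(2)[OF that(1)] that(2) by simp
    moreover have "(\<Sum>i=1..r. pd (i, b) E (diag (p k))) = 0" if "b \<le> m" for b
    proof -
      have "(\<Sum>i=1..r. pd (i, b) E (diag (p k))) = pd b (\<lambda>x. E (diag x)) (p k)"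
        by (rule mforms_chain_diag[OF Ef, symmetric]) (use mn that in fastforce)
      then show ?thesis by (simp add: Ed)
    qed
    ultimately show ?thesis using Ed by (intro bexI[OF _ Ef]) auto
  qed
qed

lemma finite_normal_dirs: "finite normal_dirs" by (rule finite_subset[of _ "sv_vars r n"]) (auto simp: normal_dirs_def)

text \<open>A combination of normal jets matches \<zeta> on \<open>normal_dirs\<close>. The
  difference \<delta> still satisfies both hypotheses: in the factors from the second on, the Euler
  relation kills the one component left, coordinate 0, and then the sums over the factors kill what
  is left in the first.\<close>

lemma normal_correction:
  assumes k: "k < h"
    and \<alpha>: "\<And>a. a \<le> m \<Longrightarrow> (\<Sum>i=1..r. \<zeta> (i, a)) = 0"
    and \<beta>: "\<And>i. i \<in> {1..r} \<Longrightarrow> (\<Sum>a\<le>n i. \<zeta> (i, a) * p k a) = 0"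
  shows "\<exists>C\<in>mforms r n d. \<forall>l<h. \<forall>\<tau>\<in>sv_vars r n. pd \<tau> C (diag (p l)) = (if l = k then \<zeta> \<tau> else 0)"
proof -
  define Q where "Q \<tau> E \<longleftrightarrow> E \<in> mforms r n d \<and>
    (\<forall>\<sigma>\<in>normal_dirs. pd \<sigma> E (diag (p k)) = (if \<sigma> = \<tau> then 1 else 0)) \<and>
    (\<forall>l<h. l \<noteq> k \<longrightarrow> (\<forall>\<sigma>\<in>sv_vars r n. pd \<sigma> E (diag (p l)) = 0)) \<and>
    (\<forall>a\<le>m. (\<Sum>i=1..r. pd (i, a) E (diag (p k))) = 0) \<and> E (diag (p k)) = 0" for \<tau> E
  have "\<forall>\<tau>\<in>normal_dirs. \<exists>E. Q \<tau> E" using normal_jet[OF k] unfolding Q_def Bex_def by blast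
  from bchoice[OF this] obtain E where Q: "\<forall>\<tau>\<in>normal_dirs. Q \<tau> (E \<tau>)" by (rule exE)
  have E: "E \<tau> \<in> mforms r n d"
    "\<sigma> \<in> normal_dirs \<Longrightarrow> pd \<sigma> (E \<tau>) (diag (p k)) = (if \<sigma> = \<tau> then 1 else 0)"
    "l < h \<Longrightarrow> l \<noteq> k \<Longrightarrow> \<sigma> \<in> sv_vars r n \<Longrightarrow> pd \<sigma> (E \<tau>) (diag (p l)) = 0"
    "a \<le> m \<Longrightarrow> (\<Sum>i=1..r. pd (i, a) (E \<tau>) (diag (p k))) = 0"
    "E \<tau> (diag (p k)) = 0" if "\<tau> \<in> normal_dirs" for \<tau> \<sigma> l a
    using bspec[OF Q that] unfolding Q_def by blast+
  define C where "C = (\<lambda>w. \<Sum>\<tau>\<in>normal_dirs. \<zeta> \<tau> * E \<tau> w)"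
  have Cf: "C \<in> mforms r n d" unfolding C_def by (intro mforms_sum mforms_cmult E(1))
  have pdC: "pd \<sigma> C w = (\<Sum>\<tau>\<in>normal_dirs. \<zeta> \<tau> * pd \<sigma> (E \<tau>) w)" for \<sigma> w
  proof -
    have "pd \<sigma> C w = (\<Sum>\<tau>\<in>normal_dirs. pd \<sigma> (\<lambda>w. \<zeta> \<tau> * E \<tau> w) w)"
      unfolding C_def by (rule pd_sum[of _ "sv_vars r n"]) (intro polyfun.mult polyfun.const polyfun_mforms[OF E(1)])
    also have "\<dots> = (\<Sum>\<tau>\<in>normal_dirs. \<zeta> \<tau> * pd \<sigma> (E \<tau>) w)"
      by (intro sum.cong refl pd_cmult[OF polyfun_mforms[OF E(1)]])
    finally show ?thesis .
  qed
  define \<delta> where "\<delta> \<tau> = \<zeta> \<tau> - pd \<tau> C (diag (p k))" for \<tau>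
  have \<delta>normal_dirs: "\<delta> \<sigma> = 0" if "\<sigma> \<in> normal_dirs" for \<sigma>
  proof -
    have "pd \<sigma> C (diag (p k)) = (\<Sum>\<tau>\<in>normal_dirs. if \<tau> = \<sigma> then \<zeta> \<tau> else 0)"
      unfolding pdC using E(2) that by (intro sum.cong) auto
    then show ?thesis using finite_normal_dirs that by (simp add: \<delta>_def)
  qed
  have \<delta>\<alpha>: "(\<Sum>i=1..r. \<delta> (i, a)) = 0" if "a \<le> m" for a
  proof -
    have "(\<Sum>i=1..r. pd (i, a) C (diag (p k))) = (\<Sum>\<tau>\<in>normal_dirs. \<zeta> \<tau> * (\<Sum>i=1..r. pd (i, a) (E \<tau>) (diag (p k))))"
      unfolding pdC by (subst sum.swap) (simp add: sum_distrib_left)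
    also have "\<dots> = 0" using E(4) that by (intro sum.neutral) auto
    finally show ?thesis using \<alpha>[OF that] by (simp add: \<delta>_def sum_subtractf)
  qed
  have C0: "C (diag (p k)) = 0" unfolding C_def using E(5) by (intro sum.neutral) auto
  have \<delta>\<beta>: "(\<Sum>a\<le>n i. \<delta> (i, a) * p k a) = 0" if "i \<in> {1..r}" for i
  proof -
    have "(\<Sum>a\<le>n i. p k a * pd (i, a) C (diag (p k))) = 0"
      using mforms_euler[OF Cf that, of "diag (p k)"] C0 by (simp add: diag_def)
    then show ?thesis using \<beta>[OF that] by (simp add: \<delta>_def algebra_simps sum_subtractf)
  qed
  have big: "\<delta> (i, a) = 0" if "i \<in> {1..r}" "i \<ge> 2" "a \<le> n i" for i a
  proof (cases "a = 0")
    case False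
    then show ?thesis using that by (intro \<delta>normal_dirs) (auto simp: normal_dirs_def sv_vars_def)
  next
    case True
    have "(\<Sum>b\<le>n i. \<delta> (i, b) * p k b) = (\<Sum>b\<le>n i. if b = 0 then \<delta> (i, b) * p k b else 0)"
      using that by (intro sum.cong refl) (auto simp: normal_dirs_def sv_vars_def intro!: \<delta>normal_dirs)
    then show ?thesis using \<delta>\<beta>[OF that(1)] p0[OF k] True by simp
  qed
  have "\<delta> (i, a) = 0" if "i \<in> {1..r}" "a \<le> n i" for i a
  proof (cases "i \<ge> 2")
    case True
    then show ?thesis using big that by blast
  next
    case False
    then have i: "i = 1" using that by auto
    show ?thesis
    proof (cases "a \<le> m")
      case True
      have "(\<Sum>l=1..r. \<delta> (l, a)) = (\<Sum>l=1..r. if l = 1 then \<delta> (l, a) else 0)"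
        using big True mn by (intro sum.cong refl) (force dest: mn)
      then show ?thesis using \<delta>\<alpha>[OF True] r1 i by simp
    next
      case False
      then show ?thesis using that by (intro \<delta>normal_dirs) (auto simp: normal_dirs_def sv_vars_def)
    qed
  qed
  then have "pd \<tau> C (diag (p k)) = \<zeta> \<tau>" if "\<tau> \<in> sv_vars r n" for \<tau>
    using that by (auto simp: sv_vars_def \<delta>_def)
  moreover have "pd \<sigma> C (diag (p l)) = 0" if "l < h" "l \<noteq> k" "\<sigma> \<in> sv_vars r n" for l \<sigma>
    unfolding pdC using E(3) that by (intro sum.neutral) auto
  ultimately show ?thesis using Cf by (intro bexI[OF _ Cf]) auto
qed

text \<open>The sums of \<xi> over the factors are made the gradient of a form on
  \<open>P^m\<close>, which is possible by independence of the double points. A lift of that form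
  has the right tangential derivatives, and its normal derivatives are corrected point by
  point.\<close>

lemma svfull_diag:
  assumes dual: "dual_on (forms {..m} (\<Sum>i=1..r. d i)) (\<lambda>k. jet (p (fst k)) (snd k)) (dbl m {..<h})"
  shows "svfull r n d (\<lambda>j. diag (p j)) h"
  unfolding svfull_def
proof (intro allI impI)
  fix j \<xi> c assume j: "j < h"
    and comp: "\<forall>i\<in>{1..r}. (\<Sum>a\<le>n i. \<xi> (i, a) * diag (p j) (i, a)) = of_nat (d i) * c"
  let ?D = "\<Sum>i=1..r. d i"
  define \<eta> where "\<eta> a = (\<Sum>i=1..r. \<xi> (i, a))" for a
  have "\<exists>F\<in>forms {..m} ?D. \<forall>k\<in>dbl m {..<h}. jet (p (fst k)) (snd k) F = (if fst k = j then \<eta> (the (snd k)) else 0)"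
    by (rule dual_on_interp[OF dual forms_subspace])
       (auto intro!: lin_on_jet[of _ "{..m}"] polyfun_forms)
  then obtain F0 where F0: "F0 \<in> forms {..m} ?D"
    "\<And>k a. k < h \<Longrightarrow> a \<le> m \<Longrightarrow> pd a F0 (p k) = (if k = j then \<eta> a else 0)"
    by (force simp: dbl_def)
  have cut: "(\<Sum>a\<le>n i. f a * p k a) = (\<Sum>a\<le>m. f a * p k a)" if "i \<in> {1..r}" for i f k
    using mn[OF that] supp by (intro sum.mono_neutral_right) auto
  \<comment> \<open>Adding the compatibility conditions of all factors gives Euler's relation in
    degree \<open>?D\<close>, so \<open>F0\<close> takes the value \<open>c\<close> at
    \<open>p j\<close>. This makes the corrections compatible in each factor separately.\<close>
  have F0v: "F0 (p k) = (if k = j then c else 0)" if k: "k < h" for k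
  proof -
    have "of_nat ?D * F0 (p k) = (\<Sum>a\<le>m. p k a * pd a F0 (p k))"
      by (rule forms_euler[OF F0(1) finite_atMost, symmetric])
    also have "\<dots> = (if k = j then (\<Sum>a\<le>m. p j a * \<eta> a) else 0)" using F0(2)[OF k] by simp
    also have "(\<Sum>a\<le>m. p j a * \<eta> a) = (\<Sum>i=1..r. \<Sum>a\<le>m. \<xi> (i, a) * p j a)"
      unfolding \<eta>_def by (subst sum.swap) (simp add: sum_distrib_left mult.commute)
    also have "\<dots> = (\<Sum>i=1..r. of_nat (d i) * c)"
      using comp cut by (intro sum.cong) (auto simp: diag_def)
    also have "\<dots> = of_nat ?D * c" by (simp add: sum_distrib_right)
    finally have *: "of_nat ?D * F0 (p k) = (if k = j then of_nat ?D * c else 0)" .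
    have "(of_nat ?D :: complex) \<noteq> 0" using D2 by (simp only: of_nat_eq_0_iff)
    then show ?thesis using * by (metis mult_cancel_left mult_zero_right)
  qed
  obtain H0 where H0: "H0 \<in> mforms r n d" "\<And>x. H0 (diag x) = F0 x" using forms_lift[OF F0(1), of n] mn by blast
  define \<zeta> where "\<zeta> k \<tau> = (if k = j then \<xi> \<tau> else 0) - pd \<tau> H0 (diag (p k))" for k \<tau>
  have "\<exists>C\<in>mforms r n d. \<forall>l<h. \<forall>\<tau>\<in>sv_vars r n. pd \<tau> C (diag (p l)) = (if l = k then \<zeta> k \<tau> else 0)" if k: "k < h" for k
  proof (rule normal_correction[OF k])
    fix a assume a: "a \<le> m"
    have "(\<Sum>i=1..r. pd (i, a) H0 (diag (p k))) = pd a (\<lambda>x. H0 (diag x)) (p k)"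
      by (rule mforms_chain_diag[OF H0(1), symmetric]) (use mn a in fastforce)
    also have "\<dots> = (if k = j then \<eta> a else 0)" using H0(2) F0(2)[OF k a] by simp
    finally show "(\<Sum>i=1..r. \<zeta> k (i, a)) = 0" by (simp add: \<zeta>_def sum_subtractf \<eta>_def)
  next
    fix i assume i: "i \<in> {1..r}"
    have "(\<Sum>a\<le>n i. pd (i, a) H0 (diag (p k)) * p k a) = of_nat (d i) * F0 (p k)"
      using mforms_euler[OF H0(1) i, of "diag (p k)"] H0(2) by (simp add: diag_def mult.commute)
    then show "(\<Sum>a\<le>n i. \<zeta> k (i, a) * p k a) = 0"
      using comp i F0v[OF k] by (simp add: \<zeta>_def sum_subtractf algebra_simps diag_def)
  qed
  then obtain C where C: "\<And>k. k < h \<Longrightarrow> C k \<in> mforms r n d"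
    "\<And>k l \<tau>. k < h \<Longrightarrow> l < h \<Longrightarrow> \<tau> \<in> sv_vars r n \<Longrightarrow> pd \<tau> (C k) (diag (p l)) = (if l = k then \<zeta> k \<tau> else 0)" by metis
  define F where "F = (\<lambda>w. H0 w + (\<Sum>k<h. C k w))"
  have sf: "(\<lambda>w. \<Sum>k<h. C k w) \<in> mforms r n d" by (rule mforms_sum) (use C in auto)
  have Ff: "F \<in> mforms r n d" unfolding F_def by (rule mforms_add[OF H0(1) sf])
  have "pd \<tau> F (diag (p l)) = (if l = j then \<xi> \<tau> else 0)" if "l < h" "\<tau> \<in> sv_vars r n" for l \<tau>
  proof -
    have "pd \<tau> F (diag (p l)) = pd \<tau> H0 (diag (p l)) + pd \<tau> (\<lambda>w. \<Sum>k<h. C k w) (diag (p l))"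
      unfolding F_def by (rule pd_add[OF polyfun_mforms[OF H0(1)] polyfun_mforms[OF sf]])
    also have "pd \<tau> (\<lambda>w. \<Sum>k<h. C k w) (diag (p l)) = (\<Sum>k<h. pd \<tau> (C k) (diag (p l)))"
      by (rule pd_sum) (use C polyfun_mforms in blast)
    also have "\<dots> = (\<Sum>k<h. if k = l then \<zeta> k \<tau> else 0)" using C(2) that by (intro sum.cong) auto
    also have "\<dots> = \<zeta> l \<tau>" using that by simp
    finally show ?thesis by (simp add: \<zeta>_def)
  qed
  then show "\<exists>F\<in>mforms r n d. \<forall>k<h. \<forall>\<tau>\<in>sv_vars r n. pd \<tau> F (diag (p k)) = (if k = j then \<xi> \<tau> else 0)"
    using Ff by blast
qed

end

section \<open>Dimension of closed subsets of projective space\<close>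

lemma choose_le_power: "(m + k) choose m \<le> (k + 1) ^ m"
proof (induction m)
  case (Suc m)
  have "Suc m * ((Suc m + k) choose Suc m) = (Suc m + k) * ((m + k) choose m)"
    using Suc_times_binomial_eq[of "m + k" m] by (simp only: mult.commute add_Suc)
  also have "\<dots> \<le> (Suc m * (k + 1)) * (k + 1) ^ m"
    by (intro mult_le_mono Suc.IH) simp
  finally have "Suc m * ((Suc m + k) choose Suc m) \<le> Suc m * (k + 1) ^ Suc m"
    by (simp only: power_Suc mult.assoc)
  then show ?case by (simp only: mult_le_cancel1)
qed simp

text \<open>As functions of \<open>e\<close> the left side has order \<open>e ^ k\<close> and the
  right side order \<open>e ^ n\<close>. The numbers of algebraically independent functions are
  bounded through this comparison.\<close>

lemma growth:
  assumes "\<And>e. (k + e) choose k \<le> c * (e + 1) ^ n"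
  shows "k \<le> n"
proof (rule ccontr)
  assume "\<not> k \<le> n"
  then have k: "Suc n \<le> k" by simp
  \<comment> \<open>Chosen so that \<open>c * fact k\<close> is smaller than
    \<open>e + 1\<close>.\<close>
  define e where "e = c * fact k"
  have "(e + 1) ^ k = (\<Prod>i<k. e + 1)" by simp
  also have "\<dots> \<le> (\<Prod>i<k. e + 1 + i)" by (intro prod_mono) auto
  also have "\<dots> = ((k + e) choose k) * fact k" using choose_fact[of e k] by (simp only: add.commute)
  also have "\<dots> \<le> c * (e + 1) ^ n * fact k" using assms[of e] by (intro mult_le_mono1)
  also have "\<dots> = e * (e + 1) ^ n" by (simp add: e_def)
  also have "\<dots> < (e + 1) * (e + 1) ^ n" by simp
  also have "\<dots> \<le> (e + 1) ^ k" using k power_increasing[OF k, of "e + 1"] by simp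
  finally show False by simp
qed

lemma proj_point_self: "x \<in> proj_point x"
  unfolding proj_point_def by (rule CollectI, rule exI[of _ 1]) (simp add: cscale_def)

lemma zero_locus_proj_point:
  assumes "S \<subseteq> (\<Union>e. forms I e)"
  shows "proj_point x \<in> zero_locus I S \<longleftrightarrow> proj_point x \<in> proj_space I \<and> (\<forall>F\<in>S. F x = 0)"
proof -
  have "F y = 0" if F: "F \<in> S" "F x = 0" "y \<in> proj_point x" for F y
  proof -
    obtain c where "y = cscale c x" using F(3) by (auto simp: proj_point_def)
    moreover obtain e where "F \<in> forms I e" using F(1) assms by blast
    ultimately show ?thesis using F(2) by (simp add: forms_cscale)
  qed
  then show ?thesis using proj_point_self[of x] by (auto simp: zero_locus_def)
qed

lemma forms_comp:
  assumes "F \<in> forms I e" "\<And>i. i \<in> I \<Longrightarrow> (\<lambda>y. g y i) \<in> forms J c"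
  shows "(\<lambda>y. F (g y)) \<in> forms J (e * c)"
  using assms(1) unfolding forms_def[of I e]
proof (induction rule: cfun.span_induct_alt)
  case base
  then show ?case using cfun.subspace_0[OF forms_subspace] by (simp add: zero_fun_def)
next
  case (step a f h)
  then obtain M where M: "f = mon M" "set_mset M \<subseteq> I" "size M = e" by (auto simp: multisets_of_size_def)
  have "(\<lambda>y. mon M (g y)) \<in> forms J (size M * c)"
    using M(2)
  proof (induction M)
    case empty
    then show ?case by (simp add: mon_empty forms_const)
  next
    case (add i M)
    then show ?case using forms_mult[OF assms(2)[of i], of "\<lambda>y. mon M (g y)" "size M * c"]
      by (simp add: mon_add)
  qed
  then have "(\<lambda>y. a * mon M (g y) + h (g y)) \<in> forms J (e * c)"
    using step.IH M(3) by (intro forms_add forms_cmult) auto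
  then show ?case by (simp add: M(1) cscale_apply)
qed

lemma forms_0_const:
  assumes "F \<in> forms I 0" shows "F x = F y"
proof -
  have "F \<in> forms {} 0" using assms by (simp add: forms_def)
  then show ?thesis by (rule polyfun_cong[OF polyfun_forms]) simp
qed

lemma forms_empty_Suc: "F \<in> forms {} (Suc e) \<Longrightarrow> F = 0"
proof -
  have "multisets_of_size {} (Suc e) = ({} :: 'a multiset set)" by (auto simp: multisets_of_size_def)
  then show "F \<in> forms {} (Suc e) \<Longrightarrow> F = 0" by (simp add: forms_def)
qed

text \<open>If the points \<open>g s\<close> together detect every form, the kernel of all
  evaluations is zero, so the greedy choice does not stop before reaching the full
  dimension.\<close>

lemma dual_on_of_injective:
  fixes g :: "'s \<Rightarrow> 'i \<Rightarrow> complex"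
  assumes I: "finite I"
    and inj: "\<And>F. F \<in> forms I e \<Longrightarrow> (\<And>s. s \<in> S \<Longrightarrow> F (g s) = 0) \<Longrightarrow> F = 0"
  shows "\<exists>S1\<subseteq>S. finite S1 \<and> card S1 = card (multisets_of_size I e) \<and> dual_on (forms I e) (\<lambda>s F. F (g s)) S1"
proof -
  obtain X where X: "finite X" "card X = card (multisets_of_size I e)" "dual_on (forms I e) (\<lambda>x F. F x) X"
    using forms_dual_points[OF I] by blast
  have "\<exists>S1. {} \<subseteq> S1 \<and> S1 \<subseteq> S \<and> finite S1 \<and> card S1 = card X \<and> dual_on (forms I e) (\<lambda>s F. F (g s)) S1"
  proof (rule dual_on_extend[of "forms I e" "\<lambda>x F. F x" X S "\<lambda>s F. F (g s)" "{}" 0 "card X"])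
    fix J' assume J': "J' \<subseteq> X" "dual_on (kern (forms I e) (\<lambda>s F. F (g s)) S) (\<lambda>x F. F x) J'"
    obtain E where E: "\<forall>i\<in>J'. E i \<in> kern (forms I e) (\<lambda>s F. F (g s)) S \<and> (\<forall>k\<in>J'. E i k = (if k = i then 1 else 0))"
      using J'(2) unfolding dual_on_def by (rule exE)
    have "i \<notin> J'" for i
    proof
      assume i: "i \<in> J'"
      have "E i = 0" using E i by (intro inj) (auto simp: kern_def)
      then show False using E i by force
    qed
    then have "J' = {}" by blast
    then show "card J' \<le> 0" by simp
  qed (use X in \<open>auto simp: forms_subspace lin_on_eval\<close>)
  then show ?thesis using X(2) by auto
qed

section \<open>Chains of irreducible closed sets and algebraic independence\<close>

text \<open>Only homogeneous relations are tested, the right notion for functions that are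
  homogeneous of one common degree. \<open>X\<close> is a set of vectors: a cone, or a space of
  parameters.\<close>

definition alg_indep :: "nat \<Rightarrow> (nat \<Rightarrow> 'a \<Rightarrow> complex) \<Rightarrow> 'a set \<Rightarrow> bool"
  where "alg_indep l f X \<longleftrightarrow> (\<forall>e. \<forall>G\<in>forms {..<l} e. (\<forall>x\<in>X. G (\<lambda>i. f i x) = 0) \<longrightarrow> G = 0)"

text \<open>The homogeneous ideal of an irreducible closed set is prime: the zero loci of
  \<open>f\<close> and \<open>g\<close> cut \<open>Z\<close> into two closed pieces, one of which
  must be everything.\<close>

lemma irreducible_mult:
  assumes Z: "irreducible_closedin (subtopology (zariski I) X) Z" and X: "X \<subseteq> proj_space I"
    and fg: "f \<in> forms I a" "g \<in> forms I b" "\<And>x. x \<in> \<Union>Z \<Longrightarrow> f x * g x = 0"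
  shows "(\<forall>x\<in>\<Union>Z. f x = 0) \<or> (\<forall>x\<in>\<Union>Z. g x = 0)"
proof -
  let ?T = "subtopology (zariski I) X"
  have ZX: "Z \<subseteq> X" and cZ: "closedin ?T Z"
    using Z closedin_subset[of ?T Z] by (auto simp: irreducible_closedin_def topspace_subtopology)
  have cl: "closedin ?T (Z \<inter> zero_locus I {u})" if "u \<in> forms I e" for u e
  proof -
    have "closedin (zariski I) (zero_locus I {u})"
      unfolding closedin_zariski using that by (intro exI[of _ "{u}"]) auto
    then have "closedin ?T (zero_locus I {u} \<inter> X)" by (auto simp: closedin_subtopology)
    from closedin_Int[OF cZ this] show ?thesis using ZX by (simp add: Int_absorb1 Int_assoc[symmetric] Int_absorb2 inf.coboundedI1)
  qed
  have "p \<in> zero_locus I {f} \<union> zero_locus I {g}" if p: "p \<in> Z" for p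
  proof -
    obtain x where x: "p = proj_point x" using p ZX X by (auto simp: proj_space_def)
    have "x \<in> \<Union>Z" using p x proj_point_self by auto
    from fg(3)[OF this] have "f x = 0 \<or> g x = 0" by simp
    moreover have "{f} \<subseteq> (\<Union>e. forms I e)" "{g} \<subseteq> (\<Union>e. forms I e)" using fg by auto
    ultimately show ?thesis
      using p ZX X unfolding x by (auto simp: zero_locus_proj_point)
  qed
  then have "Z = (Z \<inter> zero_locus I {f}) \<union> (Z \<inter> zero_locus I {g})" by blast
  then have "Z = Z \<inter> zero_locus I {f} \<or> Z = Z \<inter> zero_locus I {g}"
    using Z cl[OF fg(1)] cl[OF fg(2)] unfolding irreducible_closedin_def by blast
  then show ?thesis by (auto simp: zero_locus_def)
qed

text \<open>\<open>f l\<close> is taken to vanish on \<open>Z (l - 1)\<close> but not on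
  \<open>Z l\<close>. In a relation \<open>A + x_l * B\<close> the remainder \<open>A\<close>
  vanishes on \<open>Z (l - 1)\<close> and is zero by induction on \<open>l\<close>; then
  \<open>f l * B\<close> vanishes on the irreducible \<open>Z l\<close>, so \<open>B\<close> is a
  relation of smaller degree.\<close>

lemma chain_alg_indep:
  assumes X: "X \<subseteq> proj_space I"
    and irr: "\<And>i. i \<le> k \<Longrightarrow> irreducible_closedin (subtopology (zariski I) X) (Z i)"
    and strict: "\<And>i. i < k \<Longrightarrow> Z i \<subset> Z (Suc i)"
  shows "\<exists>a f. (\<forall>i\<le>k. f i \<in> forms I a) \<and> alg_indep (Suc k) f (\<Union>(Z k))"
proof -
  let ?T = "subtopology (zariski I) X"
  have ZX: "Z i \<subseteq> X" if "i \<le> k" for i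
    using irr[OF that] closedin_subset[of ?T "Z i"] by (auto simp: irreducible_closedin_def topspace_subtopology)
  have ne: "\<exists>x. x \<noteq> 0 \<and> x \<in> vecs I \<and> x \<in> \<Union>(Z i)" if i: "i \<le> k" for i
  proof -
    obtain p where p: "p \<in> Z i" using irr[OF i] by (auto simp: irreducible_closedin_def)
    then have "p \<in> proj_space I" using ZX[OF i] X by blast
    then obtain x where "p = proj_point x" "x \<in> vecs I - {0}" by (auto simp: proj_space_def)
    then show ?thesis using proj_point_self[of x] p by (intro exI[of _ x]) auto
  qed
  have "\<exists>g e. g \<in> forms I e \<and> e \<ge> 1 \<and> (\<exists>x\<in>\<Union>(Z l). g x \<noteq> 0) \<and> (l > 0 \<longrightarrow> (\<forall>x\<in>\<Union>(Z (l - 1)). g x = 0))"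
    if l: "l \<le> k" for l
  proof (cases l)
    case 0
    obtain x where x: "x \<noteq> 0" "x \<in> vecs I" "x \<in> \<Union>(Z 0)" using ne[of 0] by blast
    then obtain M where "x M \<noteq> 0" by (auto simp: fun_eq_iff)
    moreover then have "M \<in> I" using x(2) by (auto simp: vecs_def)
    ultimately show ?thesis using x 0 forms_var[of M I] by (intro exI[of _ "\<lambda>x. x M"] exI[of _ 1]) auto
  next
    case (Suc i)
    then have i: "i \<le> k" "i < k" using l by auto
    have "closedin ?T (Z i)" using irr[OF i(1)] by (simp add: irreducible_closedin_def)
    then obtain C where "closedin (zariski I) C" "Z i = C \<inter> X" by (auto simp: closedin_subtopology)
    then obtain S where S: "S \<subseteq> (\<Union>e. forms I e)" "Z i = zero_locus I S \<inter> X"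
      unfolding closedin_zariski by blast
    obtain p where p: "p \<in> Z l" "p \<notin> Z i" using strict[OF i(2)] Suc by blast
    have pX: "p \<in> X" "p \<in> proj_space I" using ZX[OF l] p X by auto
    then obtain f x where f: "f \<in> S" "x \<in> p" "f x \<noteq> 0" using p S(2) by (auto simp: zero_locus_def)
    obtain e where e: "f \<in> forms I e" using f(1) S(1) by blast
    have v: "\<forall>x\<in>\<Union>(Z i). f x = 0" using f(1) S(2) by (auto simp: zero_locus_def)
    have "e \<noteq> 0"
    proof
      assume "e = 0"
      obtain y where "y \<in> \<Union>(Z i)" using ne[OF i(1)] by blast
      then have "f y = 0" using v by blast
      then show False using forms_0_const[of f I x y] e \<open>e = 0\<close> f(3) by simp
    qed
    then show ?thesis using e f p v Suc by (intro exI[of _ f] exI[of _ e]) auto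
  qed
  then have "\<forall>l\<in>{..k}. \<exists>q. fst q \<in> forms I (snd q) \<and> snd q \<ge> 1 \<and> (\<exists>x\<in>\<Union>(Z l). fst q x \<noteq> 0) \<and>
      (l > 0 \<longrightarrow> (\<forall>x\<in>\<Union>(Z (l - 1)). fst q x = 0))" by fastforce
  from bchoice[OF this] obtain q where q: "\<forall>l\<in>{..k}. fst (q l) \<in> forms I (snd (q l)) \<and> snd (q l) \<ge> 1 \<and> (\<exists>x\<in>\<Union>(Z l). fst (q l) x \<noteq> 0) \<and>
      (l > 0 \<longrightarrow> (\<forall>x\<in>\<Union>(Z (l - 1)). fst (q l) x = 0))" by (rule exE)
  have q1: "fst (q l) \<in> forms I (snd (q l))" "snd (q l) \<ge> 1" "\<exists>x\<in>\<Union>(Z l). fst (q l) x \<noteq> 0"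
    and q2: "l > 0 \<Longrightarrow> x \<in> \<Union>(Z (l - 1)) \<Longrightarrow> fst (q l) x = 0" if l: "l \<le> k" for l x
    using bspec[OF q, of l] l by blast+
  \<comment> \<open>Suitable powers bring the chosen forms to the common degree
    \<open>b\<close>.\<close>
  define b where "b = (\<Prod>l\<le>k. snd (q l))"
  define c where "c l = b div snd (q l)" for l
  have c: "c l * snd (q l) = b" "c l \<ge> 1" if "l \<le> k" for l
  proof -
    have "snd (q l) dvd b" unfolding b_def using that by (intro dvd_prodI) auto
    then show 1: "c l * snd (q l) = b" by (simp add: c_def)
    have "b > 0" unfolding b_def
    proof (rule prod_pos)
      fix l assume "l \<in> {..k}"
      then show "0 < snd (q l)" using q1(2)[of l] by simp
    qed
    then show "c l \<ge> 1" using 1 by (cases "c l") auto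
  qed
  define f where "f l = (\<lambda>x. fst (q l) x ^ c l)" for l
  have fI: "f l \<in> forms I b" if "l \<le> k" for l
    using forms_power[OF q1(1)[OF that], of "c l"] c(1)[OF that] by (simp add: f_def)
  have fn: "\<exists>x\<in>\<Union>(Z l). f l x \<noteq> 0" if "l \<le> k" for l
    using q1(3)[OF that] power_not_zero unfolding f_def by blast
  have f0: "f (Suc i) x = 0" if "Suc i \<le> k" "x \<in> \<Union>(Z i)" for i x
    using q2[OF that(1), of x] that(2) c(2)[OF that(1)] by (simp add: f_def)
  have "\<forall>G\<in>forms {..<Suc l} e. (\<forall>x\<in>\<Union>(Z l). G (\<lambda>i. f i x) = 0) \<longrightarrow> G = 0" if "l \<le> k" for l e
    using that
  proof (induction l arbitrary: e)
    case (0 e)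
    show ?case
    proof (induction e)
      case 0
      obtain x where x: "x \<in> \<Union>(Z 0)" using ne[of 0] by auto
      show ?case
      proof (intro ballI impI)
        fix G assume G: "G \<in> forms {..<Suc 0} 0" "\<forall>x\<in>\<Union>(Z 0). G (\<lambda>i. f i x) = 0"
        have "G (\<lambda>i. f i x) = 0" using G(2) x by blast
        then have "G y = 0" for y using forms_0_const[OF G(1), of y "\<lambda>i. f i x"] by simp
        then show "G = 0" by (simp add: fun_eq_iff)
      qed
    next
      case (Suc e)
      show ?case
      proof (intro ballI impI)
        fix G assume G: "G \<in> forms {..<Suc 0} (Suc e)" "\<forall>x\<in>\<Union>(Z 0). G (\<lambda>i. f i x) = 0"
        have ins: "{..<Suc 0} = insert 0 {}" by auto
        obtain A B where AB: "A \<in> forms {} (Suc e)" "B \<in> forms {..<Suc 0} e" "\<And>x. G x = A x + x 0 * B x"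
          using forms_insert_decomp[of G 0 "{}" e] G(1) unfolding ins by blast
        have A0: "A = 0" by (rule forms_empty_Suc[OF AB(1)])
        have Bf: "(\<lambda>x. B (\<lambda>i. f i x)) \<in> forms I (e * b)"
          by (rule forms_comp[OF AB(2)]) (use fI in auto)
        have "(\<forall>x\<in>\<Union>(Z 0). f 0 x = 0) \<or> (\<forall>x\<in>\<Union>(Z 0). B (\<lambda>i. f i x) = 0)"
          by (rule irreducible_mult[OF irr[of 0] X fI[of 0] Bf]) (use G(2) AB(3) A0 in auto)
        then have "B = 0" using fn[of 0] Suc.IH AB(2) by blast
        then show "G = 0" using AB(3) A0 by (simp add: fun_eq_iff)
      qed
    qed
  next
    case (Suc l e)
    have l: "l \<le> k" "Suc l \<le> k" using Suc.prems by auto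
    note IHl = Suc.IH[OF l(1)]
    have "l < k" using l by simp
    then have "Z l \<subseteq> Z (Suc l)" using strict by blast
    then have sub: "\<Union>(Z l) \<subseteq> \<Union>(Z (Suc l))" by (rule Union_mono)
    show ?case
    proof (induction e)
      case 0
      obtain x where x: "x \<in> \<Union>(Z (Suc l))" using ne[OF l(2)] by auto
      show ?case
      proof (intro ballI impI)
        fix G assume G: "G \<in> forms {..<Suc (Suc l)} 0" "\<forall>x\<in>\<Union>(Z (Suc l)). G (\<lambda>i. f i x) = 0"
        have "G (\<lambda>i. f i x) = 0" using G(2) x by blast
        then have "G y = 0" for y using forms_0_const[OF G(1), of y "\<lambda>i. f i x"] by simp
        then show "G = 0" by (simp add: fun_eq_iff)
      qed
    next
      case (Suc e)
      note IHe = Suc.IH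
      show ?case
      proof (intro ballI impI)
        fix G assume G: "G \<in> forms {..<Suc (Suc l)} (Suc e)" "\<forall>x\<in>\<Union>(Z (Suc l)). G (\<lambda>i. f i x) = 0"
        have ins: "{..<Suc (Suc l)} = insert (Suc l) {..<Suc l}" by auto
        obtain A B where AB: "A \<in> forms {..<Suc l} (Suc e)" "B \<in> forms {..<Suc (Suc l)} e" "\<And>x. G x = A x + x (Suc l) * B x"
          using forms_insert_decomp[of G "Suc l" "{..<Suc l}" e] G(1) unfolding ins by blast
        have "\<forall>x\<in>\<Union>(Z l). A (\<lambda>i. f i x) = 0"
        proof
          fix x assume x: "x \<in> \<Union>(Z l)"
          then have "G (\<lambda>i. f i x) = 0" "f (Suc l) x = 0" using G(2) sub f0[OF l(2)] by blast+
          then show "A (\<lambda>i. f i x) = 0" using AB(3)[of "\<lambda>i. f i x"] by simp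
        qed
        then have A0: "A = 0" using IHl AB(1) by blast
        have Bf: "(\<lambda>x. B (\<lambda>i. f i x)) \<in> forms I (e * b)"
          by (rule forms_comp[OF AB(2)]) (use fI l in auto)
        have "(\<forall>x\<in>\<Union>(Z (Suc l)). f (Suc l) x = 0) \<or> (\<forall>x\<in>\<Union>(Z (Suc l)). B (\<lambda>i. f i x) = 0)"
          by (rule irreducible_mult[OF irr[OF l(2)] X fI[OF l(2)] Bf]) (use G(2) AB(3) A0 in auto)
        then have "B = 0" using fn[OF l(2)] IHe AB(2) by blast
        then show "G = 0" using AB(3) A0 by (simp add: fun_eq_iff)
      qed
    qed
  qed
  then have "alg_indep (Suc k) f (\<Union>(Z k))" unfolding alg_indep_def by blast
  then show ?thesis using fI by blast
qed

section \<open>Upper bound for the dimension of the Segre-Veronese variety\<close>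

definition svvec :: "nat \<Rightarrow> (nat \<Rightarrow> nat) \<Rightarrow> (nat \<Rightarrow> nat) \<Rightarrow> (nat \<times> nat \<Rightarrow> complex) \<Rightarrow> (nat \<Rightarrow> nat multiset) \<Rightarrow> complex"
  where "svvec r n d w = sv_map r n d (\<lambda>i a. w (i, a))"

lemma svvec_apply: "svvec r n d w M = (if M \<in> sv_index r n d then sv_mon r M w else 0)"
  by (simp add: svvec_def sv_map_def sv_mon_def)

lemma finite_sv_index: "finite (sv_index r n d)"
  by (simp add: sv_index_def finite_PiE finite_multisets_of_size)

lemma mforms_sv_mon_mult:
  assumes "M \<in> sv_index r n d" "H \<in> mforms r n d'"
  shows "(\<lambda>w. sv_mon r M w * H w) \<in> mforms r n (\<lambda>i. d i + d' i)"
  using assms(2) unfolding mforms_def[of r n d']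
proof (induction rule: cfun.span_induct_alt)
  case base
  then show ?case using cfun.subspace_0[OF mforms_subspace] by (simp add: zero_fun_def)
next
  case (step c f g)
  then obtain M' where M': "f = sv_mon r M'" "M' \<in> sv_index r n d'" by auto
  let ?M = "\<lambda>i\<in>{1..r}. M i + M' i"
  have "?M i \<in> multisets_of_size {0..n i} (d i + d' i)" if "i \<in> {1..r}" for i
    using PiE_mem[OF assms(1)[unfolded sv_index_def] that] PiE_mem[OF M'(2)[unfolded sv_index_def] that] that
    by (auto simp: multisets_of_size_def)
  then have "?M \<in> sv_index r n (\<lambda>i. d i + d' i)" by (auto simp: sv_index_def)
  then have "sv_mon r ?M \<in> mforms r n (\<lambda>i. d i + d' i)" unfolding mforms_def by (intro cfun.span_base) auto
  moreover have "sv_mon r ?M = (\<lambda>w. sv_mon r M w * f w)"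
    by (simp add: fun_eq_iff sv_mon_def M' mon_mult[symmetric] prod.distrib[symmetric] del: atLeastAtMost_iff)
  ultimately have "(\<lambda>w. sv_mon r M w * f w) \<in> mforms r n (\<lambda>i. d i + d' i)" by simp
  then have "(\<lambda>w. c * (sv_mon r M w * f w) + sv_mon r M w * g w) \<in> mforms r n (\<lambda>i. d i + d' i)"
    by (rule mforms_add[OF mforms_cmult step.IH])
  moreover have "(\<lambda>w. c * (sv_mon r M w * f w) + sv_mon r M w * g w) = (\<lambda>w. sv_mon r M w * (cscale c f + g) w)"
    by (simp add: fun_eq_iff cscale_apply algebra_simps)
  ultimately show ?case by (simp only:)
qed

lemma forms_comp_svvec:
  assumes "F \<in> forms (sv_index r n d) e"
  shows "(\<lambda>w. F (svvec r n d w)) \<in> mforms r n (\<lambda>i. e * d i)"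
  using assms unfolding forms_def
proof (induction rule: cfun.span_induct_alt)
  case base
  then show ?case using cfun.subspace_0[OF mforms_subspace] by (simp add: zero_fun_def)
next
  case (step c f g)
  then obtain N where N: "f = mon N" "set_mset N \<subseteq> sv_index r n d" "size N = e" by (auto simp: multisets_of_size_def)
  have "(\<lambda>w. mon N (svvec r n d w)) \<in> mforms r n (\<lambda>i. size N * d i)"
    using N(2)
  proof (induction N)
    case empty
    then show ?case by (simp add: mon_empty mforms_const)
  next
    case (add M N)
    then have M: "M \<in> sv_index r n d" and N: "(\<lambda>w. mon N (svvec r n d w)) \<in> mforms r n (\<lambda>i. size N * d i)" by auto
    have "svvec r n d w M = sv_mon r M w" for w using M by (simp add: svvec_apply)
    then show ?case using mforms_sv_mon_mult[OF M N] by (simp add: mon_add)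
  qed
  then have "(\<lambda>w. c * mon N (svvec r n d w) + g (svvec r n d w)) \<in> mforms r n (\<lambda>i. e * d i)"
    using step.IH N(3) by (intro mforms_add mforms_cmult) auto
  then show ?case by (simp add: N(1) cscale_apply)
qed

text \<open>A chain of length \<open>k\<close> makes the forms of degree \<open>e\<close> in
  \<open>k + 1\<close> variables inject into the multiforms of multidegree \<open>e * a * d\<close>,
  a space whose dimension is at most a constant times
  \<open>(e + 1) ^ (\<Sum>i=1..r. n i)\<close>.\<close>

theorem proj_dim_segre_veronese_le:
  "proj_dim (sv_index r n d) (segre_veronese r n d) \<le> enat (\<Sum>i=1..r. n i)"
  unfolding proj_dim_def krull_dim_def
proof (rule Sup_least, clarify)
  fix k and Z :: "nat \<Rightarrow> ((nat \<Rightarrow> nat multiset) \<Rightarrow> complex) set set"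
  let ?I = "sv_index r n d" and ?X = "segre_veronese r n d"
  assume irr: "\<forall>i\<le>k. irreducible_closedin (subtopology (zariski ?I) ?X) (Z i)"
    and strict: "\<forall>i<k. Z i \<subset> Z (Suc i)"
  obtain a f where f: "\<And>i. i \<le> k \<Longrightarrow> f i \<in> forms ?I a" and ind: "alg_indep (Suc k) f (\<Union>(Z k))"
    using chain_alg_indep[OF segre_veronese_subset, of k r n d Z] irr strict by blast
  have ZX: "Z k \<subseteq> ?X"
    using irr closedin_subset[of "subtopology (zariski ?I) ?X" "Z k"]
    by (auto simp: irreducible_closedin_def topspace_subtopology)
  define C where "C = (\<Prod>i=1..r. (a * d i + 1) ^ n i)"
  have "(k + e) choose k \<le> C * (e + 1) ^ (\<Sum>i=1..r. n i)" for e
  proof -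
    define g where "g w = (\<lambda>i. f i (svvec r n d w))" for w
    have Gf: "(\<lambda>x. G (\<lambda>i. f i x)) \<in> forms ?I (e * a)" if "G \<in> forms {..k} e" for G
      by (rule forms_comp[OF that]) (use f in auto)
    have "\<exists>S1\<subseteq>UNIV. finite S1 \<and> card S1 = card (multisets_of_size {..k} e) \<and> dual_on (forms {..k} e) (\<lambda>s F. F (g s)) S1"
    proof (rule dual_on_of_injective)
      fix G assume G: "G \<in> forms {..k} e" "\<And>w. w \<in> UNIV \<Longrightarrow> G (g w) = 0"
      have "G (\<lambda>i. f i x) = 0" if x: "x \<in> \<Union>(Z k)" for x
      proof -
        obtain p where p: "p \<in> Z k" "x \<in> p" using x by blast
        then obtain v where v: "p = proj_point (sv_map r n d v)" using ZX by (auto simp: segre_veronese_def)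
        then obtain c where c: "x = cscale c (sv_map r n d v)" using p(2) by (auto simp: proj_point_def)
        have "svvec r n d (\<lambda>k. v (fst k) (snd k)) = sv_map r n d v" by (simp add: svvec_def)
        then have "G (\<lambda>i. f i (sv_map r n d v)) = 0" using G(2)[of "\<lambda>k. v (fst k) (snd k)"] by (simp add: g_def)
        then show ?thesis using forms_cscale[OF Gf[OF G(1)], of c "sv_map r n d v"] c by simp
      qed
      then have "\<forall>x\<in>\<Union>(Z k). G (\<lambda>i. f i x) = 0" by blast
      then show "G = 0" using ind G(1) unfolding alg_indep_def lessThan_Suc_atMost by blast
    qed simp
    then obtain S1 where S1: "finite S1" "card S1 = card (multisets_of_size {..k} e)" "dual_on (forms {..k} e) (\<lambda>s F. F (g s)) S1"
      by blast
    obtain E where E: "\<forall>i\<in>S1. E i \<in> forms {..k} e \<and> (\<forall>s\<in>S1. E i (g s) = (if s = i then 1 else 0))"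
      using S1(3) unfolding dual_on_def by (rule exE)
    have "dual_on (mforms r n (\<lambda>i. e * a * d i)) (\<lambda>w F. F w) S1"
      unfolding dual_on_def
    proof (intro exI[of _ "\<lambda>i w. E i (g w)"] ballI conjI)
      fix i assume i: "i \<in> S1"
      then show "(\<lambda>w. E i (g w)) \<in> mforms r n (\<lambda>i. e * a * d i)"
        using forms_comp_svvec[OF Gf, of "E i"] E by (simp add: g_def)
      fix s assume "s \<in> S1"
      then show "E i (g s) = (if s = i then 1 else 0)" using E i by blast
    qed
    then have "card S1 \<le> card (sv_mon r ` sv_index r n (\<lambda>i. e * a * d i))"
      using dual_on_card_le[of "mforms r n (\<lambda>i. e * a * d i)" "\<lambda>w F. F w" S1 "sv_mon r ` sv_index r n (\<lambda>i. e * a * d i)"]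
      by (simp add: mforms_def lin_on_eval finite_sv_index)
    also have "\<dots> \<le> card (sv_index r n (\<lambda>i. e * a * d i))" by (rule card_image_le[OF finite_sv_index])
    also have "\<dots> = (\<Prod>i=1..r. (n i + e * a * d i) choose n i)" by (rule card_sv_index)
    also have "\<dots> \<le> (\<Prod>i=1..r. (a * d i + 1) ^ n i * (e + 1) ^ n i)"
    proof (intro prod_mono conjI)
      fix i
      have "(n i + e * a * d i) choose n i \<le> (e * a * d i + 1) ^ n i" by (rule choose_le_power)
      also have "\<dots> \<le> ((a * d i + 1) * (e + 1)) ^ n i" by (intro power_mono) (auto simp: algebra_simps)
      finally show "(n i + e * a * d i) choose n i \<le> (a * d i + 1) ^ n i * (e + 1) ^ n i"
        by (simp only: power_mult_distrib)
    qed simp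
    also have "\<dots> = C * (e + 1) ^ (\<Sum>i=1..r. n i)" by (simp add: C_def prod.distrib power_sum)
    finally show ?thesis using S1(2) by (simp add: card_multisets_atMost)
  qed
  then have "k \<le> (\<Sum>i=1..r. n i)" by (rule growth)
  then show "enat k \<le> enat (\<Sum>i=1..r. n i)" by simp
qed

section \<open>Jacobian criterion for algebraic independence\<close>

lemma polyfun_line_deriv:
  assumes "polyfun I F" "finite I"
  shows "((\<lambda>t. F (\<lambda>i. x i + t * z i)) has_field_derivative (\<Sum>i\<in>I. z i * pd i F x)) (at 0)"
  using assms
proof (induction rule: polyfun.induct)
  case (var j)
  have "(\<Sum>i\<in>I. z i * pd i (\<lambda>x. x j) x) = (\<Sum>i\<in>I. if i = j then z i else 0)"
    by (intro sum.cong) auto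
  also have "\<dots> = z j" using var by simp
  finally show ?case by (auto intro!: derivative_eq_intros)
next
  case (add F G)
  then show ?case
    using DERIV_add[OF add.IH(1) add.IH(2)] by (simp add: pd_add sum.distrib algebra_simps)
next
  case (mult F G)
  have "(\<Sum>i\<in>I. z i * pd i (\<lambda>x. F x * G x) x) = (\<Sum>i\<in>I. z i * pd i F x) * G x + (\<Sum>i\<in>I. z i * pd i G x) * F x"
    using mult by (simp add: pd_mult sum.distrib algebra_simps sum_distrib_left sum_distrib_right)
  then show ?case using DERIV_mult[OF mult.IH(1) mult.IH(2)] mult.prems by simp
qed auto

lemma polyfun_line:
  assumes "polyfun I F" "finite I"
  shows "\<exists>q. (\<forall>t. F (\<lambda>i. x i + t * z i) = F x + t * poly q t) \<and> poly q 0 = (\<Sum>i\<in>I. z i * pd i F x)"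
proof -
  have lin: "\<exists>q. \<forall>t. x i + t * z i = poly q t" for i by (intro exI[of _ "[:x i, z i:]"]) auto
  obtain p where p: "\<forall>t. F (\<lambda>i. x i + t * z i) = poly p t"
    using polyfun_curve[OF assms(1), of "\<lambda>t i. x i + t * z i"] lin by blast
  obtain a q where pq: "p = pCons a q" by (cases p) auto
  have a: "a = F x" using spec[OF p, of 0] pq by simp
  have "((\<lambda>t. poly p t) has_field_derivative (\<Sum>i\<in>I. z i * pd i F x)) (at 0)"
    using polyfun_line_deriv[OF assms, of x z] p by simp
  from DERIV_unique[OF this poly_DERIV] have "poly q 0 = (\<Sum>i\<in>I. z i * pd i F x)"
    by (simp add: pq pderiv_pCons)
  then show ?thesis using p pq a by (intro exI[of _ q]) simp
qed

lemma polyfun_split: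
  assumes "polyfun I F"
  shows "\<exists>F'. polyfun I F' \<and> (\<forall>v. F v = F (v(j := 0)) + v j * F' v)"
  using assms
proof (induction rule: polyfun.induct)
  case (const c)
  show ?case by (rule exI[of _ "\<lambda>_. 0"]) (simp add: polyfun.const)
next
  case (var i)
  show ?case by (rule exI[of _ "\<lambda>_. if i = j then 1 else 0"]) (simp add: polyfun.const)
next
  case (add F G)
  obtain F' where F': "polyfun I F' \<and> (\<forall>v. F v = F (v(j := 0)) + v j * F' v)" using add.IH(1) by (rule exE)
  obtain G' where G': "polyfun I G' \<and> (\<forall>v. G v = G (v(j := 0)) + v j * G' v)" using add.IH(2) by (rule exE)
  have "F v + G v = F (v(j := 0)) + G (v(j := 0)) + v j * (F' v + G' v)" for v
  proof -
    have "F v = F (v(j := 0)) + v j * F' v" "G v = G (v(j := 0)) + v j * G' v" using F' G' by blast+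
    then have "F v + G v = (F (v(j := 0)) + v j * F' v) + (G (v(j := 0)) + v j * G' v)" by (simp only:)
    then show ?thesis by (simp only: ring_distribs add_ac)
  qed
  moreover have "polyfun I (\<lambda>v. F' v + G' v)" by (rule polyfun.add) (use F' G' in simp_all)
  ultimately show ?case by (intro exI[of _ "\<lambda>v. F' v + G' v"] conjI allI)
next
  case (mult F G)
  obtain F' where F': "polyfun I F' \<and> (\<forall>v. F v = F (v(j := 0)) + v j * F' v)" using mult.IH(1) by (rule exE)
  obtain G' where G': "polyfun I G' \<and> (\<forall>v. G v = G (v(j := 0)) + v j * G' v)" using mult.IH(2) by (rule exE)
  have p0: "polyfun I (\<lambda>v. G (v(j := 0)))"
  proof (rule polyfun_comp[OF mult.hyps(2)])
    fix i show "i \<in> I \<Longrightarrow> polyfun I (\<lambda>v. (v(j := 0)) i)"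
      by (cases "i = j") (simp_all add: polyfun.const polyfun.var)
  qed
  have "F v * G v = F (v(j := 0)) * G (v(j := 0)) + v j * (F v * G' v + F' v * G (v(j := 0)))" for v
  proof -
    have f: "F v = F (v(j := 0)) + v j * F' v" and g: "G v = G (v(j := 0)) + v j * G' v" using F' G' by blast+
    have "F v * G v = F v * (G (v(j := 0)) + v j * G' v)" by (rule arg_cong[OF g])
    also have "\<dots> = F v * G (v(j := 0)) + v j * (F v * G' v)" by (simp only: ring_distribs mult_ac)
    also have "F v * G (v(j := 0)) = (F (v(j := 0)) + v j * F' v) * G (v(j := 0))" by (rule arg_cong[OF f])
    finally show ?thesis by (simp only: ring_distribs mult_ac add_ac)
  qed
  moreover have "polyfun I (\<lambda>v. F v * G' v + F' v * G (v(j := 0)))"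
    by (intro polyfun.add polyfun.mult mult.hyps p0) (use F' G' in simp_all)
  ultimately show ?case by (intro exI[of _ "\<lambda>v. F v * G' v + F' v * G (v(j := 0))"] conjI allI)
qed

text \<open>\<open>s\<close> is the order of vanishing of \<open>Q\<close> along
  \<open>v j = 0\<close>. It is finite because on the line through \<open>v0\<close> in direction
  \<open>j\<close> the function is a nonzero polynomial whose degree bounds \<open>s\<close>; by
  maximality the cofactor \<open>R\<close> does not vanish identically on the hyperplane.\<close>

lemma polyfun_order:
  assumes Q: "polyfun UNIV Q" "Q v0 \<noteq> 0"
  shows "\<exists>s R z. polyfun UNIV R \<and> (\<forall>v. Q v = v j ^ s * R v) \<and> R (z(j := 0)) \<noteq> 0"
proof -
  have c: "\<exists>q. \<forall>t. (v0(j := t)) i = poly q t" for i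
    by (cases "i = j") (auto intro: exI[of _ "[:0, 1:]"] exI[of _ "[:v0 i:]"])
  have curve: "\<exists>p. \<forall>t. F (v0(j := t)) = poly p t" if "polyfun UNIV F" for F
    using polyfun_curve[OF that, of "\<lambda>t. v0(j := t)"] c by blast
  obtain p where p: "\<forall>t. Q (v0(j := t)) = poly p t" using curve[OF Q(1)] by (rule exE)
  have p0: "p \<noteq> 0" using spec[OF p, of "v0 j"] Q(2) by auto
  define P where "P s \<longleftrightarrow> (\<exists>R. polyfun UNIV R \<and> (\<forall>v. Q v = v j ^ s * R v))" for s
  have "P 0" unfolding P_def using Q by (intro exI[of _ Q]) simp
  have bound: "s \<le> degree p" if Ps: "P s" for s
  proof -
    obtain R where R: "polyfun UNIV R" "\<forall>v. Q v = v j ^ s * R v" using Ps unfolding P_def by blast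
    obtain \<rho> where \<rho>: "\<forall>t. R (v0(j := t)) = poly \<rho> t" using curve[OF R(1)] by (rule exE)
    have "poly p t = poly (monom 1 s * \<rho>) t" for t
    proof -
      have "poly p t = Q (v0(j := t))" using p by simp
      also have "\<dots> = t ^ s * R (v0(j := t))" using spec[OF R(2), of "v0(j := t)"] by simp
      finally show ?thesis using \<rho> by (simp add: poly_monom)
    qed
    then have e: "p = monom 1 s * \<rho>" by (simp add: poly_eq_poly_eq_iff[symmetric] fun_eq_iff)
    then have "\<rho> \<noteq> 0" using p0 by auto
    then have "degree p = s + degree \<rho>" unfolding e by (subst degree_mult_eq) (auto simp: degree_monom_eq)
    then show ?thesis by simp
  qed
  define s where "s = (GREATEST s. P s)"
  have Ps: "P s" unfolding s_def using \<open>P 0\<close> bound by (rule GreatestI_nat)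
  have nS: "\<not> P (Suc s)"
  proof
    assume "P (Suc s)"
    then have "Suc s \<le> s" unfolding s_def using bound by (rule Greatest_le_nat)
    then show False by simp
  qed
  obtain R where R: "polyfun UNIV R" "\<forall>v. Q v = v j ^ s * R v" using Ps unfolding P_def by blast
  have "\<exists>z. R (z(j := 0)) \<noteq> 0"
  proof (rule ccontr)
    assume "\<not> ?thesis"
    then have z: "R (z(j := 0)) = 0" for z by blast
    obtain R' where "polyfun UNIV R'" "\<forall>v. R v = R (v(j := 0)) + v j * R' v"
      using polyfun_split[OF R(1)] by blast
    then have "P (Suc s)" unfolding P_def using R(2) z by (intro exI[of _ R']) simp
    then show False using nS by blast
  qed
  then show ?thesis using R by blast
qed

text \<open>
  If \<open>G (y s) = 0\<close> identically, expand \<open>G\<close> at \<open>y s0\<close>: its lowest order part vanishes on all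
  directions, because the Jacobian of \<open>y\<close> is invertible there.
\<close>

lemma alg_indep_jacobian:
  assumes y: "\<And>i. i \<le> l \<Longrightarrow> polyfun {..D} (y i)" and l: "l \<le> D" and s0: "s0 \<in> vecs {..l}"
    and pdy: "\<And>i k. i \<le> l \<Longrightarrow> k \<le> D \<Longrightarrow> pd k (y i) s0 = (if k = i then c i else 0)"
    and c: "\<And>i. i \<le> l \<Longrightarrow> c i \<noteq> 0"
  shows "alg_indep (Suc l) y (vecs {..l})"
  unfolding alg_indep_def
proof (intro allI ballI impI)
  fix e G assume G: "G \<in> forms {..<Suc l} e" and van: "\<forall>s\<in>vecs {..l}. G (\<lambda>i. y i s) = 0"
  show "G = 0"
  proof (rule ccontr)
    assume "G \<noteq> 0"
    then obtain b where b: "G b \<noteq> 0" by (auto simp: fun_eq_iff)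
    have pG: "polyfun {..<Suc l} G" by (rule polyfun_forms[OF G])
    \<comment> \<open>\<open>v None\<close> is a parameter and the \<open>v (Some i)\<close> form a
      direction: the power of \<open>v None\<close> dividing \<open>Q\<close> is the order of
      \<open>G\<close> at the point \<open>y s0\<close>, and \<open>R\<close> on
      \<open>v None = 0\<close> is the lowest order part.\<close>
    define Q where "Q v = G (\<lambda>i. y i s0 + v None * v (Some i))" for v :: "nat option \<Rightarrow> complex"
    have pQ: "polyfun UNIV Q" unfolding Q_def[abs_def]
      by (rule polyfun_comp[OF pG]) (intro polyfun.add polyfun.mult polyfun.const polyfun.var UNIV_I)
    define v0 where "v0 = (\<lambda>k. case k of None \<Rightarrow> 1 | Some i \<Rightarrow> b i - y i s0)"
    have "Q v0 \<noteq> 0" using b by (simp add: Q_def v0_def)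
    with pQ have "\<exists>s R z. polyfun UNIV R \<and> (\<forall>v. Q v = v None ^ s * R v) \<and> R (z(None := 0)) \<noteq> 0"
      by (rule polyfun_order[of Q v0 None])
    then obtain s R z where
      R: "polyfun UNIV R" "\<forall>v. Q v = v None ^ s * R v" "R (z(None := 0)) \<noteq> 0" by (elim exE conjE)
    \<comment> \<open>The direction in parameter space that the diagonal Jacobian with entries
      \<open>c i\<close> sends to \<open>z\<close>.\<close>
    define \<zeta> where "\<zeta> i = (if i \<le> l then z (Some i) / c i else 0)" for i
    have "\<exists>q. i \<le> l \<longrightarrow> (\<forall>t. y i (\<lambda>k. s0 k + t * \<zeta> k) = y i s0 + t * poly q t) \<and> poly q 0 = z (Some i)" for i
    proof (cases "i \<le> l")
      case True
      have "(\<Sum>k\<in>{..D}. \<zeta> k * pd k (y i) s0) = (\<Sum>k\<in>{..D}. if k = i then \<zeta> i * c i else 0)"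
        using pdy[OF True] by (intro sum.cong) auto
      also have "\<dots> = z (Some i)" using True l c[OF True] by (simp add: \<zeta>_def)
      finally show ?thesis using polyfun_line[OF y[OF True] finite_atMost, of s0 \<zeta>] by metis
    qed auto
    then obtain q where q: "\<And>i t. i \<le> l \<Longrightarrow> y i (\<lambda>k. s0 k + t * \<zeta> k) = y i s0 + t * poly (q i) t"
        "\<And>i. i \<le> l \<Longrightarrow> poly (q i) 0 = z (Some i)" by metis
    \<comment> \<open>The curve \<open>y (s0 + t * \<zeta>)\<close> in the coordinates of
      \<open>Q\<close>; at \<open>t = 0\<close> it points in the direction \<open>z\<close>, where
      \<open>R\<close> is nonzero.\<close>
    define v where "v t = (\<lambda>k. case k of None \<Rightarrow> t | Some i \<Rightarrow> if i \<le> l then poly (q i) t else z (Some i))" for t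
    have "\<exists>p. \<forall>t. v t k = poly p t" for k
    proof (cases k)
      case None
      then show ?thesis by (intro exI[of _ "[:0, 1:]"]) (simp add: v_def)
    next
      case (Some i)
      then show ?thesis by (intro exI[of _ "if i \<le> l then q i else [:z (Some i):]"]) (simp add: v_def)
    qed
    then obtain \<rho> where \<rho>: "\<forall>t. R (v t) = poly \<rho> t" using polyfun_curve[OF R(1), of v] by blast
    have "poly (monom 1 s * \<rho>) t = 0" for t
    proof -
      have "Q (v t) = G (\<lambda>i. y i (\<lambda>k. s0 k + t * \<zeta> k))"
        unfolding Q_def by (rule polyfun_cong[OF pG]) (simp add: v_def q(1))
      also have "\<dots> = 0" using van s0 by (auto simp: vecs_def \<zeta>_def)
      finally show ?thesis using spec[OF R(2), of "v t"] \<rho> by (simp add: v_def poly_monom)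
    qed
    then have "monom 1 s * \<rho> = 0" by (simp add: poly_all_0_iff_0[symmetric])
    then have "\<rho> = 0" by (simp add: monom_eq_0_iff)
    then have "R (v 0) = 0" using \<rho> by simp
    moreover have "v 0 = z(None := 0)" by (auto simp: v_def fun_eq_iff q(2) split: option.split)
    ultimately show False using R(3) by simp
  qed
qed

section \<open>Parametrised subsets of the secant variety\<close>

text \<open>The parameters form a linear space, so two forms that do not vanish identically along
  \<Phi> are both nonzero at a common parameter. A decomposition into two proper closed subsets
  would contradict this.\<close>

lemma irreducible_closure:
  fixes \<Phi> :: "(nat \<Rightarrow> complex) \<Rightarrow> 'i \<Rightarrow> complex"
  assumes B: "B = {proj_point (\<Phi> s) | s. s \<in> vecs L \<and> \<Phi> s \<noteq> 0}"
    and \<Phi>: "\<And>s. \<Phi> s \<in> vecs I" "\<And>M. polyfun UNIV (\<lambda>s. \<Phi> s M)"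
    and ne: "s1 \<in> vecs L" "\<Phi> s1 \<noteq> 0" and Y: "closedin (zariski I) Y" "B \<subseteq> Y"
  shows "irreducible_closedin (subtopology (zariski I) Y) (zariski I closure_of B)"
proof -
  let ?Z = "zariski I closure_of B"
  have BI: "B \<subseteq> proj_space I" using \<Phi>(1) by (auto simp: B proj_space_def)
  have BZ: "B \<subseteq> ?Z" using BI by (intro closure_of_subset) (simp add: topspace_zariski)
  have ZY: "?Z \<subseteq> Y" by (rule closure_of_minimal[OF Y(2,1)])
  have "closedin (subtopology (zariski I) Y) ?Z"
    using ZY by (auto simp: closedin_subtopology intro!: exI[of _ ?Z])
  moreover have "?Z \<noteq> {}" using ne BZ B by blast
  moreover have "?Z = A \<or> ?Z = A'"
    if cl: "closedin (subtopology (zariski I) Y) A" "closedin (subtopology (zariski I) Y) A'" "?Z = A \<union> A'" for A A'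
  proof (rule ccontr)
    assume no: "\<not> ?thesis"
    have *: "\<exists>s F e. s \<in> vecs L \<and> F \<in> forms I e \<and> F (\<Phi> s) \<noteq> 0 \<and> (\<forall>s. proj_point (\<Phi> s) \<in> C \<longrightarrow> F (\<Phi> s) = 0)"
      if C: "closedin (subtopology (zariski I) Y) C" "C \<subseteq> ?Z" "?Z \<noteq> C" for C
    proof -
      obtain T where T: "closedin (zariski I) T" "C = T \<inter> Y" using C(1) by (auto simp: closedin_subtopology)
      have "\<not> B \<subseteq> T"
      proof
        assume "B \<subseteq> T"
        then have "?Z \<subseteq> T" using T(1) by (rule closure_of_minimal)
        then show False using T(2) ZY C by blast
      qed
      then obtain s where s: "s \<in> vecs L" "\<Phi> s \<noteq> 0" "proj_point (\<Phi> s) \<notin> T" unfolding B by blast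
      obtain S where S: "S \<subseteq> (\<Union>e. forms I e)" "T = zero_locus I S" using T(1) unfolding closedin_zariski by blast
      have "proj_point (\<Phi> s) \<in> proj_space I" using \<Phi>(1) s(2) by (auto simp: proj_space_def)
      then obtain F where F: "F \<in> S" "F (\<Phi> s) \<noteq> 0" using s(3) S by (auto simp: zero_locus_proj_point)
      moreover obtain e where "F \<in> forms I e" using F(1) S(1) by blast
      moreover have "F (\<Phi> s') = 0" if "proj_point (\<Phi> s') \<in> C" for s'
        using that T(2) S F(1) by (auto simp: zero_locus_proj_point)
      ultimately show ?thesis using s(1) by blast
    qed
    obtain s F e where F: "s \<in> vecs L" "F \<in> forms I e" "F (\<Phi> s) \<noteq> 0" "\<forall>s. proj_point (\<Phi> s) \<in> A \<longrightarrow> F (\<Phi> s) = 0"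
      using *[OF cl(1)] cl(3) no by blast
    obtain s' F' e' where F': "s' \<in> vecs L" "F' \<in> forms I e'" "F' (\<Phi> s') \<noteq> 0" "\<forall>s. proj_point (\<Phi> s) \<in> A' \<longrightarrow> F' (\<Phi> s) = 0"
      using *[OF cl(2)] cl(3) no by blast
    have p: "polyfun UNIV (\<lambda>s. F (\<Phi> s))" "polyfun UNIV (\<lambda>s. F' (\<Phi> s))"
      by (rule polyfun_comp[OF polyfun_forms[OF F(2)] \<Phi>(2)], rule polyfun_comp[OF polyfun_forms[OF F'(2)] \<Phi>(2)])
    obtain t where t: "F (\<Phi> (\<lambda>i. s i + t * (s' i - s i))) \<noteq> 0" "F' (\<Phi> (\<lambda>i. s i + t * (s' i - s i))) \<noteq> 0"
      using polyfun_common[of UNIV "\<lambda>s. F (\<Phi> s)" "\<lambda>s. F' (\<Phi> s)" s s'] p F(3) F'(3) by blast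
    define u where "u = (\<lambda>i. s i + t * (s' i - s i))"
    have u: "u \<in> vecs L" using F(1) F'(1) by (auto simp: u_def vecs_def)
    have un: "proj_point (\<Phi> u) \<notin> A" "proj_point (\<Phi> u) \<notin> A'" using t F(4) F'(4) unfolding u_def by blast+
    have "\<Phi> u = 0 \<Longrightarrow> proj_point (\<Phi> u) \<notin> proj_space I"
    proof
      assume "\<Phi> u = 0" "proj_point (\<Phi> u) \<in> proj_space I"
      then obtain x where x: "proj_point (0 :: 'i \<Rightarrow> complex) = proj_point x" "x \<noteq> 0" by (auto simp: proj_space_def)
      then have "x \<in> proj_point 0" using proj_point_self[of x] by simp
      then show False using x(2) by (auto simp: proj_point_def cscale_def fun_eq_iff)
    qed
    show False
    proof (cases "\<Phi> u = 0")
      case False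
      then have "proj_point (\<Phi> u) \<in> B" using u by (auto simp: B)
      then show False using un BZ cl(3) by blast
    next
      \<comment> \<open>A form that is nonzero at the zero vector is constant, so if
        \<open>\<Phi> u = 0\<close> the parameter \<open>s1\<close> serves in place of
        \<open>u\<close>.\<close>
      case True
      have e0: "G 0 = 0 \<or> (\<forall>x. G x = G 0)" if G: "G \<in> forms I e" for G e
      proof (cases "e = 0")
        case True
        then show ?thesis using G forms_0_const by blast
      next
        case False
        have "cscale 0 (0 :: 'i \<Rightarrow> complex) = 0" by (simp add: fun_eq_iff cscale_def)
        then have "G 0 = 0 ^ e * G 0" using forms_cscale[OF G, of 0 0] by (simp only:)
        then show ?thesis using False by (simp add: power_0_left)
      qed
      have "F (\<Phi> s1) \<noteq> 0" "F' (\<Phi> s1) \<noteq> 0"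
        using e0[OF F(2)] e0[OF F'(2)] t True unfolding u_def by metis+
      moreover have "proj_point (\<Phi> s1) \<in> A \<union> A'" using ne BZ cl(3) unfolding B by blast
      ultimately show False using F(4) F'(4) by blast
    qed
  qed
  ultimately show ?thesis unfolding irreducible_closedin_def by blast
qed

text \<open>The coordinates of the ambient space pull back to the multimonomials; by linearity one
  \<phi> serves sums over any number of points.\<close>

lemma mforms_linear_form:
  assumes "F \<in> mforms r n d"
  shows "\<exists>\<phi>\<in>forms (sv_index r n d) 1. \<forall>(w :: nat \<Rightarrow> _) h. \<phi> (\<lambda>M. \<Sum>j<h. svvec r n d (w j) M) = (\<Sum>j<h. F (w j))"
  using assms unfolding mforms_def
proof (induction rule: cfun.span_induct_alt)
  case base
  then show ?case using cfun.subspace_0[OF forms_subspace] by (intro bexI[of _ 0]) auto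
next
  case (step c f g)
  then obtain M where M: "f = sv_mon r M" "M \<in> sv_index r n d" by auto
  obtain \<phi> where \<phi>: "\<phi> \<in> forms (sv_index r n d) 1"
    "\<forall>(w :: nat \<Rightarrow> _) h. \<phi> (\<lambda>M. \<Sum>j<h. svvec r n d (w j) M) = (\<Sum>j<h. g (w j))" using step.IH by blast
  have "(\<lambda>x. c * x M + \<phi> x) \<in> forms (sv_index r n d) 1"
    by (intro forms_add forms_cmult forms_var M \<phi>)
  then show ?case using \<phi>(2) M
    by (intro bexI[of _ "\<lambda>x. c * x M + \<phi> x"]) (simp_all add: svvec_apply cscale_apply sum.distrib sum_distrib_left)
qed

text \<open>A vector \<open>w j\<close> that is zero in some factor contributes nothing, since every
  \<open>d i\<close> is positive, and \<open>q0\<close> takes its place in the collection of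
  points.\<close>

lemma secant_variety_point:
  fixes w :: "nat \<Rightarrow> nat \<times> nat \<Rightarrow> complex"
  assumes d1: "\<And>i. i \<in> {1..r} \<Longrightarrow> d i \<ge> 1"
    and x: "x = (\<lambda>M. \<Sum>j<h. svvec r n d (w j) M)" "x \<noteq> 0"
  shows "proj_point x \<in> (\<Union>p \<in> {1..h} \<rightarrow> segre_veronese r n d. linear_span (sv_index r n d) (p ` {1..h}))"
proof -
  let ?I = "sv_index r n d" and ?X = "segre_veronese r n d"
  define ok where "ok j \<longleftrightarrow> (\<forall>i\<in>{1..r}. \<exists>a\<le>n i. w j (i, a) \<noteq> 0)" for j
  define q0 where "q0 = proj_point (sv_map r n d (\<lambda>i a. if a = 0 then 1 else 0))"
  have q0: "q0 \<in> ?X" unfolding q0_def segre_veronese_def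
    by (rule CollectI, rule exI, rule conjI, rule refl) (auto simp: vecs_def fun_eq_iff)
  \<comment> \<open>Points are numbered from 1 in the definition of the secant variety and from 0
    here.\<close>
  define p where "p k = (if ok (k - 1) then proj_point (svvec r n d (w (k - 1))) else q0)" for k
  have "proj_point (svvec r n d (w j)) \<in> ?X" if ok: "ok j" for j
  proof -
    define v where "v i a = (if a \<le> n i then w j (i, a) else 0)" for i a
    have "\<forall>i\<in>{1..r}. v i \<in> vecs {0..n i} - {0}"
    proof
      fix i assume "i \<in> {1..r}"
      then have "\<exists>a\<le>n i. w j (i, a) \<noteq> 0" using ok unfolding ok_def by (rule bspec[rotated])
      then obtain a where a: "a \<le> n i" "w j (i, a) \<noteq> 0" by blast
      then have "v i a \<noteq> 0 a" by (simp add: v_def)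
      then have "v i \<noteq> 0" by metis
      moreover have "v i \<in> vecs {0..n i}" by (simp add: vecs_def v_def)
      ultimately show "v i \<in> vecs {0..n i} - {0}" by simp
    qed
    moreover have "sv_map r n d v = svvec r n d (w j)"
    proof
      fix M
      have "sv_mon r M (\<lambda>k. v (fst k) (snd k)) = sv_mon r M (w j)" if "M \<in> ?I"
        by (rule polyfun_cong[OF polyfun_sv_mon[OF that]]) (auto simp: sv_vars_def v_def)
      then show "sv_map r n d v M = svvec r n d (w j) M" by (simp add: svvec_apply sv_map_def sv_mon_def)
    qed
    ultimately show ?thesis unfolding segre_veronese_def by (intro CollectI exI[of _ v]) simp
  qed
  then have p: "p \<in> {1..h} \<rightarrow> ?X" using q0 by (auto simp: p_def)
  have zero: "svvec r n d (w j) = 0" if no: "\<not> ok j" for j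
  proof
    fix M
    obtain i where i: "i \<in> {1..r}" "\<And>a. a \<le> n i \<Longrightarrow> w j (i, a) = 0" using no by (auto simp: ok_def)
    have "sv_mon r M (w j) = 0" if "M \<in> ?I"
    proof -
      have Mi: "M i \<in> multisets_of_size {0..n i} (d i)"
        using PiE_mem[OF that[unfolded sv_index_def] i(1)] .
      then have "M i \<noteq> {#}" using d1[OF i(1)] by (auto simp: multisets_of_size_def)
      then obtain a where a: "a \<in># M i" by blast
      then have "a \<le> n i" using Mi by (auto simp: multisets_of_size_def)
      then have "w j (i, a) = 0" by (rule i(2))
      then have "0 \<in> (\<lambda>a. w j (i, a)) ` set_mset (M i)" using a by (intro image_eqI[of _ _ a]) simp_all
      then have "mon (M i) (\<lambda>a. w j (i, a)) = 0" by (simp add: mon_def)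
      then show ?thesis unfolding sv_mon_def using i(1) by (intro prod_zero) auto
    qed
    then show "svvec r n d (w j) M = 0 M" by (simp add: svvec_apply)
  qed
  have in_span: "svvec r n d (w j) \<in> cfun.span (\<Union>(p ` {1..h}))" if j: "j < h" for j
  proof (cases "ok j")
    case True
    then have "p (Suc j) = proj_point (svvec r n d (w j))" by (simp add: p_def)
    then have "svvec r n d (w j) \<in> p (Suc j)" using proj_point_self by simp
    moreover have "Suc j \<in> {1..h}" using j by simp
    ultimately show ?thesis by (intro cfun.span_base) blast
  next
    case False
    show ?thesis unfolding zero[OF False] by (rule cfun.span_zero)
  qed
  have xs: "x = (\<Sum>j<h. svvec r n d (w j))" unfolding x(1) by (induction h) (auto simp: fun_eq_iff)
  have x_in: "x \<in> cfun.span (\<Union>(p ` {1..h}))" unfolding xs using in_span by (intro cfun.span_sum) auto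
  have "x \<in> vecs ?I" unfolding x(1) by (auto simp: vecs_def svvec_apply)
  then have "proj_point x \<in> proj_space ?I" using x(2) by (auto simp: proj_space_def)
  moreover have "proj_point x \<subseteq> cfun.span (\<Union>(p ` {1..h}))"
    using x_in by (auto simp: proj_point_def intro: cfun.span_scale)
  ultimately have "proj_point x \<in> linear_span ?I (p ` {1..h})" by (simp add: linear_span_def)
  then show ?thesis using p by blast
qed


text \<open>Part of the cone over the secant variety is parametrised by \<Phi>, with
  \<open>s 0\<close> scaling all points at once and the other parameters moving single points along
  the directions in \<open>S1\<close>. Linear forms dual to the tangent vectors give functions
  \<open>y i\<close> with diagonal Jacobian at \<open>s0\<close>, hence algebraically independent.
  The chain consists of the closures of the images of coordinate subspaces of the parameter
  space.\<close>

theorem terracini_lower_bound: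
  fixes W :: "nat \<Rightarrow> nat \<times> nat \<Rightarrow> complex"
  assumes r: "r \<ge> 1" and d1: "\<And>i. i \<in> {1..r} \<Longrightarrow> d i \<ge> 1"
    and J: "finite J" "J \<noteq> {}" "J \<subseteq> {..<h} \<times> insert None (Some ` sv_vars r n)"
    and dual: "dual_on (mforms r n d) (\<lambda>k. jet (W (fst k)) (snd k)) J"
    and F0: "F0 \<in> mforms r n d" "(\<Sum>j<h. F0 (W j)) \<noteq> 0"
  shows "enat (card J - 1) \<le> proj_dim (sv_index r n d) (secant_variety (sv_index r n d) h (segre_veronese r n d))"
proof -
  let ?I = "sv_index r n d" and ?V = "mforms r n d"
  define D where "D = card J - 1"
  define \<delta> where "\<delta> = (\<Sum>i=1..r. d i)"
  \<comment> \<open>\<open>None\<close> is the sum of the values, which up to the factor \<delta> is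
    the derivative in the scaling parameter; \<open>Some (j, \<tau>)\<close> belongs to moving the
    \<open>j\<close>-th point.\<close>
  define Mf where "Mf \<sigma> F = (case \<sigma> of None \<Rightarrow> (\<Sum>j<h. F (W j)) | Some q \<Rightarrow> pd (snd q) F (W (fst q)))"
    for \<sigma> :: "(nat \<times> nat \<times> nat) option" and F :: "(nat \<times> nat \<Rightarrow> complex) \<Rightarrow> complex"
  define S where "S = insert None (Some ` ({..<h} \<times> sv_vars r n))"
  have linM: "lin_on ?V (Mf \<sigma>)" for \<sigma>
  proof (cases \<sigma>)
    case None
    then show ?thesis
      by (simp add: Mf_def lin_on_def cscale_apply sum.distrib sum_distrib_left)
  next
    case (Some q)
    then show ?thesis unfolding Mf_def using lin_on_pd[of ?V "sv_vars r n"] polyfun_mforms by simp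
  qed
  have linJ: "lin_on ?V (jet (W (fst k)) (snd k))" for k :: "nat \<times> (nat \<times> nat) option"
    by (rule lin_on_jet[of ?V "sv_vars r n"]) (rule polyfun_mforms)
  have 0: "dual_on ?V Mf {None}"
    using dual_on_insert(2)[of ?V Mf "{}" F0 None] F0 linM mforms_subspace by (simp add: Mf_def)
  have r1: "1 \<in> {1..r}" using r by simp
  \<comment> \<open>By Euler's relation the values occurring in \<open>J\<close> are consequences of
    the derivatives, so \<open>J\<close> can be exchanged for a family of the same size that
    contains \<open>None\<close>.\<close>
  have "\<exists>S1. {None} \<subseteq> S1 \<and> S1 \<subseteq> S \<and> finite S1 \<and> card S1 = card J \<and> dual_on ?V Mf S1"
  proof (rule dual_on_exchange[OF dual J(1) mforms_subspace linJ linM 0])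
    show "card {None :: (nat \<times> nat \<times> nat) option} \<le> card J" using J(1,2) by (simp add: Suc_leI card_gt_0_iff)
    fix F k assume F: "F \<in> ?V" "\<And>s. s \<in> S \<Longrightarrow> Mf s F = 0" and k: "k \<in> J"
    obtain j q where jq: "k = (j, q)" "j < h" "q \<in> insert None (Some ` sv_vars r n)" using k J(3) by auto
    have pd0: "pd \<tau> F (W j) = 0" if "\<tau> \<in> sv_vars r n" for \<tau>
      using F(2)[of "Some (j, \<tau>)"] that jq(2) by (simp add: S_def Mf_def)
    have "of_nat (d 1) * F (W j) = (\<Sum>a\<le>n 1. W j (1, a) * pd (1, a) F (W j))"
      by (rule mforms_euler[OF F(1) r1, symmetric])
    also have "\<dots> = 0" using pd0 r1 by (intro sum.neutral) (auto simp: sv_vars_def)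
    finally have "F (W j) = 0" using d1[OF r1] by simp
    then show "jet (W (fst k)) (snd k) F = 0" using jq pd0 by auto
  qed (auto simp: S_def)
  then obtain S1 where S1: "None \<in> S1" "S1 \<subseteq> S" "finite S1" "card S1 = card J" "dual_on ?V Mf S1" by auto
  have "card {1..D} = card (S1 - {None})" using S1 J(1,2) by (simp add: D_def)
  then obtain e' where e': "bij_betw e' {1..D} (S1 - {None})"
    using finite_same_card_bij[of "{1..D}" "S1 - {None}"] S1(3) by auto
  define e where "e = e'(0 := None)"
  have e0: "e 0 = None" by (simp add: e_def)
  have eS: "e k \<in> S1 - {None}" if "k \<in> {1..D}" for k
  proof -
    have "e' k \<in> S1 - {None}" using bij_betw_apply[OF e' that] .
    then show ?thesis using that by (simp add: e_def)
  qed
  have einj: "inj_on e {..D}"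
  proof (rule inj_onI)
    fix a b assume ab: "a \<in> {..D}" "b \<in> {..D}" "e a = e b"
    show "a = b"
    proof (cases "a = 0 \<or> b = 0")
      case True
      then show ?thesis using eS[of a] eS[of b] ab e0 by (cases "a = 0"; cases "b = 0") auto
    next
      case False
      then have "e' a = e' b" "a \<in> {1..D}" "b \<in> {1..D}" using ab by (auto simp: e_def)
      then show ?thesis by (rule inj_onD[OF bij_betw_imp_inj_on[OF e']])
    qed
  qed
  have e1: "\<exists>j \<tau>. e k = Some (j, \<tau>) \<and> j < h \<and> \<tau> \<in> sv_vars r n" if "k \<in> {1..D}" for k
    using eS[OF that] S1(2) by (auto simp: S_def)
  have "e ` {..D} \<subseteq> S1"
  proof
    fix x assume "x \<in> e ` {..D}"
    then obtain k where "x = e k" "k \<le> D" by auto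
    then show "x \<in> S1" using eS[of k] e0 S1(1) by (cases "k = 0") auto
  qed
  then have "dual_on ?V Mf (e ` {..D})" by (rule dual_on_mono[OF S1(5) _ order_refl])
  then have "dual_on ?V (\<lambda>k. Mf (e k)) {..D}" unfolding dual_on_reindex[OF einj] .
  then obtain f where f: "\<forall>i\<in>{..D}. f i \<in> ?V \<and> (\<forall>k\<in>{..D}. Mf (e k) (f i) = (if k = i then 1 else 0))"
    unfolding dual_on_def by (rule exE)
  define ws where "ws s j = (\<lambda>\<tau>. s 0 * W j \<tau> + (\<Sum>k\<in>{1..D}. (if e k = Some (j, \<tau>) then 1 else 0) * s k))"
    for s :: "nat \<Rightarrow> complex" and j
  define \<Phi> where "\<Phi> s = (\<lambda>M. \<Sum>j<h. svvec r n d (ws s j) M)" for s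
  define y where "y i = (\<lambda>s. \<Sum>j<h. f i (ws s j))" for i
  have "\<forall>i\<in>{..D}. \<exists>\<phi>. \<phi> \<in> forms ?I 1 \<and> (\<forall>s. \<phi> (\<Phi> s) = y i s)"
  proof
    fix i assume "i \<in> {..D}"
    then have "f i \<in> ?V" using f by blast
    from mforms_linear_form[OF this] obtain \<phi> where "\<phi> \<in> forms ?I 1"
      "\<forall>(w :: nat \<Rightarrow> _) h. \<phi> (\<lambda>M. \<Sum>j<h. svvec r n d (w j) M) = (\<Sum>j<h. f i (w j))" by blast
    then show "\<exists>\<phi>. \<phi> \<in> forms ?I 1 \<and> (\<forall>s. \<phi> (\<Phi> s) = y i s)" by (auto simp: \<Phi>_def y_def)
  qed
  from bchoice[OF this] obtain \<phi> where \<phi>: "\<forall>i\<in>{..D}. \<phi> i \<in> forms ?I 1 \<and> (\<forall>s. \<phi> i (\<Phi> s) = y i s)" by (rule exE)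
  define s0 where "s0 = (\<lambda>k :: nat. if k = 0 then 1 else (0 :: complex))"
  have ws0: "ws s0 j = W j" for j by (auto simp: ws_def s0_def fun_eq_iff intro!: sum.neutral)
  have pws: "polyfun {..D} (\<lambda>s. ws s j \<tau>)" for j \<tau>
    unfolding ws_def by (intro polyfun.add polyfun.mult polyfun_sum polyfun.const polyfun.var) auto
  have pf: "polyfun (sv_vars r n) (f i)" if "i \<le> D" for i using f that polyfun_mforms by blast
  have py: "polyfun {..D} (y i)" if "i \<le> D" for i
    unfolding y_def by (intro polyfun_sum polyfun_comp[OF pf[OF that]] pws)
  have pdws: "pd k (\<lambda>s. ws s j \<tau>) s = (if k = 0 then W j \<tau> else if e k = Some (j, \<tau>) then 1 else 0)"
    if k: "k \<le> D" for k j \<tau> s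
  proof -
    have v: "polyfun {..D} (\<lambda>s. s i)" if "i \<in> {..D}" for i using that by (rule polyfun.var)
    have p1: "polyfun {..D} (\<lambda>s. s 0 * W j \<tau>)" by (intro polyfun.mult v polyfun.const) simp
    have p2: "polyfun {..D} (\<lambda>s. (if e i = Some (j, \<tau>) then 1 else 0) * s i)" if "i \<in> {1..D}" for i
      using that by (intro polyfun.mult v polyfun.const) simp
    have p3: "polyfun {..D} (\<lambda>s. \<Sum>i\<in>{1..D}. (if e i = Some (j, \<tau>) then 1 else 0) * s i)"
      by (rule polyfun_sum) (rule p2)
    have "pd k (\<lambda>s. ws s j \<tau>) s = pd k (\<lambda>s. s 0 * W j \<tau>) s
        + pd k (\<lambda>s. \<Sum>i\<in>{1..D}. (if e i = Some (j, \<tau>) then 1 else 0) * s i) s"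
      unfolding ws_def by (rule pd_add[OF p1 p3])
    also have "pd k (\<lambda>s. \<Sum>i\<in>{1..D}. (if e i = Some (j, \<tau>) then 1 else 0) * s i) s
        = (\<Sum>i\<in>{1..D}. pd k (\<lambda>s. (if e i = Some (j, \<tau>) then 1 else 0) * s i) s)"
      by (rule pd_sum) (rule p2)
    also have "pd k (\<lambda>s. s 0 * W j \<tau>) s = (if k = 0 then W j \<tau> else 0)"
    proof -
      have "polyfun {..D} (\<lambda>s. s 0)" by (rule v) simp
      from pd_mult[OF this polyfun.const[of UNIV "W j \<tau>"], of k s] show ?thesis by simp
    qed
    also have "(\<Sum>i\<in>{1..D}. pd k (\<lambda>s. (if e i = Some (j, \<tau>) then 1 else 0) * s i) s)
        = (\<Sum>i\<in>{1..D}. if i = k then (if e i = Some (j, \<tau>) then 1 else 0) else 0)"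
    proof (rule sum.cong[OF refl])
      fix i assume "i \<in> {1..D}"
      then have "polyfun {..D} (\<lambda>s. s i)" by (intro v) simp
      from pd_cmult[OF this, of k "if e i = Some (j, \<tau>) then 1 else 0" s]
      show "pd k (\<lambda>s. (if e i = Some (j, \<tau>) then 1 else 0) * s i) s
          = (if i = k then (if e i = Some (j, \<tau>) then 1 else 0) else 0)" by auto
    qed
    finally show ?thesis using k by (cases "k = 0") auto
  qed
  have pdy: "pd k (y i) s0 = (if k = i then (if i = 0 then of_nat \<delta> else 1) else 0)" if i: "i \<le> D" and k: "k \<le> D" for i k
  proof -
    have fi: "f i \<in> ?V" "\<And>k. k \<le> D \<Longrightarrow> Mf (e k) (f i) = (if k = i then 1 else 0)" using f i by auto
    have "pd k (y i) s0 = (\<Sum>j<h. pd k (\<lambda>s. f i (ws s j)) s0)"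
      unfolding y_def by (rule pd_sum[of _ "{..D}"]) (rule polyfun_comp[OF pf[OF i] pws])
    also have "\<dots> = (\<Sum>j<h. \<Sum>\<tau>\<in>sv_vars r n. pd \<tau> (f i) (W j) * (if k = 0 then W j \<tau> else if e k = Some (j, \<tau>) then 1 else 0))"
      by (intro sum.cong refl) (simp add: pd_chain[OF pf[OF i] finite_sv_vars pws] ws0 pdws[OF k])
    also have "\<dots> = (if k = i then (if i = 0 then of_nat \<delta> else 1) else 0)"
    proof (cases "k = 0")
      case True
      \<comment> \<open>Euler's relations, added over the factors: this is where \<delta> enters the
        Jacobian.\<close>
      have "(\<Sum>\<tau>\<in>sv_vars r n. pd \<tau> (f i) (W j) * W j \<tau>) = of_nat \<delta> * f i (W j)" for j
      proof -
        have "(\<Sum>\<tau>\<in>sv_vars r n. pd \<tau> (f i) (W j) * W j \<tau>) = (\<Sum>l=1..r. \<Sum>a\<le>n l. pd (l, a) (f i) (W j) * W j (l, a))"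
          unfolding sv_vars_def by (subst sum.Sigma) auto
        also have "\<dots> = (\<Sum>l=1..r. of_nat (d l) * f i (W j))"
          using mforms_euler[OF fi(1), of _ "W j"] by (intro sum.cong) (auto simp: mult.commute)
        finally show ?thesis by (simp add: \<delta>_def sum_distrib_right)
      qed
      then have "(\<Sum>j<h. \<Sum>\<tau>\<in>sv_vars r n. pd \<tau> (f i) (W j) * (if k = 0 then W j \<tau> else if e k = Some (j, \<tau>) then 1 else 0))
          = of_nat \<delta> * Mf (e 0) (f i)" using True e0 by (simp add: Mf_def sum_distrib_left)
      then show ?thesis using fi(2)[of 0] True by auto
    next
      case False
      then have "k \<in> {1..D}" using k by simp
      then obtain j0 \<tau>0 where ek: "e k = Some (j0, \<tau>0)" "j0 < h" "\<tau>0 \<in> sv_vars r n" using e1 by blast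
      have "(\<Sum>j<h. \<Sum>\<tau>\<in>sv_vars r n. pd \<tau> (f i) (W j) * (if k = 0 then W j \<tau> else if e k = Some (j, \<tau>) then 1 else 0))
          = (\<Sum>j<h. \<Sum>\<tau>\<in>sv_vars r n. if \<tau> = \<tau>0 then (if j = j0 then pd \<tau> (f i) (W j) else 0) else 0)"
        using False ek(1) by (intro sum.cong refl) auto
      also have "\<dots> = pd \<tau>0 (f i) (W j0)" using ek(2,3) by simp
      also have "\<dots> = Mf (e k) (f i)" by (simp add: Mf_def ek(1))
      finally show ?thesis using fi(2)[OF k] False by auto
    qed
    finally show ?thesis .
  qed
  have \<delta>0: "\<delta> \<noteq> 0"
    unfolding \<delta>_def using d1[OF r1] r1 by (metis finite_atLeastAtMost not_one_le_zero sum_eq_0_iff)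
  have ai: "alg_indep (Suc l) y (vecs {..l})" if l: "l \<le> D" for l
    by (rule alg_indep_jacobian[of l D y s0 "\<lambda>i. if i = 0 then of_nat \<delta> else 1"])
       (use l py pdy \<delta>0 in \<open>auto simp: s0_def vecs_def\<close>)
  have \<Phi>v: "\<Phi> s \<in> vecs ?I" for s by (auto simp: \<Phi>_def vecs_def svvec_apply)
  have psv: "polyfun UNIV (\<lambda>s. svvec r n d (ws s j) M)" for j M
  proof (cases "M \<in> ?I")
    case True
    then show ?thesis unfolding svvec_apply
      using polyfun_comp[OF polyfun_sv_mon[OF True] polyfun_mono[OF pws subset_UNIV]] by simp
  qed (simp add: svvec_apply polyfun.const)
  have p\<Phi>: "polyfun UNIV (\<lambda>s. \<Phi> s M)" for M
    unfolding \<Phi>_def by (intro polyfun_sum psv)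
  have \<Phi>0: "\<Phi> s0 \<noteq> 0"
  proof
    assume a: "\<Phi> s0 = 0"
    have "f 0 \<in> ?V" "Mf (e 0) (f 0) = 1" using f by auto
    then have "y 0 s0 = 1" by (simp add: y_def ws0 e0 Mf_def)
    moreover have \<phi>0: "\<phi> 0 \<in> forms ?I 1" "\<phi> 0 (\<Phi> s0) = y 0 s0" using \<phi> by auto
    moreover have "\<phi> 0 0 = 0"
    proof -
      have "cscale 0 (0 :: (nat \<Rightarrow> nat multiset) \<Rightarrow> complex) = 0" by (simp add: fun_eq_iff cscale_def)
      then show ?thesis using forms_cscale[OF \<phi>0(1), of 0 0] by simp
    qed
    ultimately show False using a by simp
  qed
  define Sec where "Sec = secant_variety ?I h (segre_veronese r n d)"
  define B where "B l = {proj_point (\<Phi> s) | s. s \<in> vecs {..l} \<and> \<Phi> s \<noteq> 0}" for l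
  define Z where "Z l = zariski ?I closure_of B l" for l
  have BI: "B l \<subseteq> proj_space ?I" for l using \<Phi>v by (auto simp: B_def proj_space_def)
  have BZ: "B l \<subseteq> Z l" for l
    unfolding Z_def using BI by (intro closure_of_subset) (simp add: topspace_zariski)
  have BSec: "B l \<subseteq> Sec" for l
  proof -
    let ?U = "\<Union>p \<in> {1..h} \<rightarrow> segre_veronese r n d. linear_span ?I (p ` {1..h})"
    have "B l \<subseteq> ?U" unfolding B_def using secant_variety_point[OF d1 _ _, of r] by (force simp: \<Phi>_def)
    moreover have "?U \<subseteq> zariski ?I closure_of ?U"
      by (rule closure_of_subset) (auto simp: topspace_zariski linear_span_def)
    ultimately show ?thesis by (simp add: Sec_def secant_variety_def)
  qed
  have Sec_closed: "closedin (zariski ?I) Sec" by (simp add: Sec_def secant_variety_def)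
  have s0v: "s0 \<in> vecs {..l}" for l by (simp add: s0_def vecs_def)
  have irr: "irreducible_closedin (subtopology (zariski ?I) Sec) (Z l)" for l
    unfolding Z_def by (rule irreducible_closure[OF B_def \<Phi>v p\<Phi> s0v \<Phi>0 Sec_closed BSec])
  have strict: "Z l \<subset> Z (Suc l)" if l: "Suc l \<le> D" for l
  proof
    have "B l \<subseteq> B (Suc l)" unfolding B_def vecs_def by auto
    then show "Z l \<subseteq> Z (Suc l)" unfolding Z_def by (rule closure_of_mono)
    show "Z l \<noteq> Z (Suc l)"
    proof
      assume eq: "Z l = Z (Suc l)"
      \<comment> \<open>On the smaller parameter space there are too many functions:
        \<open>y 0, ..., y (l + 1)\<close> depend on \<open>l + 1\<close> parameters, and comparing
        forms of degree \<open>e\<close> in \<open>l + 2\<close> variables with forms of degree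
        \<open>e * \<delta>\<close> in \<open>l + 1\<close> variables forces a relation.\<close>
      have "\<exists>e. \<exists>G\<in>forms {..Suc l} e. (\<forall>s\<in>vecs {..l}. G (\<lambda>i. y i s) = 0) \<and> G \<noteq> 0"
      proof (rule ccontr)
        assume no: "\<not> ?thesis"
        have "(Suc l + e) choose Suc l \<le> (\<delta> + 1) ^ l * (e + 1) ^ l" for e
        proof -
          have "\<exists>S1\<subseteq>vecs {..l}. finite S1 \<and> card S1 = card (multisets_of_size {..Suc l} e) \<and>
              dual_on (forms {..Suc l} e) (\<lambda>s F. F (\<lambda>i. y i s)) S1"
            by (rule dual_on_of_injective) (use no in auto)
          then obtain T where T: "T \<subseteq> vecs {..l}" "finite T" "card T = card (multisets_of_size {..Suc l} e)"
              "dual_on (forms {..Suc l} e) (\<lambda>s F. F (\<lambda>i. y i s)) T" by blast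
          obtain E where E: "\<forall>i\<in>T. E i \<in> forms {..Suc l} e \<and> (\<forall>s\<in>T. E i (\<lambda>i. y i s) = (if s = i then 1 else 0))"
            using T(4) unfolding dual_on_def by (rule exE)
          \<comment> \<open>Truncation to the first \<open>l + 1\<close> parameters makes the
            coordinates of \<open>ws\<close> linear forms in these and is the identity on
            \<open>T\<close>.\<close>
          define res where "res s = (\<lambda>k. if k \<le> l then s k else (0 :: complex))" for s
          have resT: "res s = s" if "s \<in> T" for s using T(1) that by (auto simp: res_def vecs_def fun_eq_iff)
          have fres: "(\<lambda>s. res s k) \<in> forms {..l} 1" for k
            using forms_var[of k "{..l}"] cfun.subspace_0[OF forms_subspace[of "{..l}" 1]]
            by (cases "k \<le> l") (auto simp: res_def zero_fun_def)
          have fws: "(\<lambda>s. ws (res s) j \<tau>) \<in> forms {..l} 1" for j \<tau>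
          proof -
            have "(\<lambda>s. W j \<tau> * res s 0 + (\<Sum>k\<in>{1..D}. (if e k = Some (j, \<tau>) then 1 else 0) * res s k)) \<in> forms {..l} 1" for e
              by (intro forms_add forms_sum forms_cmult fres)
            then show ?thesis by (simp add: ws_def mult.commute)
          qed
          have fsv: "(\<lambda>s. F (ws (res s) j)) \<in> forms {..l} \<delta>" if "F \<in> ?V" for F j
            using that unfolding mforms_def
          proof (induction rule: cfun.span_induct_alt)
            case base
            then show ?case using cfun.subspace_0[OF forms_subspace] by (simp add: zero_fun_def)
          next
            case (step c g1 g2)
            then obtain M where M: "g1 = sv_mon r M" "M \<in> ?I" by auto
            have "(\<lambda>s. mon (M i) (\<lambda>a. ws (res s) j (i, a))) \<in> forms {..l} (d i)" if "i \<in> {1..r}" for i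
            proof -
              have "M i \<in> multisets_of_size {0..n i} (d i)" using PiE_mem[OF M(2)[unfolded sv_index_def] that] .
              then have "mon (M i) \<in> forms {0..n i} (d i)" unfolding forms_def by (intro cfun.span_base) auto
              from forms_comp[OF this fws] show ?thesis by simp
            qed
            then have "(\<lambda>s. sv_mon r M (ws (res s) j)) \<in> forms {..l} \<delta>"
              unfolding sv_mon_def \<delta>_def by (rule forms_prod)
            then have "(\<lambda>s. c * g1 (ws (res s) j) + g2 (ws (res s) j)) \<in> forms {..l} \<delta>"
              unfolding M(1) by (rule forms_add[OF forms_cmult step.IH])
            then show ?case by (simp add: cscale_apply)
          qed
          have fy: "(\<lambda>s. y i (res s)) \<in> forms {..l} \<delta>" if "i \<in> {..Suc l}" for i
            unfolding y_def by (intro forms_sum fsv) (use f that l in auto)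
          have "dual_on (forms {..l} (e * \<delta>)) (\<lambda>s F. F s) T"
            unfolding dual_on_def
          proof (intro exI[of _ "\<lambda>t s. E t (\<lambda>i. y i (res s))"] ballI conjI)
            fix t assume t: "t \<in> T"
            show "(\<lambda>s. E t (\<lambda>i. y i (res s))) \<in> forms {..l} (e * \<delta>)"
              by (rule forms_comp[OF _ fy]) (use E t in auto)
            fix s assume "s \<in> T"
            then show "E t (\<lambda>i. y i (res s)) = (if s = t then 1 else 0)" using E t resT by auto
          qed
          then have "card T \<le> card (multisets_of_size {..l} (e * \<delta>))"
            by (rule conjunct2[OF dual_on_forms_card_le[OF _ order_refl lin_on_eval finite_atMost]])
          then have "(Suc l + e) choose Suc l \<le> (l + e * \<delta>) choose l"
            using T(3) unfolding card_multisets_atMost by simp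
          also have "\<dots> \<le> (e * \<delta> + 1) ^ l" by (rule choose_le_power)
          also have "\<dots> \<le> ((\<delta> + 1) * (e + 1)) ^ l" by (intro power_mono) (auto simp: algebra_simps)
          finally show ?thesis by (simp only: power_mult_distrib)
        qed
        then have "Suc l \<le> l" by (rule growth)
        then show False by simp
      qed
      then obtain e G where G: "G \<in> forms {..Suc l} e" "\<forall>s\<in>vecs {..l}. G (\<lambda>i. y i s) = 0" "G \<noteq> 0" by blast
      \<comment> \<open>Positive degree makes \<open>H\<close> below vanish at the zero vector,
        which covers the parameters with \<open>\<Phi> s = 0\<close>.\<close>
      have "e \<noteq> 0"
      proof
        assume "e = 0"
        then have "G x = 0" for x using forms_0_const[of G "{..Suc l}" x "\<lambda>i. y i s0"] G(1,2) s0v by simp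
        then show False using G(3) by (simp add: fun_eq_iff)
      qed
      \<comment> \<open>The relation is carried to the ambient space: \<open>H\<close> vanishes on
        \<open>Z l\<close>, hence on \<open>Z (Suc l)\<close> if the two agree, against the
        independence of the \<open>y i\<close> there.\<close>
      define H where "H x = G (\<lambda>i. \<phi> i x)" for x
      have Hf: "H \<in> forms ?I e"
        unfolding H_def[abs_def] using forms_comp[OF G(1), of "\<lambda>x i. \<phi> i x" ?I 1] \<phi> l by simp
      have Hy: "H (\<Phi> s) = G (\<lambda>i. y i s)" for s
        unfolding H_def by (rule polyfun_cong[OF polyfun_forms[OF G(1)]]) (use \<phi> l in auto)
      have HS: "{H} \<subseteq> (\<Union>e. forms ?I e)" using Hf by blast
      have "B l \<subseteq> zero_locus ?I {H}"
      proof
        fix p assume p: "p \<in> B l"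
        then obtain s where s: "p = proj_point (\<Phi> s)" "s \<in> vecs {..l}" by (auto simp: B_def)
        have "proj_point (\<Phi> s) \<in> proj_space ?I" using BI p s(1) by blast
        then show "p \<in> zero_locus ?I {H}" unfolding s(1) zero_locus_proj_point[OF HS] using Hy G(2) s(2) by simp
      qed
      moreover have "closedin (zariski ?I) (zero_locus ?I {H})" unfolding closedin_zariski using HS by blast
      ultimately have "Z l \<subseteq> zero_locus ?I {H}" unfolding Z_def by (rule closure_of_minimal)
      then have sub: "B (Suc l) \<subseteq> zero_locus ?I {H}" using eq BZ[of "Suc l"] by blast
      have "G (\<lambda>i. y i s) = 0" if s: "s \<in> vecs {..Suc l}" for s
      proof (cases "\<Phi> s = 0")
        case True
        have "cscale 0 (0 :: (nat \<Rightarrow> nat multiset) \<Rightarrow> complex) = 0" by (simp add: fun_eq_iff cscale_def)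
        then have "H 0 = 0" using forms_cscale[OF Hf, of 0 0] \<open>e \<noteq> 0\<close> by (simp add: power_0_left)
        then show ?thesis using Hy[of s] True by simp
      next
        case False
        then have "proj_point (\<Phi> s) \<in> B (Suc l)" using s by (auto simp: B_def)
        then have "proj_point (\<Phi> s) \<in> zero_locus ?I {H}" using sub by blast
        then show ?thesis unfolding zero_locus_proj_point[OF HS] using Hy by simp
      qed
      then have "G = 0" using ai[OF l] G(1) unfolding alg_indep_def lessThan_Suc_atMost by blast
      then show False using G(3) by simp
    qed
  qed
  have "enat D \<le> krull_dim (subtopology (zariski ?I) Sec)"
    unfolding krull_dim_def
  proof (rule Sup_upper, rule CollectI, rule exI[of _ D], rule conjI[OF refl], rule exI[of _ Z], intro conjI allI impI)
    fix i show "irreducible_closedin (subtopology (zariski ?I) Sec) (Z i)" by (rule irr)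
  next
    fix i assume "i < D" then show "Z i \<subset> Z (Suc i)" by (intro strict) simp
  qed
  then show ?thesis by (simp add: proj_dim_def Sec_def D_def)
qed

section \<open>Defectivity\<close>

text \<open>The expected dimension is monotone in the dimension of the variety, so an upper bound
  for the latter can be inserted. The alternatives in \<open>D\<close> are a secant variety of the
  dimension given by the parameter count and one that fills the space.\<close>

lemma not_defective:
  assumes low: "enat D \<le> proj_dim (sv_index r n d) (secant_variety (sv_index r n d) h (segre_veronese r n d))"
    and D: "(\<Sum>i=1..r. n i) * h + h - 1 \<le> D \<or> card (sv_index r n d) - 1 \<le> D"
  shows "\<not> defective (sv_index r n d) h (segre_veronese r n d)"
proof -
  let ?I = "sv_index r n d" and ?X = "segre_veronese r n d"
  obtain x where x: "proj_dim ?I ?X = enat x" "x \<le> (\<Sum>i=1..r. n i)"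
    using proj_dim_segre_veronese_le[of r n d] by (cases "proj_dim ?I ?X") auto
  have "expected_dim ?I h ?X = min (enat (x * h + h - 1)) (enat (card ?I - 1))"
    by (simp add: expected_dim_def x(1) one_enat_def)
  also have "\<dots> \<le> enat D"
  proof -
    have "x * h + h - 1 \<le> (\<Sum>i=1..r. n i) * h + h - 1" using x(2) by (intro diff_le_mono add_le_mono1 mult_le_mono1)
    then show ?thesis using D by (auto simp: min_def)
  qed
  finally show ?thesis using low unfolding defective_def by (meson leD le_less_trans order.trans)
qed

lemma svfullD:
  assumes sv: "svfull r n d W h" and r: "r \<ge> 1" and d1: "d 1 \<ge> 1" and j: "j < h"
    and comp: "\<And>i. i \<in> {1..r} \<Longrightarrow> (\<Sum>a\<le>n i. \<xi> (i, a) * W j (i, a)) = of_nat (d i) * c"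
  shows "\<exists>F\<in>mforms r n d. \<forall>k<h. F (W k) = (if k = j then c else 0) \<and>
    (\<forall>\<tau>\<in>sv_vars r n. pd \<tau> F (W k) = (if k = j then \<xi> \<tau> else 0))"
proof -
  have "\<forall>i\<in>{1..r}. (\<Sum>a\<le>n i. \<xi> (i, a) * W j (i, a)) = of_nat (d i) * c" using comp by blast
  then obtain F where F: "F \<in> mforms r n d" "\<forall>k<h. \<forall>\<tau>\<in>sv_vars r n. pd \<tau> F (W k) = (if k = j then \<xi> \<tau> else 0)"
    using sv j unfolding svfull_def by blast
  have r1: "1 \<in> {1..r}" using r by simp
  have "F (W k) = (if k = j then c else 0)" if k: "k < h" for k
  proof -
    have "of_nat (d 1) * F (W k) = (\<Sum>a\<le>n 1. W k (1, a) * pd (1, a) F (W k))"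
      by (rule mforms_euler[OF F(1) r1, symmetric])
    also have "\<dots> = (\<Sum>a\<le>n 1. if k = j then \<xi> (1, a) * W j (1, a) else 0)"
    proof (rule sum.cong[OF refl])
      fix a assume "a \<in> {..n 1}"
      then have "(1, a) \<in> sv_vars r n" using r1 by (simp add: sv_vars_def)
      then show "W k (1, a) * pd (1, a) F (W k) = (if k = j then \<xi> (1, a) * W j (1, a) else 0)"
        using F(2) k by simp
    qed
    also have "\<dots> = of_nat (d 1) * (if k = j then c else 0)" using comp[OF r1] by simp
    finally show ?thesis using d1 by simp
  qed
  then show ?thesis using F by blast
qed

text \<open>In every factor the derivative along one coordinate \<open>piv j i\<close> at which the
  point is nonzero is determined by the Euler relation. This leaves, for each point, the value and
  \<open>n i\<close> free derivatives in the \<open>i\<close>-th factor.\<close>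

lemma svfull_dual:
  assumes sv: "svfull r n d W h" and r: "r \<ge> 1" and d1: "d 1 \<ge> 1"
    and ne: "\<And>j i. j < h \<Longrightarrow> i \<in> {1..r} \<Longrightarrow> \<exists>a\<le>n i. W j (i, a) \<noteq> 0"
  shows "\<exists>J. finite J \<and> J \<subseteq> {..<h} \<times> insert None (Some ` sv_vars r n) \<and> {..<h} \<times> {None} \<subseteq> J \<and>
    card J = h * ((\<Sum>i=1..r. n i) + 1) \<and> dual_on (mforms r n d) (\<lambda>k. jet (W (fst k)) (snd k)) J"
proof -
  define piv where "piv j i = (SOME a. a \<le> n i \<and> W j (i, a) \<noteq> 0)" for j i
  have piv: "piv j i \<le> n i" "W j (i, piv j i) \<noteq> 0" if "j < h" "i \<in> {1..r}" for j i
    using someI_ex[OF ne[OF that, unfolded Bex_def]] unfolding piv_def by blast+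
  define T where "T j = Sigma {1..r} (\<lambda>i. {..n i} - {piv j i})" for j
  define J where "J = Sigma {..<h} (\<lambda>j. insert None (Some ` T j))"
  have TI: "T j \<subseteq> sv_vars r n" for j by (auto simp: T_def sv_vars_def)
  have finT: "finite (T j)" for j by (simp add: T_def)
  have cT: "card (T j) = (\<Sum>i=1..r. n i)" if "j < h" for j
    unfolding T_def using piv(1)[OF that] by (subst card_SigmaI) (auto intro!: sum.cong simp: card_Diff_singleton)
  have "card J = (\<Sum>j<h. card (insert None (Some ` T j)))"
    unfolding J_def by (rule card_SigmaI) (auto simp: finT)
  also have "\<dots> = (\<Sum>j<h. (\<Sum>i=1..r. n i) + 1)"
    using cT finT by (intro sum.cong refl) (simp add: card_image card_insert_if)
  finally have cJ: "card J = h * ((\<Sum>i=1..r. n i) + 1)" by simp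
  have "\<exists>F\<in>mforms r n d. \<forall>k\<in>J. jet (W (fst k)) (snd k) F = (if k = q then 1 else 0)" if q: "q \<in> J" for q
  proof -
    obtain j u where ju: "q = (j, u)" "j < h" "u \<in> insert None (Some ` T j)" using q by (auto simp: J_def)
    define c :: complex where "c = (if u = None then 1 else 0)"
    define \<theta> :: "nat \<times> nat \<Rightarrow> complex" where "\<theta> \<tau> = (if u = Some \<tau> then 1 else 0)" for \<tau>
    \<comment> \<open>The pivot component is the solution of the Euler relation of its
      factor.\<close>
    define \<xi> where "\<xi> \<tau> = (if snd \<tau> = piv j (fst \<tau>)
      then (of_nat (d (fst \<tau>)) * c - (\<Sum>a\<in>{..n (fst \<tau>)} - {piv j (fst \<tau>)}. \<theta> (fst \<tau>, a) * W j (fst \<tau>, a))) / W j \<tau>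
      else \<theta> \<tau>)" for \<tau>
    have "(\<Sum>a\<le>n i. \<xi> (i, a) * W j (i, a)) = of_nat (d i) * c" if i: "i \<in> {1..r}" for i
    proof -
      have "(\<Sum>a\<le>n i. \<xi> (i, a) * W j (i, a)) = \<xi> (i, piv j i) * W j (i, piv j i)
          + (\<Sum>a\<in>{..n i} - {piv j i}. \<xi> (i, a) * W j (i, a))"
        using piv(1)[OF ju(2) i] by (intro sum.remove) auto
      also have "(\<Sum>a\<in>{..n i} - {piv j i}. \<xi> (i, a) * W j (i, a)) = (\<Sum>a\<in>{..n i} - {piv j i}. \<theta> (i, a) * W j (i, a))"
        by (intro sum.cong) (auto simp: \<xi>_def)
      finally show ?thesis using piv(2)[OF ju(2) i] by (simp add: \<xi>_def)
    qed
    from svfullD[OF sv r d1 ju(2) this] obtain F where F: "F \<in> mforms r n d"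
      "\<forall>k<h. F (W k) = (if k = j then c else 0) \<and> (\<forall>\<tau>\<in>sv_vars r n. pd \<tau> F (W k) = (if k = j then \<xi> \<tau> else 0))" by blast
    have "jet (W (fst k)) (snd k) F = (if k = q then 1 else 0)" if k: "k \<in> J" for k
    proof -
      obtain l v where lv: "k = (l, v)" "l < h" "v \<in> insert None (Some ` T l)" using k by (auto simp: J_def)
      show ?thesis
      proof (cases v)
        case None
        then show ?thesis using F(2) lv ju by (auto simp: c_def)
      next
        case (Some \<tau>)
        then have \<tau>: "\<tau> \<in> T l" using lv(3) by auto
        then have "pd \<tau> F (W l) = (if l = j then \<xi> \<tau> else 0)" using F(2) lv(2) TI by blast
        moreover have "l = j \<Longrightarrow> \<xi> \<tau> = \<theta> \<tau>" using \<tau> by (auto simp: \<xi>_def T_def)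
        ultimately show ?thesis using lv ju Some by (auto simp: \<theta>_def)
      qed
    qed
    then show ?thesis using F(1) by blast
  qed
  then obtain F where "\<forall>q\<in>J. F q \<in> mforms r n d \<and> (\<forall>k\<in>J. jet (W (fst k)) (snd k) (F q) = (if k = q then 1 else 0))"
    by (metis (no_types, lifting))
  then have "dual_on (mforms r n d) (\<lambda>k. jet (W (fst k)) (snd k)) J" unfolding dual_on_def by (rule exI[of _ F])
  moreover have "finite J" unfolding J_def using finT by auto
  moreover have "J \<subseteq> {..<h} \<times> insert None (Some ` sv_vars r n)" using TI by (auto simp: J_def)
  moreover have "{..<h} \<times> {None} \<subseteq> J" by (auto simp: J_def)
  ultimately show ?thesis using cJ by (intro exI[of _ J]) simp
qed

lemma svfull_not_defective:
  assumes sv: "svfull r n d W h" and r: "r \<ge> 1" and d1: "\<And>i. i \<in> {1..r} \<Longrightarrow> d i \<ge> 1" and h: "h \<ge> 1"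
    and ne: "\<And>j i. j < h \<Longrightarrow> i \<in> {1..r} \<Longrightarrow> \<exists>a\<le>n i. W j (i, a) \<noteq> 0"
  shows "\<not> defective (sv_index r n d) h (segre_veronese r n d)"
proof -
  have d11: "d 1 \<ge> 1" using d1 r by simp
  obtain J where J: "finite J" "J \<subseteq> {..<h} \<times> insert None (Some ` sv_vars r n)" "{..<h} \<times> {None} \<subseteq> J"
    "card J = h * ((\<Sum>i=1..r. n i) + 1)" "dual_on (mforms r n d) (\<lambda>k. jet (W (fst k)) (snd k)) J"
    using svfull_dual[OF sv r d11 ne] by blast
  obtain E where E: "\<forall>i\<in>J. E i \<in> mforms r n d \<and> (\<forall>k\<in>J. jet (W (fst k)) (snd k) (E i) = (if k = i then 1 else 0))"
    using J(5) unfolding dual_on_def by (rule exE)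
  have inJ: "(j, None) \<in> J" if "j < h" for j using J(3) that by auto
  \<comment> \<open>The multiform dual to the value at the point 0 has sum of values 1 and so can
    serve as \<open>F0\<close> in \<open>terracini_lower_bound\<close>.\<close>
  have "E (0, None) (W j) = (if j = 0 then 1 else 0)" if j: "j < h" for j
  proof -
    have "jet (W (fst (j, None :: (nat \<times> nat) option))) (snd (j, None :: (nat \<times> nat) option)) (E (0, None))
        = (if (j, None :: (nat \<times> nat) option) = (0, None) then 1 else 0)"
    proof -
      have "(0, None) \<in> J" using inJ[of 0] h by simp
      then show ?thesis using bspec[OF conjunct2[OF bspec[OF E]] inJ[OF j]] by blast
    qed
    then show ?thesis by simp
  qed
  then have "(\<Sum>j<h. E (0, None) (W j)) = (\<Sum>j<h. if j = 0 then 1 else 0)" by (intro sum.cong) auto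
  also have "\<dots> \<noteq> 0" using h by simp
  finally have S: "(\<Sum>j<h. E (0, None) (W j)) \<noteq> 0" .
  have EV: "E (0, None) \<in> mforms r n d" using E inJ[of 0] h by simp
  have "J \<noteq> {}" using inJ[of 0] h by auto
  from terracini_lower_bound[OF r d1 J(1) this J(2,5) EV S]
  have "enat (card J - 1) \<le> proj_dim (sv_index r n d) (secant_variety (sv_index r n d) h (segre_veronese r n d))" .
  then show ?thesis by (rule not_defective) (simp add: J(4) algebra_simps)
qed

section \<open>Generic configurations on the diagonal\<close>

text \<open>As long as the conditions do not exhaust the space, some nonzero form satisfies them
  all, and the next simple point is placed outside its zero set.\<close>

lemma indep_mixed:
  assumes "dp_indep m d (card G)" "finite G" "finite R" "G \<inter> R = {}" "(m + 1) * card G + card R \<le> (m + d) choose m"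
  shows "indep m d (dbl m G \<union> R \<times> {None})"
  using assms(3-5)
proof (induction R rule: finite_induct)
  case empty
  then show ?case using dp_indep_indep[OF assms(1,2)] by simp
next
  case (insert j R)
  let ?J = "dbl m G \<union> R \<times> {None}"
  have fin: "finite ?J" using assms(2) insert.hyps by auto
  have "indep m d ?J" by (rule insert.IH) (use insert.prems insert.hyps in auto)
  then obtain y0 where y0: "dual_on (forms {..m} d) (jets y0) ?J" unfolding indep_def by (rule exE)
  have "card ?J = (m + 1) * card G + card R"
  proof -
    have "dbl m G \<inter> R \<times> {None} = {}" by (auto simp: dbl_def)
    then show ?thesis using assms(2) insert.hyps
      by (simp add: card_Un_disjoint card_dbl card_cartesian_product)
  qed
  then have "card ?J < (m + d) choose m" using insert by simp
  from kern_forms_nonzero[OF fin this] obtain F x where F: "F \<in> forms {..m} d" "\<And>k. k \<in> ?J \<Longrightarrow> jets y0 k F = 0" "F x \<noteq> 0"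
    unfolding kern_def by blast
  define y where "y = (\<lambda>(i, a). if i = j then x a else y0 (i, a))"
  have j: "j \<notin> G" "j \<notin> R" using insert by auto
  have yk: "jets y k H = jets y0 k H" if "k \<in> ?J" for k H
    using that j by (intro jets_cong) (auto simp: y_def dbl_def)
  have yx: "pt y j = x" by (auto simp: pt_def y_def)
  have 1: "dual_on (forms {..m} d) (jets y) ?J"
    using y0 dual_on_cong[of ?J "forms {..m} d" "jets y" "jets y0"] yk by blast
  have "dual_on (forms {..m} d) (jets y) (insert (j, None) ?J)"
    by (rule dual_on_insert[OF 1 F(1)])
       (use F yk yx fin in \<open>auto simp: forms_subspace lin_on_jets[OF order_refl]\<close>)
  moreover have "insert (j, None) ?J = dbl m G \<union> insert j R \<times> {None}" by auto
  ultimately have "dual_on (forms {..m} d) (jets y) (dbl m G \<union> insert j R \<times> {None})" by (simp only:)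
  then show ?case by (rule indepI)
qed

text \<open>Configurations are generic in all coordinates; those beyond \<open>m\<close> are cut off
  before \<open>diag\<close> spreads a point over factors with \<open>n i > m\<close>.\<close>

definition trunc :: "nat \<Rightarrow> (nat \<times> nat \<Rightarrow> complex) \<Rightarrow> nat \<Rightarrow> nat \<Rightarrow> complex"
  where "trunc m y j a = (if a \<le> m then y (j, a) else 0)"

lemma jet_trunc:
  assumes "F \<in> forms {..m} d"
  shows "jet (trunc m y (fst k)) (snd k) F = jets y k F"
proof (cases "snd k")
  case None
  then show ?thesis using polyfun_cong[OF polyfun_forms[OF assms], of "trunc m y (fst k)" "pt y (fst k)"]
    by (simp add: jets_def trunc_def pt_def)
next
  case (Some b)
  then show ?thesis using polyfun_cong[OF polyfun_pd[OF polyfun_forms[OF assms]], of "trunc m y (fst k)" "pt y (fst k)" b]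
    by (simp add: jets_def trunc_def pt_def)
qed

text \<open>Double points in degree \<open>d\<close> and simple points in degree
  \<open>d - 2\<close> are independent for generic configurations, hence for a common one with
  nonzero coordinates 0.\<close>

lemma diagonal_configuration:
  assumes mn: "\<And>i. i \<in> {1..r} \<Longrightarrow> m \<le> n i" and d1: "\<And>i. i \<in> {1..r} \<Longrightarrow> d i \<ge> 1"
    and r1: "r \<ge> 1" and D2: "(\<Sum>i=1..r. d i) \<ge> 2"
    and A: "dp_indep m (\<Sum>i=1..r. d i) h" and h: "h \<le> (m + ((\<Sum>i=1..r. d i) - 2)) choose m"
  shows "\<exists>p. diagonal r m h n d p \<and> svfull r n d (\<lambda>j. diag (p j)) h"
proof -
  let ?D = "\<Sum>i=1..r. d i"
  have "indep m (?D - 2) (dbl m {} \<union> {..<h} \<times> {None})"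
    by (rule indep_mixed) (use dp_indep_0 h in auto)
  then have i1: "indep m (?D - 2) ({..<h} \<times> {None})" by (simp add: dbl_def)
  have g1: "generically (\<lambda>y. dual_on (forms {..m} (?D - 2)) (jets y) ({..<h} \<times> {None}))"
    by (rule indep_gen[OF i1]) simp
  have g2: "generically (\<lambda>y. dual_on (forms {..m} ?D) (jets y) (dbl m {..<h}))"
    by (rule indep_gen[OF A[unfolded dp_indep_def]]) simp
  have g3: "generically (\<lambda>y. \<forall>j\<in>{..<h}. y (j, 0) \<noteq> 0)" by (rule generically_ball[OF _ generically_coord]) simp
  obtain y where y: "dual_on (forms {..m} (?D - 2)) (jets y) ({..<h} \<times> {None})"
    "dual_on (forms {..m} ?D) (jets y) (dbl m {..<h})" "\<forall>j\<in>{..<h}. y (j, 0) \<noteq> 0"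
    using generically_ex[OF generically_conj[OF g1 generically_conj[OF g2 g3]]] by blast
  define p where "p = trunc m y"
  have inj: "inj_on (\<lambda>j. (j, None :: nat option)) {..<h}" by (auto simp: inj_on_def)
  have "(\<lambda>j. (j, None :: nat option)) ` {..<h} = {..<h} \<times> {None}" by auto
  then have "dual_on (forms {..m} (?D - 2)) (\<lambda>j. jets y (j, None)) {..<h}"
    using y(1) dual_on_reindex[OF inj, of "forms {..m} (?D - 2)" "jets y"] by simp
  moreover have "F (p j) = jets y (j, None) F" if "F \<in> forms {..m} (?D - 2)" for F j
    using jet_trunc[OF that, of y "(j, None)"] by (simp add: p_def)
  ultimately have "dual_on (forms {..m} (?D - 2)) (\<lambda>j F. F (p j)) {..<h}"
    using dual_on_cong[of "{..<h}" "forms {..m} (?D - 2)" "\<lambda>j F. F (p j)" "\<lambda>j. jets y (j, None)"] by blast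
  then have dg: "diagonal r m h n d p"
    using mn d1 r1 D2 y(3) by unfold_locales (auto simp: p_def trunc_def)
  have "dual_on (forms {..m} ?D) (\<lambda>k. jet (p (fst k)) (snd k)) (dbl m {..<h})"
    using y(2) dual_on_cong[of "dbl m {..<h}" "forms {..m} ?D" "\<lambda>k. jet (p (fst k)) (snd k)" "jets y"] jet_trunc
    unfolding p_def by blast
  from diagonal.svfull_diag[OF dg this] dg show ?thesis by blast
qed

section \<open>The exceptional case of nineteen points in degree 9\<close>

lemma forms_slot:
  assumes "F \<in> forms {..n i} e" "i \<in> {1..r}"
  shows "(\<lambda>w. F (\<lambda>a. w (i, a))) \<in> mforms r n (\<lambda>k. if k = i then e else 0)"
  using assms(1) unfolding forms_def
proof (induction rule: cfun.span_induct_alt)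
  case base
  then show ?case using cfun.subspace_0[OF mforms_subspace] by (simp add: zero_fun_def)
next
  case (step c f g)
  then obtain M where M: "f = mon M" "set_mset M \<subseteq> {..n i}" "size M = e" by (auto simp: multisets_of_size_def)
  have "(\<lambda>w. mon M (\<lambda>a. w (i, a))) \<in> mforms r n (\<lambda>k. if k = i then size M else 0)"
    using M(2)
  proof (induction M)
    case empty
    then show ?case by (simp add: mon_empty mforms_const)
  next
    case (add a M)
    have e: "(\<lambda>k. if k = i then size M else 0)(i := Suc (if i = i then size M else 0)) = (\<lambda>k. if k = i then size (add_mset a M) else 0)"
      by auto
    have "(\<lambda>w. w (i, a) * mon M (\<lambda>a. w (i, a))) \<in> mforms r n ((\<lambda>k. if k = i then size M else 0)(i := Suc (if i = i then size M else 0)))"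
      by (rule mforms_var[OF _ assms(2)]) (use add in auto)
    then show ?case unfolding e mon_add .
  qed
  then have "(\<lambda>w. mon M (\<lambda>a. w (i, a))) \<in> mforms r n (\<lambda>k. if k = i then e else 0)"
    by (simp only: M(3))
  then have "(\<lambda>w. c * mon M (\<lambda>a. w (i, a)) + g (\<lambda>a. w (i, a))) \<in> mforms r n (\<lambda>k. if k = i then e else 0)"
    by (rule mforms_add[OF mforms_cmult step.IH])
  then show ?case by (simp add: M(1) cscale_apply)
qed

lemma pd_slot: "pd (i, b) (\<lambda>w. F (\<lambda>a. w (i, a))) w = pd b F (\<lambda>a. w (i, a))"
proof -
  have "(\<lambda>a. (w((i, b) := t)) (i, a)) = (\<lambda>a. w (i, a))(b := t)" for t by (auto simp: fun_eq_iff)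
  then show ?thesis by (simp add: pd_def)
qed

lemma pd_other_slot:
  assumes "k \<noteq> i" shows "pd (k, b) (\<lambda>w. F (\<lambda>a. w (i, a))) w = 0"
proof -
  have "(\<lambda>a. (w((k, b) := t)) (i, a)) = (\<lambda>a. w (i, a))" for t using assms by (auto simp: fun_eq_iff)
  then show ?thesis by (simp add: pd_def)
qed

text \<open>Eighteen double points give 54 conditions. A nonzero form singular at all of them
  exists, and the value at a point outside its zero set is the last condition:
  \<open>55 = C(11, 2)\<close>, so the secant variety fills the space.\<close>

lemma filling_2_9:
  assumes n: "n 1 = 2" and d: "d 1 = 9"
  shows "\<not> defective (sv_index 1 n d) 19 (segre_veronese 1 n d)"
proof -
  have nd: "n (Suc 0) = 2" "d (Suc 0) = 9" using n d by simp_all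
  obtain y0 where y0: "dual_on (forms {..2} 9) (jets y0) (dbl 2 {..<18})"
    using dp_indep_2_9_18 unfolding dp_indep_def indep_def by (rule exE)
  have "card (dbl 2 {..<18}) < (2 + 9) choose 2" by (simp add: card_dbl choose_two)
  then have "\<exists>F\<in>kern (forms {..2} 9) (jets y0) (dbl 2 {..<18}). \<exists>x. F x \<noteq> 0"
    by (intro kern_forms_nonzero) simp_all
  then obtain F x where F: "F \<in> forms {..2} 9" "\<And>k. k \<in> dbl 2 {..<18} \<Longrightarrow> jets y0 k F = 0" "F x \<noteq> 0"
    unfolding kern_def by blast
  define y where "y = (\<lambda>(i, a). if i = 18 then x a else y0 (i, a))"
  have yk: "jets y k H = jets y0 k H" if "k \<in> dbl 2 {..<18}" for k H
    using that by (intro jets_cong) (auto simp: y_def dbl_def)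
  have yx: "pt y 18 = x" by (auto simp: pt_def y_def)
  have 1: "dual_on (forms {..2} 9) (jets y) (dbl 2 {..<18})"
    using y0 dual_on_cong[of "dbl 2 {..<18}" "forms {..2} 9" "jets y" "jets y0"] yk by blast
  let ?J = "insert (18, None) (dbl 2 {..<18})"
  have 2: "dual_on (forms {..2} 9) (jets y) ?J"
    by (rule dual_on_insert[OF 1 F(1)])
       (use F yk yx in \<open>auto simp: forms_subspace lin_on_jets[OF order_refl]\<close>)
  define \<sigma> where "\<sigma> k = (fst k, map_option (Pair (1 :: nat)) (snd k))" for k :: "nat \<times> nat option"
  define W where "W j = diag (pt y j)" for j
  have sl: "(\<lambda>a. W j (1, a)) = pt y j" for j by (simp add: W_def diag_def)
  have inj: "inj_on \<sigma> ?J" by (auto simp: inj_on_def \<sigma>_def dbl_def)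
  have jet_slot: "jet (W (fst (\<sigma> k))) (snd (\<sigma> k)) (\<lambda>w. H (\<lambda>a. w (1, a))) = jets y k H" for k H
    by (cases "snd k") (simp_all add: \<sigma>_def jets_def pd_slot sl[unfolded One_nat_def])
  have mf: "(\<lambda>w. H (\<lambda>a. w (1, a))) \<in> mforms 1 n d" if "H \<in> forms {..2} 9" for H
  proof -
    have "mforms 1 n d = mforms 1 n (\<lambda>k. if k = 1 then 9 else 0)" by (rule mforms_cong) (use nd in simp)
    then show ?thesis using forms_slot[of H n 1 9 1] that nd by simp
  qed
  obtain E where E: "\<forall>i\<in>?J. E i \<in> forms {..2} 9 \<and> (\<forall>k\<in>?J. jets y k (E i) = (if k = i then 1 else 0))"
    using 2 unfolding dual_on_def by (rule exE)
  have "dual_on (mforms 1 n d) (\<lambda>k. jet (W (fst (\<sigma> k))) (snd (\<sigma> k))) ?J"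
    unfolding dual_on_def
  proof (intro exI[of _ "\<lambda>i w. E i (\<lambda>a. w (1, a))"] ballI conjI)
    fix i assume i: "i \<in> ?J"
    have Ei: "E i \<in> forms {..2} 9" "\<forall>k\<in>?J. jets y k (E i) = (if k = i then 1 else 0)"
      using bspec[OF E i] by (rule conjunct1, rule conjunct2)
    show "(\<lambda>w. E i (\<lambda>a. w (1, a))) \<in> mforms 1 n d" by (rule mf[OF Ei(1)])
    fix k assume k: "k \<in> ?J"
    show "jet (W (fst (\<sigma> k))) (snd (\<sigma> k)) (\<lambda>w. E i (\<lambda>a. w (1, a))) = (if k = i then 1 else 0)"
      unfolding jet_slot by (rule bspec[OF Ei(2) k])
  qed
  then have dual: "dual_on (mforms 1 n d) (\<lambda>k. jet (W (fst k)) (snd k)) (\<sigma> ` ?J)"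
    using dual_on_reindex[OF inj, of "mforms 1 n d" "\<lambda>k. jet (W (fst k)) (snd k)"] by simp
  have F0: "F (pt y j) = 0" if j: "j < 18" for j
  proof (rule euler_zero[OF F(1)])
    fix b :: nat assume "b \<le> 2"
    then have k: "(j, Some b) \<in> dbl 2 {..<18}" using j by (auto simp: dbl_def)
    show "pd b F (pt y j) = 0" using F(2)[OF k] yk[OF k, of F] by simp
  qed simp
  have "(\<Sum>j<19. F (\<lambda>a. W j (1, a))) = (\<Sum>j<18. F (pt y j)) + F (pt y 18)"
    unfolding sl by (simp add: eval_nat_numeral)
  then have S: "(\<Sum>j<19. F (\<lambda>a. W j (1, a))) \<noteq> 0" using F0 F(3) yx by simp
  have sub: "\<sigma> ` ?J \<subseteq> {..<19} \<times> insert None (Some ` sv_vars 1 n)"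
    using nd by (auto simp: \<sigma>_def dbl_def sv_vars_def)
  have cJ: "card (\<sigma> ` ?J) = 55" unfolding card_image[OF inj]
    by (subst card_insert_disjoint) (auto simp: dbl_def card_cartesian_product card_image)
  have "enat (card (\<sigma> ` ?J) - 1) \<le> proj_dim (sv_index 1 n d) (secant_variety (sv_index 1 n d) 19 (segre_veronese 1 n d))"
    by (rule terracini_lower_bound[OF _ _ _ _ sub dual mf[OF F(1)] S]) (use nd in simp_all)
  then show ?thesis
    by (rule not_defective) (unfold cJ, simp add: card_sv_index nd choose_two)
qed

text \<open>The new point \<open>P\<close> is generic. \<open>g i\<close> is singular at the old
  points, nonzero at \<open>P\<close>, and leaves room for one linear form in the factor
  \<open>i\<close>. Linear forms vanishing at \<open>P\<close> then realise the derivatives at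
  \<open>P\<close> in that factor without disturbing the old points, and \<open>F0\<close> takes
  care of the value.\<close>

lemma not_defective_Suc:
  assumes sv: "svfull r n d W h" and r: "r \<ge> 1" and d1: "\<And>i. i \<in> {1..r} \<Longrightarrow> d i \<ge> 1"
    and ne: "\<And>j i. j < h \<Longrightarrow> i \<in> {1..r} \<Longrightarrow> \<exists>a\<le>n i. W j (i, a) \<noteq> 0"
    and G: "\<And>i. i \<in> {1..r} \<Longrightarrow> \<exists>G\<in>mforms r n (d(i := d i - 1)). (\<exists>w. G w \<noteq> 0) \<and>
      (\<forall>j<h. G (W j) = 0 \<and> (\<forall>\<tau>\<in>sv_vars r n. pd \<tau> G (W j) = 0))"
  shows "\<not> defective (sv_index r n d) (Suc h) (segre_veronese r n d)"
proof -
  let ?V = "mforms r n d" and ?N = "\<Sum>i=1..r. n i"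
  have r1: "1 \<in> {1..r}" and d11: "d 1 \<ge> 1" using r d1 by auto
  define Q where "Q i G \<longleftrightarrow> G \<in> mforms r n (d(i := d i - 1)) \<and> (\<exists>w. G w \<noteq> 0) \<and>
      (\<forall>j<h. G (W j) = 0 \<and> (\<forall>\<tau>\<in>sv_vars r n. pd \<tau> G (W j) = 0))" for i G
  have "\<forall>i\<in>{1..r}. \<exists>G. Q i G" using G unfolding Q_def Bex_def by blast
  from bchoice[OF this] obtain g where Qg: "\<forall>i\<in>{1..r}. Q i (g i)" by (rule exE)
  have g: "g i \<in> mforms r n (d(i := d i - 1))" "\<exists>w. g i w \<noteq> 0" if "i \<in> {1..r}" for i
    using bspec[OF Qg that] unfolding Q_def by blast+
  have g0: "g i (W j) = 0" "\<tau> \<in> sv_vars r n \<Longrightarrow> pd \<tau> (g i) (W j) = 0" if "i \<in> {1..r}" "j < h" for i j \<tau>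
    using bspec[OF Qg that(1)] that(2) unfolding Q_def by blast+
  have pg: "polyfun (sv_vars r n) (g i)" if "i \<in> {1..r}" for i by (rule polyfun_mforms[OF g(1)[OF that]])
  have gen1: "generically (\<lambda>w. g i w \<noteq> 0)" if i: "i \<in> {1..r}" for i
  proof -
    obtain w where w: "g i w \<noteq> 0" using g(2)[OF i] by (rule exE)
    show ?thesis by (rule genericallyI[of "g i" w, OF polyfun_mono[OF pg[OF i] subset_UNIV] w])
  qed
  have "generically (\<lambda>w. (\<forall>i\<in>{1..r}. g i w \<noteq> 0) \<and> (\<forall>i\<in>{1..r}. w (i, 0) \<noteq> 0))"
    by (rule generically_conj) (rule generically_ball[OF finite_atLeastAtMost gen1] generically_ball[OF finite_atLeastAtMost generically_coord], assumption?)+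
  then obtain P where P: "\<forall>i\<in>{1..r}. g i P \<noteq> 0" "\<forall>i\<in>{1..r}. P (i, 0) \<noteq> 0" using generically_ex by blast
  define W' where "W' = W(h := P)"
  define L where "L k = jet (W' (fst k)) (snd k)" for k :: "nat \<times> (nat \<times> nat) option"
  have linL: "lin_on ?V (L k)" for k
    unfolding L_def by (rule lin_on_jet[of ?V "sv_vars r n"]) (rule polyfun_mforms)
  obtain J where J: "finite J" "J \<subseteq> {..<h} \<times> insert None (Some ` sv_vars r n)"
    "card J = h * (?N + 1)" "dual_on ?V (\<lambda>k. jet (W (fst k)) (snd k)) J"
    using svfull_dual[OF sv r d11 ne] by blast
  have LJ: "L k F = jet (W (fst k)) (snd k) F" if "k \<in> J" for k F
  proof -
    have "fst k < h" using J(2) that by auto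
    then show ?thesis by (simp add: L_def W'_def)
  qed
  have dJ: "dual_on ?V L J"
    using J(4) dual_on_cong[of J ?V L "\<lambda>k. jet (W (fst k)) (snd k)"] LJ by blast
  have van: "L k (\<lambda>w. N w * g i w) = 0" if "k \<in> J" "i \<in> {1..r}" "polyfun UNIV N" for k i N
  proof -
    obtain j u where ju: "k = (j, u)" "j < h" "u \<in> insert None (Some ` sv_vars r n)" using J(2) \<open>k \<in> J\<close> by auto
    have "jet (W j) u (\<lambda>w. N w * g i w) = 0"
      using ju(3) g0[OF that(2) ju(2)] by (auto simp: pd_mult[OF that(3) pg[OF that(2)]])
    then show ?thesis using LJ[OF that(1)] ju(1) by simp
  qed
  have pv: "polyfun UNIV (\<lambda>w. w \<tau>)" for \<tau> :: "nat \<times> nat" by (rule polyfun.var) simp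
  define F0 where "F0 = (\<lambda>w. w (1, 0) * g 1 w)"
  have F0: "F0 \<in> ?V" unfolding F0_def by (rule mforms_var'[OF g(1)[OF r1] r1 _ d11]) simp
  have F0P: "F0 P \<noteq> 0" using P r1 by (simp add: F0_def)
  define J1 where "J1 = insert (h, None) J"
  have F0J: "L k F0 = 0" if "k \<in> J" for k unfolding F0_def by (rule van[OF that r1 pv])
  have LP: "L (h, None) F0 \<noteq> 0" using F0P by (simp add: L_def W'_def)
  have d1': "dual_on ?V L J1"
    unfolding J1_def by (rule dual_on_insert(2)[OF dJ F0 F0J LP mforms_subspace linL J(1)])
  define T where "T = Sigma {1..r} (\<lambda>i. {1..n i})"
  have TI: "T \<subseteq> sv_vars r n" by (auto simp: T_def sv_vars_def)
  \<comment> \<open>With \<open>i = fst \<tau>\<close>, the linear form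
    \<open>w \<tau> * P (i, 0) - w (i, 0) * P \<tau>\<close> vanishes at \<open>P\<close>; the
    leading factor normalises its derivative.\<close>
  define E where "E \<tau> = (\<lambda>w. 1 / (P (fst \<tau>, 0) * g (fst \<tau>) P) *
      ((w \<tau> * P (fst \<tau>, 0) - w (fst \<tau>, 0) * P \<tau>) * g (fst \<tau>) w))" for \<tau>
  have d2: "dual_on (kern ?V L J1) L ({h} \<times> Some ` T)"
    unfolding dual_on_def
  proof (intro exI[of _ "\<lambda>k. E (the (snd k))"] ballI conjI)
    fix k assume "k \<in> {h} \<times> Some ` T"
    then obtain i a where k: "k = (h, Some (i, a))" "i \<in> {1..r}" "1 \<le> a" "a \<le> n i" by (auto simp: T_def)
    define N where "N = (\<lambda>w. w (i, a) * P (i, 0) - w (i, 0) * P (i, a))"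
    have pN: "polyfun UNIV N" unfolding N_def by (intro polyfun_diff polyfun.mult pv polyfun.const)
    define c where "c = 1 / (P (i, 0) * g i P)"
    have Ek: "E (the (snd k)) = (\<lambda>w. c * (N w * g i w))" by (simp add: E_def k N_def c_def)
    have gi: "(\<lambda>w. w (i, b) * g i w) \<in> ?V" if "b \<le> n i" for b
      by (rule mforms_var'[OF g(1)[OF k(2)] k(2) that d1[OF k(2)]])
    have "(\<lambda>w. c * (P (i, 0) * (w (i, a) * g i w) - P (i, a) * (w (i, 0) * g i w))) \<in> ?V"
      by (intro mforms_cmult mforms_diff gi) (use k in auto)
    moreover have "(\<lambda>w. c * (P (i, 0) * (w (i, a) * g i w) - P (i, a) * (w (i, 0) * g i w))) = (\<lambda>w. c * (N w * g i w))"
      by (simp add: N_def fun_eq_iff algebra_simps)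
    ultimately have EV: "(\<lambda>w. c * (N w * g i w)) \<in> ?V" by (simp only:)
    have "polyfun UNIV (\<lambda>w. c * N w)" by (intro polyfun.mult polyfun.const pN)
    from van[OF _ k(2) this] have "L l (\<lambda>w. c * (N w * g i w)) = 0" if "l \<in> J" for l
      using that by (simp add: mult.assoc)
    moreover have NP: "N P = 0" by (simp add: N_def)
    then have "L (h, None) (\<lambda>w. c * (N w * g i w)) = 0" by (simp add: L_def W'_def)
    ultimately show "E (the (snd k)) \<in> kern ?V L J1" using EV unfolding Ek by (auto simp: kern_def J1_def)
    fix l assume "l \<in> {h} \<times> Some ` T"
    then obtain \<sigma> where l: "l = (h, Some \<sigma>)" "\<sigma> \<in> T" by auto
    have s0: "\<sigma> \<noteq> (i, 0)" using l(2) by (auto simp: T_def)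
    have p1: "polyfun UNIV (\<lambda>w. w \<tau> * x)" for \<tau> :: "nat \<times> nat" and x by (intro polyfun.mult pv polyfun.const)
    have "pd \<sigma> (\<lambda>w. w \<tau> * x) P = (if \<tau> = \<sigma> then x else 0)" for \<tau> x
      using pd_mult[OF pv polyfun.const[of UNIV x], of \<sigma> \<tau> P] by simp
    then have pdN: "pd \<sigma> N P = (if \<sigma> = (i, a) then P (i, 0) else 0)"
      unfolding N_def using pd_diff[OF p1 p1, of \<sigma> "(i, a)" "P (i, 0)" "(i, 0)" "P (i, a)" P] s0 by auto
    have "pd \<sigma> (\<lambda>w. c * (N w * g i w)) P = c * (pd \<sigma> N P * g i P)"
      using pd_cmult[OF polyfun.mult[OF pN polyfun_mono[OF pg[OF k(2)] subset_UNIV]], of \<sigma> c P]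
        pd_mult[OF pN pg[OF k(2)], of \<sigma> P] NP by simp
    also have "\<dots> = (if \<sigma> = (i, a) then 1 else 0)" using pdN P k(2) by (simp add: c_def)
    finally show "L l (E (the (snd k))) = (if l = k then 1 else 0)"
      unfolding Ek using l(1) k(1) by (simp add: L_def W'_def)
  qed
  have hJ: "(h, u) \<notin> J" for u using J(2) by auto
  have dis: "J1 \<inter> {h} \<times> Some ` T = {}" using hJ by (auto simp: J1_def)
  have finT: "finite T" by (simp add: T_def)
  have finJ1: "finite J1" using J(1) by (simp add: J1_def)
  have fin2: "finite ({h} \<times> Some ` T)" using finT by simp
  have dual: "dual_on ?V (\<lambda>k. jet (W' (fst k)) (snd k)) (J1 \<union> {h} \<times> Some ` T)"
    using dual_on_Un[OF d1' d2 dis mforms_subspace linL finJ1 fin2] unfolding L_def .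
  have "card T = ?N" unfolding T_def by (subst card_SigmaI) auto
  then have cJ: "card (J1 \<union> {h} \<times> Some ` T) = Suc h * (?N + 1)"
    using dis finJ1 fin2 hJ J(1,3) by (simp add: card_Un_disjoint J1_def card_cartesian_product card_image)
  have sub: "J1 \<union> {h} \<times> Some ` T \<subseteq> {..<Suc h} \<times> insert None (Some ` sv_vars r n)"
    using J(2) TI by (auto simp: J1_def)
  have "F0 (W j) = 0" if "j < h" for j using g0(1)[OF r1 that] by (simp add: F0_def)
  then have S: "(\<Sum>j<Suc h. F0 (W' j)) \<noteq> 0" using F0P by (simp add: W'_def)
  have "enat (card (J1 \<union> {h} \<times> Some ` T) - 1) \<le> proj_dim (sv_index r n d) (secant_variety (sv_index r n d) (Suc h) (segre_veronese r n d))"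
    by (rule terracini_lower_bound[OF r d1 _ _ sub dual F0 S]) (use finJ1 fin2 in \<open>auto simp: J1_def\<close>)
  then show ?thesis by (rule not_defective) (unfold cJ, simp add: algebra_simps)
qed

text \<open>A minor of the factors \<open>a\<close> and \<open>b\<close> and the lift of a sextic
  through the eighteen points both vanish at these points, so their product is singular there. The
  sextic exists because \<open>18 < 28\<close>.\<close>

lemma double_minor:
  assumes dg: "diagonal r 2 18 n d p" and ab: "a \<in> {1..r}" "b \<in> {1..r}" "a \<noteq> b"
    and e: "(\<Sum>i=1..r. e i) = 8" "e a \<ge> 1" "e b \<ge> 1"
  shows "\<exists>G\<in>mforms r n e. (\<exists>w. G w \<noteq> 0) \<and>
      (\<forall>j<18. G (diag (p j)) = 0 \<and> (\<forall>\<tau>\<in>sv_vars r n. pd \<tau> G (diag (p j)) = 0))"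
proof -
  interpret diagonal r 2 18 n d p by (rule dg)
  define y where "y = (\<lambda>(j, a). p j a)"
  have "\<exists>F\<in>kern (forms {..2} 6) (jets y) ({..<18} \<times> {None}). \<exists>x. F x \<noteq> 0"
    by (rule kern_forms_nonzero) (simp_all add: card_cartesian_product choose_two)
  then obtain K x where K: "K \<in> forms {..2} 6" "\<And>k. k \<in> {..<18} \<times> {None} \<Longrightarrow> jets y k K = 0" "K x \<noteq> 0"
    unfolding kern_def by blast
  have Kp: "K (p j) = 0" if "j < 18" for j
    using K(2)[of "(j, None)"] that by (simp add: y_def pt_def)
  let ?e1 = "e(a := e a - 1)"
  let ?e2 = "?e1(b := ?e1 b - 1)"
  have "(\<Sum>i=1..r. ?e2 i) = 6"
    using sum_decrease[of b r ?e1] sum_decrease[of a r e] ab e by simp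
  then obtain H where H: "H \<in> mforms r n ?e2" "\<And>x. H (diag x) = K x"
    using forms_lift[of K 2 ?e2 r n] K(1) mn by auto
  have mono: "(\<lambda>w. w (a, u) * (w (b, v) * H w)) \<in> mforms r n e" if "u \<le> 2" "v \<le> 2" for u v
  proof -
    have "(\<lambda>w. w (b, v) * H w) \<in> mforms r n ?e1"
      by (rule mforms_var'[OF H(1) ab(2)]) (use mn[OF ab(2)] that e ab in auto)
    from mforms_var'[OF this ab(1) _ e(2)] show ?thesis using mn[OF ab(1)] that by auto
  qed
  define N where "N = (\<lambda>w :: nat \<times> nat \<Rightarrow> complex. w (a, 0) * w (b, 1) - w (a, 1) * w (b, 0))"
  have pv: "polyfun UNIV (\<lambda>w :: nat \<times> nat \<Rightarrow> complex. w t)" for t by (rule polyfun.var) simp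
  have pN: "polyfun UNIV N" unfolding N_def by (intro polyfun_diff polyfun.mult pv)
  have pH: "polyfun UNIV H" by (rule polyfun_mono[OF polyfun_mforms[OF H(1)] subset_UNIV])
  have "(\<lambda>w. w (a, 0) * (w (b, 1) * H w) - w (a, 1) * (w (b, 0) * H w)) \<in> mforms r n e"
    by (intro mforms_diff mono) auto
  moreover have "(\<lambda>w. w (a, 0) * (w (b, 1) * H w) - w (a, 1) * (w (b, 0) * H w)) = (\<lambda>w. N w * H w)"
    by (simp add: N_def fun_eq_iff algebra_simps)
  ultimately have Gf: "(\<lambda>w. N w * H w) \<in> mforms r n e" by (simp only:)
  have N1: "N (\<lambda>t. if t = (a, 0) \<or> t = (b, 1) then 1 else 0) \<noteq> 0" using ab(3) by (simp add: N_def)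
  have H1: "H (diag x) \<noteq> 0" using H(2) K(3) by simp
  have "\<exists>w. N w * H w \<noteq> 0"
    using polyfun_common[of UNIV N H "\<lambda>t. if t = (a, 0) \<or> t = (b, 1) then 1 else 0" "diag x"] pN pH N1 H1 by auto
  moreover have "N (diag x) = 0" for x by (simp add: N_def diag_def)
  then have "N (diag (p j)) * H (diag (p j)) = 0 \<and> (\<forall>\<tau>\<in>sv_vars r n. pd \<tau> (\<lambda>w. N w * H w) (diag (p j)) = 0)" if "j < 18" for j
    using H(2) Kp[OF that] by (simp add: pd_mult[OF pN pH])
  ultimately show ?thesis using Gf by (intro bexI[OF _ Gf]) blast
qed

text \<open>Only the coordinates \<open>0..2\<close> of the points can be nonzero, so the square of
  coordinate 3 of the factor \<open>k\<close> is singular at all of them.\<close>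

lemma double_coordinate:
  assumes dg: "diagonal r 2 18 n d p" and k: "k \<in> {1..r}" "n k \<ge> 3"
    and e: "(\<Sum>i=1..r. e i) = 8" "e k = 8"
  shows "\<exists>G\<in>mforms r n e. (\<exists>w. G w \<noteq> 0) \<and>
      (\<forall>j<18. G (diag (p j)) = 0 \<and> (\<forall>\<tau>\<in>sv_vars r n. pd \<tau> G (diag (p j)) = 0))"
proof -
  interpret diagonal r 2 18 n d p by (rule dg)
  let ?e1 = "e(k := e k - 1)"
  let ?e2 = "?e1(k := ?e1 k - 1)"
  have "(\<Sum>i=1..r. ?e2 i) = 6"
    using sum_decrease[of k r ?e1] sum_decrease[of k r e] k e by simp
  moreover have "(\<lambda>x. x (0 :: nat) ^ 6) \<in> forms {..2} (6 * 1)" by (intro forms_power forms_var) simp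
  ultimately obtain H where H: "H \<in> mforms r n ?e2" "\<And>x. H (diag x) = x 0 ^ 6"
    using forms_lift[of "\<lambda>x. x 0 ^ 6" 2 ?e2 r n] mn by auto
  have "(\<lambda>w. w (k, 3) * H w) \<in> mforms r n ?e1"
    by (rule mforms_var'[OF H(1) k(1,2)]) (use e in simp)
  from mforms_var'[OF this k] have Gf: "(\<lambda>w. w (k, 3) * (w (k, 3) * H w)) \<in> mforms r n e" using e by simp
  have pv: "polyfun UNIV (\<lambda>w :: nat \<times> nat \<Rightarrow> complex. w (k, 3))" by (rule polyfun.var) simp
  have pH: "polyfun UNIV H" by (rule polyfun_mono[OF polyfun_mforms[OF H(1)] subset_UNIV])
  have z: "diag (p j) (k, 3) = 0" for j using supp[of 3 j] by (simp add: diag_def)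
  define u :: "nat \<times> nat \<Rightarrow> complex" where "u = diag (\<lambda>_. 1)"
  have "H u = 1" unfolding u_def H(2) by (rule power_one)
  moreover have "u (k, 3) = 1" by (simp add: u_def diag_def)
  ultimately have "u (k, 3) * (u (k, 3) * H u) \<noteq> 0" by simp
  then have "\<exists>w. w (k, 3) * (w (k, 3) * H w) \<noteq> 0" by (rule exI[of _ u])
  moreover have "pd \<tau> (\<lambda>w. w (k, 3) * (w (k, 3) * H w)) (diag (p j)) = 0" for \<tau> j
    unfolding pd_mult[OF pv polyfun.mult[OF pv pH]] pd_mult[OF pv pH] using z by simp
  ultimately show ?thesis using Gf z by (intro bexI[OF _ Gf]) simp
qed

text \<open>In bidegree \<open>(1, 8)\<close> multiforms are built as sums of
  \<open>w (i0, b) * s b\<close> with octics \<open>s b\<close> on \<open>P^2\<close>. Placing the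
  point \<open>j\<close> over the coordinate point \<open>j mod 3\<close> decouples the conditions:
  \<open>s b\<close> is prescribed to first order where \<open>j mod 3 = b\<close> and only in value
  elsewhere, which makes at most \<open>3 * 7 + 12 = 33\<close> conditions on a space of dimension
  45.\<close>

lemma split_1_8:
  assumes ii: "{1..r} = {i0, i1}" "i0 \<noteq> i1" and d: "d i0 = 1" "d i1 = 8" and n: "n i0 \<ge> 2" "n i1 = 2"
  shows "\<exists>W. svfull r n d W 19 \<and> (\<forall>j<19. \<forall>i\<in>{1..r}. \<exists>a\<le>n i. W j (i, a) \<noteq> 0)"
proof -
  define M where "M b = dbl 2 {j. j < 19 \<and> j mod 3 = b} \<union> {j. j < 19 \<and> j mod 3 \<noteq> b} \<times> {None}" for b
  have A7: "dp_indep 2 8 7" by (rule dp_indep_count) (simp_all add: choose_two)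
  have set19: "{j. j < 19 \<and> Q j} = set (filter Q [0..<19])" for Q :: "nat \<Rightarrow> bool" by auto
  have cb: "card {j :: nat. j < 19 \<and> j mod 3 = b} \<le> 7" for b
  proof (cases "b < 3")
    case True
    then have b: "b = 0 \<or> b = 1 \<or> b = 2" by auto
    have "[0..<19] = [0, 1, 2, 3, 4, 5, 6, 7, 8, 9, 10, 11, 12, 13, 14, 15, 16, 17, 18]"
      by (simp add: upt_rec)
    then show ?thesis using b unfolding set19 by (elim disjE) simp_all
  next
    case False
    then have e: "{j :: nat. j < 19 \<and> j mod 3 = b} = {}" by auto
    show ?thesis unfolding e by simp
  qed
  have "indep 2 8 (M b)" for b
    unfolding M_def
  proof (rule indep_mixed)
    show "dp_indep 2 8 (card {j. j < 19 \<and> j mod 3 = b})" by (rule dp_indep_mono[OF A7 cb])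
    have "{j :: nat. j < 19 \<and> j mod 3 = b} \<union> {j. j < 19 \<and> j mod 3 \<noteq> b} = {..<19}" by auto
    then have "card {j :: nat. j < 19 \<and> j mod 3 = b} + card {j :: nat. j < 19 \<and> j mod 3 \<noteq> b} = 19"
      by (subst card_Un_disjoint[symmetric]) auto
    then show "(2 + 1) * card {j. j < 19 \<and> j mod 3 = b} + card {j. j < 19 \<and> j mod 3 \<noteq> b} \<le> (2 + 8) choose 2"
      using cb[of b] by (simp add: choose_two)
  qed auto
  then have g1: "generically (\<lambda>y. dual_on (forms {..2} 8) (jets y) (M b))" for b
    by (rule indep_gen) (simp add: M_def)
  have g2: "generically (\<lambda>y. \<forall>b\<in>{..n i0}. dual_on (forms {..2} 8) (jets y) (M b))"
    by (rule generically_ball[OF finite_atMost g1])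
  have g3: "generically (\<lambda>y :: nat \<times> nat \<Rightarrow> complex. \<forall>j\<in>{..<19}. y (j, 0) \<noteq> 0)" by (rule generically_ball[OF _ generically_coord]) simp
  obtain y where y: "\<forall>b\<in>{..n i0}. dual_on (forms {..2} 8) (jets y) (M b)" "\<forall>j\<in>{..<19}. y (j, 0) \<noteq> 0"
    using generically_ex[OF generically_conj[OF g2 g3]] by blast
  define W where "W j = (\<lambda>t. if fst t = i0 then (if snd t = j mod 3 then 1 else 0) else y (j, snd t))" for j :: nat
  have W1: "(\<lambda>a. W j (i1, a)) = pt y j" for j using ii(2) by (auto simp: W_def pt_def)
  have W0: "W j (i0, a) = (if a = j mod 3 then 1 else 0)" for j a by (simp add: W_def)
  have mod3: "j mod 3 \<le> n i0" for j :: nat 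
  proof -
    have "j mod 3 < 3" by simp
    then show ?thesis using n(1) by linarith
  qed
  have "svfull r n d W 19"
    unfolding svfull_def
  proof (intro allI impI)
    fix j \<xi> c assume j: "j < 19" and comp: "\<forall>i\<in>{1..r}. (\<Sum>a\<le>n i. \<xi> (i, a) * W j (i, a)) = of_nat (d i) * c"
    have c0: "\<xi> (i0, j mod 3) = c"
    proof -
      have "(\<Sum>a\<le>n i0. \<xi> (i0, a) * W j (i0, a)) = (\<Sum>a\<le>n i0. if a = j mod 3 then \<xi> (i0, a) else 0)"
        by (intro sum.cong) (auto simp: W0)
      then show ?thesis using comp ii(1) d(1) mod3[of j] by simp
    qed
    have c1: "(\<Sum>a\<le>2. \<xi> (i1, a) * pt y j a) = 8 * c"
    proof -
      have "W j (i1, a) = pt y j a" for a using fun_cong[OF W1, of j a] .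
      then show ?thesis using comp ii(1) d(2) n(2) by auto
    qed
    have "\<exists>F. F \<in> forms {..2} 8 \<and> (\<forall>k<19. F (pt y k) = (if k = j then \<xi> (i0, b) else 0) \<and>
        (k mod 3 = b \<longrightarrow> (\<forall>a\<le>2. pd a F (pt y k) = (if k = j then \<xi> (i1, a) else 0))))" if b: "b \<le> n i0" for b
    proof -
      define v where "v k = (if fst k = j then (case snd k of None \<Rightarrow> \<xi> (i0, b) | Some a \<Rightarrow> \<xi> (i1, a)) else 0)"
        for k :: "nat \<times> nat option"
      have "dual_on (forms {..2} 8) (jets y) (M b)" using y(1) b by blast
      from dual_on_interp[OF this forms_subspace lin_on_jets[OF order_refl], of v]
      obtain F where F: "F \<in> forms {..2} 8" "\<forall>k\<in>M b. jets y k F = v k" by (auto simp: M_def)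
      have grad: "pd a F (pt y k) = (if k = j then \<xi> (i1, a) else 0)" if "k < 19" "k mod 3 = b" "a \<le> 2" for k a
      proof -
        have "(k, Some a) \<in> M b" using that by (auto simp: M_def dbl_def)
        from bspec[OF F(2) this] show ?thesis by (simp add: v_def)
      qed
      have "F (pt y k) = (if k = j then \<xi> (i0, b) else 0)" if k: "k < 19" for k
      proof (cases "k mod 3 = b")
        case False
        then have "(k, None) \<in> M b" using k by (auto simp: M_def)
        from bspec[OF F(2) this] show ?thesis by (simp add: v_def)
      next
        case True
        \<comment> \<open>At a double point the value is forced by Euler's relation; it is the
          required one because compatibility in the factor \<open>i0\<close> gives
          \<open>\<xi> (i0, j mod 3) = c\<close>.\<close>
        have "of_nat 8 * F (pt y k) = (\<Sum>a\<le>2. pt y k a * pd a F (pt y k))"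
          by (rule forms_euler[OF F(1) finite_atMost, symmetric])
        also have "\<dots> = (\<Sum>a\<le>2. if k = j then \<xi> (i1, a) * pt y j a else 0)"
          using grad[OF k True] by (intro sum.cong) auto
        also have "\<dots> = (if k = j then 8 * c else 0)" using c1 by simp
        finally show ?thesis using c0 True by (auto split: if_splits)
      qed
      then show ?thesis using F(1) grad by blast
    qed
    then have "\<forall>b\<in>{..n i0}. \<exists>F. F \<in> forms {..2} 8 \<and> (\<forall>k<19. F (pt y k) = (if k = j then \<xi> (i0, b) else 0) \<and>
        (k mod 3 = b \<longrightarrow> (\<forall>a\<le>2. pd a F (pt y k) = (if k = j then \<xi> (i1, a) else 0))))" by blast
    from bchoice[OF this] obtain f where f: "\<forall>b\<in>{..n i0}. f b \<in> forms {..2} 8 \<and> (\<forall>k<19. f b (pt y k) = (if k = j then \<xi> (i0, b) else 0) \<and>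
        (k mod 3 = b \<longrightarrow> (\<forall>a\<le>2. pd a (f b) (pt y k) = (if k = j then \<xi> (i1, a) else 0))))" by (rule exE)
    define s where "s b = (\<lambda>w :: nat \<times> nat \<Rightarrow> complex. f b (\<lambda>a. w (i1, a)))" for b
    define F where "F = (\<lambda>w. \<Sum>b\<le>n i0. w (i0, b) * s b w)"
    have i01: "i0 \<in> {1..r}" "i1 \<in> {1..r}" using ii(1) by auto
    have sm: "s b \<in> mforms r n (d(i0 := d i0 - 1))" if "b \<le> n i0" for b
    proof -
      have "s b \<in> mforms r n (\<lambda>k. if k = i1 then 8 else 0)"
        unfolding s_def by (rule forms_slot[OF _ i01(2)]) (use f that n in auto)
      moreover have "mforms r n (\<lambda>k. if k = i1 then 8 else 0) = mforms r n (d(i0 := d i0 - 1))"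
      proof (rule mforms_cong)
        fix k assume "k \<in> {1..r}"
        then have "k = i0 \<or> k = i1" unfolding ii(1) by simp
        then show "(if k = i1 then 8 else 0) = (d(i0 := d i0 - 1)) k" using ii(2) d by (elim disjE) simp_all
      qed
      ultimately show ?thesis by simp
    qed
    have sV: "(\<lambda>w. w (i0, b) * s b w) \<in> mforms r n d" if "b \<le> n i0" for b
      by (rule mforms_var'[OF sm[OF that] i01(1) that]) (use d in simp)
    have Ff: "F \<in> mforms r n d" unfolding F_def by (rule mforms_sum) (use sV in auto)
    have pv: "polyfun UNIV (\<lambda>w :: nat \<times> nat \<Rightarrow> complex. w t)" for t by (rule polyfun.var) simp
    have pdF: "pd \<tau> F w = (\<Sum>b\<le>n i0. w (i0, b) * pd \<tau> (s b) w + (if (i0, b) = \<tau> then 1 else 0) * s b w)" for \<tau> w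
    proof -
      have "pd \<tau> F w = (\<Sum>b\<le>n i0. pd \<tau> (\<lambda>w. w (i0, b) * s b w) w)"
        unfolding F_def by (rule pd_sum[of _ "sv_vars r n"]) (use sV polyfun_mforms in blast)
      also have "\<dots> = (\<Sum>b\<le>n i0. w (i0, b) * pd \<tau> (s b) w + (if (i0, b) = \<tau> then 1 else 0) * s b w)"
      proof (rule sum.cong[OF refl])
        fix b assume "b \<in> {..n i0}"
        then have "polyfun (sv_vars r n) (s b)" using sm polyfun_mforms by blast
        from pd_mult[OF pv this, of \<tau> "(i0, b)" w]
        show "pd \<tau> (\<lambda>w. w (i0, b) * s b w) w = w (i0, b) * pd \<tau> (s b) w + (if (i0, b) = \<tau> then 1 else 0) * s b w"
          by simp
      qed
      finally show ?thesis .
    qed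
    have s0: "pd (i0, b') (s b) w = 0" for b b' w unfolding s_def by (rule pd_other_slot[OF ii(2)])
    have s1: "pd (i1, a) (s b) (W k) = pd a (f b) (pt y k)" for a b k
      unfolding s_def pd_slot W1 ..
    have sW: "s b (W k) = f b (pt y k)" for b k by (simp add: s_def W1)
    have "pd \<tau> F (W k) = (if k = j then \<xi> \<tau> else 0)" if k: "k < 19" and \<tau>: "\<tau> \<in> sv_vars r n" for k \<tau>
    proof -
      obtain i a where ia: "\<tau> = (i, a)" "i = i0 \<or> i = i1" "a \<le> n i" using \<tau> ii(1) by (auto simp: sv_vars_def)
      show ?thesis
      proof (cases "i = i0")
        case True
        have "pd \<tau> F (W k) = (\<Sum>b\<le>n i0. if b = a then f b (pt y k) else 0)"
          unfolding pdF ia(1) True s0 sW by (intro sum.cong) auto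
        also have "\<dots> = f a (pt y k)" using ia True by simp
        finally show ?thesis using f ia True k by simp
      next
        case False
        then have i: "i = i1" using ia(2) by simp
        have "pd \<tau> F (W k) = (\<Sum>b\<le>n i0. if b = k mod 3 then pd a (f b) (pt y k) else 0)"
          unfolding pdF ia(1) i s1 W0 using ii(2) by (intro sum.cong) auto
        also have "\<dots> = pd a (f (k mod 3)) (pt y k)" using mod3 by simp
        finally show ?thesis using f mod3[of k] ia i n(2) k by simp
      qed
    qed
    then show "\<exists>F\<in>mforms r n d. \<forall>k<19. \<forall>\<tau>\<in>sv_vars r n. pd \<tau> F (W k) = (if k = j then \<xi> \<tau> else 0)"
      using Ff by blast
  qed
  moreover have "\<exists>a\<le>n i. W j (i, a) \<noteq> 0" if "j < 19" "i \<in> {1..r}" for j i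
  proof (cases "i = i0")
    case True
    then show ?thesis using mod3[of j] W0[of j "j mod 3"] by auto
  next
    case False
    then show ?thesis using y(2) that by (intro exI[of _ 0]) (simp add: W_def)
  qed
  ultimately show ?thesis by blast
qed

text \<open>With several factors, a nineteenth point can be added off the diagonal if lowering any
  one degree by 1 leaves either two positive degrees, or degree 8 in a single factor of dimension at
  least 3. Otherwise there are just two factors, of degrees 1 and 8, the latter being a
  plane.\<close>

lemma not_defective_2_9_19:
  assumes n: "n 1 = 2" "\<And>i. i \<in> {1..r} \<Longrightarrow> 2 \<le> n i" and d: "(\<Sum>i=1..r. d i) = 9" "\<And>i. i \<in> {1..r} \<Longrightarrow> d i \<ge> 1"
    and r: "r \<ge> 1"
  shows "\<not> defective (sv_index r n d) 19 (segre_veronese r n d)"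
proof (cases "r = 1")
  case True
  then show ?thesis using filling_2_9[of n d] n(1) d(1) by simp
next
  case False
  then have r2: "r \<ge> 2" using r by simp
  have "\<exists>p. diagonal r 2 18 n d p \<and> svfull r n d (\<lambda>j. diag (p j)) 18"
    by (rule diagonal_configuration[OF n(2) d(2) r]) (use d(1) dp_indep_2_9_18 in \<open>simp_all add: choose_two\<close>)
  then obtain p where p: "diagonal r 2 18 n d p" "svfull r n d (\<lambda>j. diag (p j)) 18" by blast
  have ne: "\<exists>a\<le>n i. diag (p j) (i, a) \<noteq> 0" if "j < 18" for i j
    using diagonal.p0[OF p(1) that] by (intro exI[of _ 0]) (simp add: diag_def)
  define e where "e i = d(i := d i - 1)" for i
  have e8: "(\<Sum>k=1..r. e i k) = 8" if "i \<in> {1..r}" for i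
    unfolding e_def using sum_decrease[OF that, of d] d that by simp
  define G where "G i \<longleftrightarrow> (\<exists>G\<in>mforms r n (d(i := d i - 1)). (\<exists>w. G w \<noteq> 0) \<and>
      (\<forall>j<18. G (diag (p j)) = 0 \<and> (\<forall>\<tau>\<in>sv_vars r n. pd \<tau> G (diag (p j)) = 0)))" for i
  show ?thesis
  proof (cases "\<forall>i\<in>{1..r}. G i")
    case True
    then have "\<not> defective (sv_index r n d) (Suc 18) (segre_veronese r n d)"
      by (intro not_defective_Suc[OF p(2) r d(2) ne]) (auto simp: G_def)
    then show ?thesis by simp
  next
    case False
    then obtain i where i: "i \<in> {1..r}" "\<not> G i" by blast
    have two: "e i a = 0 \<or> e i b = 0" if "a \<in> {1..r}" "b \<in> {1..r}" "a \<noteq> b" for a b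
    proof (rule ccontr)
      assume "\<not> ?thesis"
      then have "G i" unfolding G_def using double_minor[OF p(1) that, of "e i"] e8[OF i(1)] by (simp add: e_def)
      then show False using i(2) by simp
    qed
    define k :: nat where "k = (if i = 1 then 2 else 1)"
    have k: "k \<in> {1..r}" "k \<noteq> i" using r2 i(1) by (auto simp: k_def)
    have ek: "e i k \<noteq> 0" using d(2)[OF k(1)] k(2) by (simp add: e_def)
    have others: "b = i \<or> b = k" if "b \<in> {1..r}" for b
      using two[OF that k(1)] ek d(2)[OF that] by (auto simp: e_def split: if_splits)
    then have R: "{1..r} = {i, k}" using i(1) k(1) by blast
    have "e i i = 0" using two[OF i(1) k(1)] k(2) ek by auto
    then have di: "d i = 1" using d(2)[OF i(1)] by (simp add: e_def)
    have "(\<Sum>l=1..r. d l) = d i + d k" unfolding R using k(2) by simp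
    then have dk: "d k = 8" using di d(1) by simp
    show ?thesis
    proof (cases "n k \<ge> 3")
      case True
      have "G i" unfolding G_def
        using double_coordinate[OF p(1) k(1) True, of "e i"] e8[OF i(1)] k(2) dk by (simp add: e_def)
      then show ?thesis using i(2) by simp
    next
      case False
      then have "n k = 2" using n(2)[OF k(1)] by simp
      from split_1_8[OF R _ di dk n(2)[OF i(1)] this] obtain W where
        "svfull r n d W 19" "\<forall>j<19. \<forall>i\<in>{1..r}. \<exists>a\<le>n i. W j (i, a) \<noteq> 0" using k(2) by blast
      then show ?thesis by (intro svfull_not_defective[OF _ r d(2)]) auto
    qed
  qed
qed

text \<open>For \<open>n 1 = 2\<close> and total degree 9 the values up to 18 follow from eighteen
  independent double points on the diagonal, so that only \<open>h = 19\<close> goes to the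
  exceptional case.\<close>

lemma segre_veronese_not_defective:
  assumes r: "r \<ge> 1" and d1: "\<And>i. i \<in> {1..r} \<Longrightarrow> d i \<ge> 1" and n1: "n 1 \<ge> 1"
    and mn: "\<And>i. i \<in> {1..r} \<Longrightarrow> n 1 \<le> n i" and D: "(\<Sum>i=1..r. d i) \<ge> 3"
    and h: "h \<ge> 1" "h \<le> bsum (n 1) (((\<Sum>i=1..r. d i) - 1) div 2) + 1"
  shows "\<not> defective (sv_index r n d) h (segre_veronese r n d)"
proof -
  let ?D = "\<Sum>i=1..r. d i"
  define t where "t = (?D - 1) div 2"
  have t: "t \<ge> 1" "2 * t - 1 \<le> ?D - 2" using D by (auto simp: t_def)
  have ht: "h \<le> bsum (n 1) t + 1" using h(2) by (simp add: t_def)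
  show ?thesis
  proof (cases "n 1 = 2 \<and> ?D = 9 \<and> h = 19")
    case True
    then show ?thesis using not_defective_2_9_19[of n r d] mn d1 r by simp
  next
    case False
    have A: "dp_indep (n 1) ?D h"
    proof (cases "n 1 = 2 \<and> ?D = 9")
      case True
      then have "t = 4" by (simp add: t_def)
      then have "h \<le> 18" using ht True False bsum_small(4)[of 2] by auto
      then show ?thesis using True dp_indep_mono[OF dp_indep_2_9_18] by simp
    next
      case False
      show ?thesis using dp_indep_mono[OF dp_indep_bound[OF n1 D False]] ht by (simp add: t_def)
    qed
    have "bsum (n 1) t < (n 1 + (2 * t - 1)) choose n 1" by (rule bsum_less_choose'[OF n1 t(1)])
    also have "\<dots> \<le> (n 1 + (?D - 2)) choose n 1" by (rule binomial_right_mono) (use t(2) in simp)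
    finally have "h \<le> (n 1 + (?D - 2)) choose n 1" using ht by simp
    then have "\<exists>p. diagonal r (n 1) h n d p \<and> svfull r n d (\<lambda>j. diag (p j)) h"
      using D by (intro diagonal_configuration[OF mn d1 r _ A]) simp_all
    then obtain p where p: "diagonal r (n 1) h n d p" "svfull r n d (\<lambda>j. diag (p j)) h" by blast
    have "\<exists>a\<le>n i. diag (p j) (i, a) \<noteq> 0" if "j < h" for i j
      using diagonal.p0[OF p(1) that] by (intro exI[of _ 0]) (simp add: diag_def)
    then show ?thesis by (intro svfull_not_defective[OF p(2) r d1 h(1)])
  qed
qed

theorem theorem1p1:
  fixes r s h \<epsilon> :: nat and n d lam :: "nat \<Rightarrow> nat"
  assumes "r \<ge> 1"
    and "\<forall>i\<in>{1..r}. n i \<ge> 1 \<and> d i \<ge> 1"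
    and "\<forall>i\<in>{1..r}. \<forall>j\<in>{1..r}. i \<le> j \<longrightarrow> n i \<le> n j"
    and "(\<Sum>i=1..r. d i) \<ge> 3"
    and "(\<Sum>i=1..r. d i) - 1 = (\<Sum>k=1..s. 2 ^ lam k) + \<epsilon>"
    and "\<forall>k\<in>{1..s}. \<forall>m\<in>{1..s}. k < m \<longrightarrow> lam m < lam k"
    and "\<forall>k\<in>{1..s}. lam k \<ge> 1"
    and "\<epsilon> \<in> {0, 1}"
    and "h \<ge> 1"
    and "h \<le> n 1 * (\<Sum>k=1..s. (n 1 + 1) ^ (lam k - 1)) + 1"
  shows "\<not> defective (sv_index r n d) h (segre_veronese r n d)"
proof (rule segre_veronese_not_defective)
  \<comment> \<open>Halving \<open>d - 1\<close> removes \<epsilon> and lowers every exponent by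
    one. As the exponents are distinct and at least 1, the lowered ones are still distinct, which is
    what \<open>bsum_sum\<close> asks for.\<close>
  let ?L = "(\<lambda>k. lam k - 1) ` {1..s}"
  have inj: "inj_on (\<lambda>k. lam k - 1) {1..s}"
  proof (rule inj_onI)
    fix k m assume km: "k \<in> {1..s}" "m \<in> {1..s}" "lam k - 1 = lam m - 1"
    then have "lam k = lam m" using assms(7) by (metis le_add_diff_inverse)
    then show "k = m" using assms(6) km(1,2) by (metis linorder_neqE_nat nat_less_le)
  qed
  have "(\<Sum>k=1..s. 2 ^ lam k) = (2 :: nat) * (\<Sum>l\<in>?L. 2 ^ l)"
  proof -
    have "(2 :: nat) ^ lam k = 2 * 2 ^ (lam k - 1)" if "k \<in> {1..s}" for k
      using assms(7) that by (metis One_nat_def Suc_pred le_simps(3) power_Suc)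
    then have "(\<Sum>k=1..s. 2 ^ lam k) = (\<Sum>k=1..s. (2 :: nat) * 2 ^ (lam k - 1))" by (rule sum.cong[OF refl])
    also have "\<dots> = 2 * (\<Sum>l\<in>?L. 2 ^ l)"
      unfolding sum.reindex[OF inj] comp_def by (rule sum_distrib_left[symmetric])
    finally show ?thesis .
  qed
  then have "((\<Sum>i=1..r. d i) - 1) div 2 = (\<Sum>l\<in>?L. 2 ^ l)" using assms(5,8) by auto
  then have "bsum (n 1) (((\<Sum>i=1..r. d i) - 1) div 2) = n 1 * (\<Sum>k=1..s. (n 1 + 1) ^ (lam k - 1))"
    using sum.reindex[OF inj, of "\<lambda>l. (n 1 + 1) ^ l"] by (simp add: bsum_sum comp_def)
  then show "h \<le> bsum (n 1) (((\<Sum>i=1..r. d i) - 1) div 2) + 1" using assms(10) by simp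
qed (use assms in auto)

end
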